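(* Let $T\in\mathcal{BC}(X)$ be such that $T=T_0+T_1e_1+T_2e_2$, and assume that the operators $T_\ell$, $\ell=0,1,2$, have real spectrum. (i) Let $\breve f^\circ=\overline{\mathcal D}f$ with $f\in SH_L(\sigma_S(T))$ and assume that $f(q)=\sum_{m=0}^\infty q^ma_m$ with $a_m\in\mathbb H$, where this series converges on a ball $B_r(0)$ with $\sigma_S(T)\subset B_r(0)$. Then $$\breve f^\circ(T)=2\sum_{m=1}^\infty\Big(mT^{m-1}+\sum_{k=1}^mT^{m-k}\overline T^{\,k-1}\Big)a_m.$$ (ii) Let $\breve f^\circ=f\overline{\mathcal D}$ with $f\in SH_R(\sigma_S(T))$ and assume that $f(q)=\sum_{m=0}^\infty a_mq^m$ with $a_m\in\mathbb H$, where this series converges on a ball $B_r(0)$ with $\sigma_S(T)\subset B_r(0)$. Then $$\breve f^\circ(T)=2\sum_{m=1}^\infty a_m\Big(mT^{m-1}+\sum_{k=1}^mT^{m-k}\overline T^{\,k-1}\Big).$$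
   Context: $\mathbb H$: quaternions with units $e_1,e_2,e_3$. $\mathbb S$: imaginary units ($J^2=-1$). $\mathbb C_J=\mathbb R+J\mathbb R$. $B_r(0)$: open ball of radius $r$ centered at $0$ in $\mathbb H$. $\overline{\mathcal D}=\partial_{q_0}-\sum_{i=1}^3e_i\partial_{q_i}$ (acting from the left as $\overline{\mathcal D}f$, from the right as $f\overline{\mathcal D}$). A set $U\subseteq\mathbb H$ is axially symmetric if $u+Iv\in U$ implies $u+Jv\in U$ for all $J\in\mathbb S$. A slice Cauchy domain is an axially symmetric open $U$ such that for every $J\in\mathbb S$ the boundary of $U\cap\mathbb C_J$ is a finite union of nonintersecting piecewise $C^1$ Jordan curves. On an axially symmetric open $U$, $f$ is left (right) slice hyperholomorphic if $f(u+Jv)=\alpha(u,v)+J\beta(u,v)$ (resp. $\alpha(u,v)+\beta(u,v)J$) with $\mathbb H$-valued differentiable $\alpha$ even in $v$, $\beta$ odd in $v$, and $\partial_u\alpha=\partial_v\beta$, $\partial_v\alpha=-\partial_u\beta$. $X=X_{\mathbb R}\otimes\mathbb H$ is a two-sided quaternionic Banach module, $X_{\mathbb R}$ a real Banach space; $\mathcal B(X)$ is the space of bounded right linear operators; $(aT)(x)=aT(x)$, $(Ta)(x)=T(ax)$ for $a\in\mathbb H$. $\mathcal{BC}(X)$: operators $T=T_0+T_1e_1+T_2e_2+T_3e_3$ with pairwise commuting $T_i\in\mathcal B(X_{\mathbb R})$; $\overline T=T_0-T_1e_1-T_2e_2-T_3e_3$. $\rho_S(T)=\{s\in\mathbb H:(T^2-2\mathrm{Re}(s)T+|s|^2\mathcal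 I)^{-1}\in\mathcal B(X)\}$, $\sigma_S(T)=\mathbb H\setminus\rho_S(T)$; for $T\in\mathcal{BC}(X)$, $\rho_S(T)$ is also the set of $s$ with $\mathcal Q_{c,s}(T):=s^2-s(T+\overline T)+T\overline T$ invertible in $\mathcal B(X)$. $SH_L(\sigma_S(T))$, $SH_R(\sigma_S(T))$: left, right slice hyperholomorphic functions whose (axially symmetric open) domain contains $\sigma_S(T)$. For $s\in\rho_S(T)$: $F_L(s,T)=-4(s\mathcal I-\overline T)\mathcal Q_{c,s}(T)^{-2}$, $F_R(s,T)=-4\mathcal Q_{c,s}(T)^{-2}(s\mathcal I-\overline T)$, $\mathcal P^L_2(s,T)=-F_L(s,T)s+T_0F_L(s,T)$, $\mathcal P^R_2(s,T)=-sF_R(s,T)+T_0F_R(s,T)$. $P_2$-functional calculus: for $J\in\mathbb S$, $ds_J=ds(-J)$ and $U$ a bounded slice Cauchy domain with $\sigma_S(T)\subset U$, $\overline U\subset\mathrm{dom}(f)$ (no dependence on $U,J$): if $\breve f^\circ=\overline{\mathcal D}f$, $f\in SH_L(\sigma_S(T))$, then $\breve f^\circ(T):=\frac1{2\pi}\int_{\partial(U\cap\mathbb C_J)}\mathcal P^L_2(s,T)ds_Jf(s)$; if $\breve f^\circ=f\overline{\mathcal D}$, $f\in SH_R(\sigma_S(T))$, then $\breve f^\circ(T):=\frac1{2\pi}\int_{\partial(U\cap\mathbb C_J)}f(s)ds_J\mathcal P^R_2(s,T)$. *)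

theory Defs
  imports "HOL-Complex_Analysis.Complex_Analysis"
begin

section \<open>Quaternions\<close>

datatype quat = Quat (qc0: real) (qc1: real) (qc2: real) (qc3: real)

lemma quat_eq_iff: "p = q \<longleftrightarrow> qc0 p = qc0 q \<and> qc1 p = qc1 q \<and> qc2 p = qc2 q \<and> qc3 p = qc3 q"
  by (cases p; cases q) simp

instantiation quat :: ab_group_add
begin
definition "0 = Quat 0 0 0 0"
definition "p + q = Quat (qc0 p + qc0 q) (qc1 p + qc1 q) (qc2 p + qc2 q) (qc3 p + qc3 q)"
definition "p - q = Quat (qc0 p - qc0 q) (qc1 p - qc1 q) (qc2 p - qc2 q) (qc3 p - qc3 q)"
definition "- p = Quat (- qc0 p) (- qc1 p) (- qc2 p) (- qc3 p)"
instance
  by standard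
    (simp_all add: quat_eq_iff zero_quat_def plus_quat_def minus_quat_def uminus_quat_def)
end

instantiation quat :: ring_1
begin
definition "1 = Quat 1 0 0 0"
definition "p * q = Quat
  (qc0 p * qc0 q - qc1 p * qc1 q - qc2 p * qc2 q - qc3 p * qc3 q)
  (qc0 p * qc1 q + qc1 p * qc0 q + qc2 p * qc3 q - qc3 p * qc2 q)
  (qc0 p * qc2 q - qc1 p * qc3 q + qc2 p * qc0 q + qc3 p * qc1 q)
  (qc0 p * qc3 q + qc1 p * qc2 q - qc2 p * qc1 q + qc3 p * qc0 q)"
instance
  by standard
    (simp_all add: quat_eq_iff zero_quat_def plus_quat_def one_quat_def times_quat_def algebra_simps)
end

instantiation quat :: real_algebra_1
begin
definition "r *\<^sub>R q = Quat (r * qc0 q) (r * qc1 q) (r * qc2 q) (r * qc3 q)"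
instance
  by standard
    (simp_all add: quat_eq_iff plus_quat_def times_quat_def scaleR_quat_def algebra_simps)
end

lemmas quat_arith_defs = zero_quat_def plus_quat_def minus_quat_def uminus_quat_def
  one_quat_def times_quat_def scaleR_quat_def

instantiation quat :: real_inner
begin
definition inner_quat :: "quat \<Rightarrow> quat \<Rightarrow> real" where
  "inner_quat p q = qc0 p * qc0 q + qc1 p * qc1 q + qc2 p * qc2 q + qc3 p * qc3 q"
definition norm_quat :: "quat \<Rightarrow> real" where
  "norm_quat q = sqrt (inner q q)"
definition dist_quat :: "quat \<Rightarrow> quat \<Rightarrow> real" where
  "dist_quat p q = norm (p - q)"
definition sgn_quat :: "quat \<Rightarrow> quat" where
  "sgn_quat q = q /\<^sub>R norm q"
definition uniformity_quat :: "(quat \<times> quat) filter" where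
  "uniformity_quat = (INF e\<in>{0 <..}. principal {(x, y). dist x y < e})"
definition open_quat :: "quat set \<Rightarrow> bool" where
  "open_quat U \<longleftrightarrow> (\<forall>x\<in>U. eventually (\<lambda>(x', y). x' = x \<longrightarrow> y \<in> U) uniformity)"
instance
proof
  fix x y z :: quat and r :: real and U :: "quat set"
  show "dist x y = norm (x - y)" "sgn x = x /\<^sub>R norm x" "norm x = sqrt (inner x x)"
    "uniformity = (INF e\<in>{0 <..}. principal {(x :: quat, y). dist x y < e})"
    "open U \<longleftrightarrow> (\<forall>x\<in>U. eventually (\<lambda>(x', y). x' = x \<longrightarrow> y \<in> U) uniformity)"
    by (rule dist_quat_def sgn_quat_def norm_quat_def uniformity_quat_def open_quat_def)+
  show "inner x y = inner y x" "inner (x + y) z = inner x z + inner y z"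
    "inner (r *\<^sub>R x) y = r * inner x y" "0 \<le> inner x x"
    by (simp_all add: inner_quat_def quat_arith_defs algebra_simps)
  show "inner x x = 0 \<longleftrightarrow> x = 0"
    by (simp add: inner_quat_def quat_arith_defs quat_eq_iff add_nonneg_eq_0_iff)
qed
end

instantiation quat :: inverse
begin
definition inverse_quat :: "quat \<Rightarrow> quat" where
  "inverse_quat q = Quat (qc0 q) (- qc1 q) (- qc2 q) (- qc3 q) /\<^sub>R inner q q"
definition divide_quat :: "quat \<Rightarrow> quat \<Rightarrow> quat" where
  "divide_quat p q = p * inverse q"
instance ..
end

lemma four_squares_identity:
  fixes a0 a1 a2 a3 b0 b1 b2 b3 :: real
  shows "(a0 * b0 - a1 * b1 - a2 * b2 - a3 * b3)\<^sup>2 + (a0 * b1 + a1 * b0 + a2 * b3 - a3 * b2)\<^sup>2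
    + (a0 * b2 - a1 * b3 + a2 * b0 + a3 * b1)\<^sup>2 + (a0 * b3 + a1 * b2 - a2 * b1 + a3 * b0)\<^sup>2
    = (a0\<^sup>2 + a1\<^sup>2 + a2\<^sup>2 + a3\<^sup>2) * (b0\<^sup>2 + b1\<^sup>2 + b2\<^sup>2 + b3\<^sup>2)"
  by algebra

instance quat :: real_normed_div_algebra
proof
  fix a b :: quat
  show "a / b = a * inverse b" "inverse (0 :: quat) = 0"
    by (simp_all add: divide_quat_def inverse_quat_def quat_arith_defs)
  define c where "c = Quat (qc0 a) (- qc1 a) (- qc2 a) (- qc3 a)"
  have "c * a = inner a a *\<^sub>R 1" "a * c = inner a a *\<^sub>R 1"
    by (simp_all add: c_def quat_eq_iff quat_arith_defs inner_quat_def)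
  then show "inverse a * a = 1" "a * inverse a = 1" if "a \<noteq> 0"
    using that by (simp_all add: inverse_quat_def flip: c_def)
  have "inner (a * b) (a * b) = inner a a * inner b b"
    unfolding inner_quat_def times_quat_def quat.sel power2_eq_square[symmetric]
    by (rule four_squares_identity)
  then show "norm (a * b) = norm a * norm b"
    by (simp only: norm_quat_def real_sqrt_mult)
qed

abbreviation qe1 :: quat where "qe1 \<equiv> Quat 0 1 0 0"
abbreviation qe2 :: quat where "qe2 \<equiv> Quat 0 0 1 0"
abbreviation qe3 :: quat where "qe3 \<equiv> Quat 0 0 0 1"

instantiation quat :: euclidean_space
begin
definition "Basis = {1, qe1, qe2, qe3}"
instance
proof
  show "(Basis :: quat set) \<noteq> {}" "finite (Basis :: quat set)"
    by (simp_all add: Basis_quat_def)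
  show "inner u v = (if u = v then 1 else 0)" if "u \<in> Basis" "v \<in> Basis" for u v :: quat
    using that unfolding Basis_quat_def inner_quat_def one_quat_def
    by (elim insertE emptyE; hypsubst; simp)
  show "(\<forall>u\<in>Basis. inner x u = 0) \<longleftrightarrow> x = 0" for x :: quat
    by (cases x) (simp add: Basis_quat_def inner_quat_def one_quat_def zero_quat_def)
qed
end

definition imag_units :: "quat set" where
  "imag_units = {J. J * J = -1}"

definition slice_embed :: "quat \<Rightarrow> complex \<Rightarrow> quat" where
  "slice_embed J z = of_real (Re z) + J * of_real (Im z)"

text \<open>\<open>U \<inter> \<complex>\<^sub>J\<close>, regarded as a subset of the complex plane via \<open>u + iv \<mapsto> u + Jv\<close>.\<close>

definition slice :: "quat \<Rightarrow> quat set \<Rightarrow> complex set" where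
  "slice J U = slice_embed J -` U"


section \<open>Slice hyperholomorphic functions\<close>

definition axially_symmetric :: "quat set \<Rightarrow> bool" where
  "axially_symmetric U \<longleftrightarrow>
    (\<forall>u v. \<forall>I\<in>imag_units. of_real u + I * of_real v \<in> U \<longrightarrow>
       (\<forall>J\<in>imag_units. of_real u + J * of_real v \<in> U))"

definition slice_pair :: "quat set \<Rightarrow> (real \<times> real \<Rightarrow> quat) \<Rightarrow> (real \<times> real \<Rightarrow> quat) \<Rightarrow> bool" where
  "slice_pair U \<alpha> \<beta> \<longleftrightarrow>
    (\<forall>u v. \<forall>J\<in>imag_units. of_real u + J * of_real v \<in> U \<longrightarrow>
       \<alpha> differentiable (at (u, v)) \<and> \<beta> differentiable (at (u, v)) \<and>
       \<alpha> (u, - v) = \<alpha> (u, v) \<and> \<beta> (u, - v) = - \<beta> (u, v) \<and>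
       frechet_derivative \<alpha> (at (u, v)) (1, 0) = frechet_derivative \<beta> (at (u, v)) (0, 1) \<and>
       frechet_derivative \<alpha> (at (u, v)) (0, 1) = - frechet_derivative \<beta> (at (u, v)) (1, 0))"

definition slice_hyperholomorphic_left :: "quat set \<Rightarrow> (quat \<Rightarrow> quat) \<Rightarrow> bool" where
  "slice_hyperholomorphic_left U f \<longleftrightarrow> open U \<and> axially_symmetric U \<and>
    (\<exists>\<alpha> \<beta>. slice_pair U \<alpha> \<beta> \<and>
      (\<forall>u v. \<forall>J\<in>imag_units. of_real u + J * of_real v \<in> U \<longrightarrow>
         f (of_real u + J * of_real v) = \<alpha> (u, v) + J * \<beta> (u, v)))"

definition slice_hyperholomorphic_right :: "quat set \<Rightarrow> (quat \<Rightarrow> quat) \<Rightarrow> bool" where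
  "slice_hyperholomorphic_right U f \<longleftrightarrow> open U \<and> axially_symmetric U \<and>
    (\<exists>\<alpha> \<beta>. slice_pair U \<alpha> \<beta> \<and>
      (\<forall>u v. \<forall>J\<in>imag_units. of_real u + J * of_real v \<in> U \<longrightarrow>
         f (of_real u + J * of_real v) = \<alpha> (u, v) + \<beta> (u, v) * J))"

definition qpartial :: "quat \<Rightarrow> (quat \<Rightarrow> quat) \<Rightarrow> quat \<Rightarrow> quat" where
  "qpartial e f q = vector_derivative (\<lambda>t. f (q + t *\<^sub>R e)) (at 0)"

definition Dbar_left :: "(quat \<Rightarrow> quat) \<Rightarrow> quat \<Rightarrow> quat" where
  "Dbar_left f q = qpartial 1 f q
     - (qe1 * qpartial qe1 f q + qe2 * qpartial qe2 f q + qe3 * qpartial qe3 f q)"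

definition Dbar_right :: "(quat \<Rightarrow> quat) \<Rightarrow> quat \<Rightarrow> quat" where
  "Dbar_right f q = qpartial 1 f q
     - (qpartial qe1 f q * qe1 + qpartial qe2 f q * qe2 + qpartial qe3 f q * qe3)"


section \<open>Slice Cauchy domains and oriented boundaries\<close>

definition Jordan_boundary :: "complex set \<Rightarrow> (real \<Rightarrow> complex) set \<Rightarrow> bool" where
  "Jordan_boundary D G \<longleftrightarrow> finite G \<and>
     (\<forall>\<gamma>\<in>G. valid_path \<gamma> \<and> simple_path \<gamma> \<and> pathfinish \<gamma> = pathstart \<gamma>) \<and>
     pairwise (\<lambda>\<gamma> \<delta>. path_image \<gamma> \<inter> path_image \<delta> = {}) G \<and>
     frontier D = (\<Union>\<gamma>\<in>G. path_image \<gamma>)"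

definition slice_Cauchy_domain :: "quat set \<Rightarrow> bool" where
  "slice_Cauchy_domain U \<longleftrightarrow> open U \<and> axially_symmetric U \<and>
     (\<forall>J\<in>imag_units. \<exists>G. Jordan_boundary (slice J U) G)"

text \<open>The positive orientation of the boundary of a planar domain \<open>D\<close>: as a cycle, the
  boundary curves wind once around the points of \<open>D\<close> and not at all around the points
  outside \<open>closure D\<close>.\<close>

definition positively_oriented_boundary :: "complex set \<Rightarrow> (real \<Rightarrow> complex) set \<Rightarrow> bool" where
  "positively_oriented_boundary D G \<longleftrightarrow> Jordan_boundary D G \<and>
     (\<forall>z. z \<notin> frontier D \<longrightarrow> (\<Sum>\<gamma>\<in>G. winding_number \<gamma> z) = (if z \<in> D then 1 else 0))"


section \<open>The quaternionic module and its operators\<close>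

text \<open>\<open>X = X\<^sub>\<real> \<otimes> \<H>\<close>: the tuple \<open>(x\<^sub>0, x\<^sub>1, x\<^sub>2, x\<^sub>3)\<close> stands for
  \<open>x\<^sub>0 + x\<^sub>1 e\<^sub>1 + x\<^sub>2 e\<^sub>2 + x\<^sub>3 e\<^sub>3\<close>. The product norm is the Euclidean combination of the norms
  of the components.\<close>

type_synonym 'a hmod = "'a \<times> 'a \<times> 'a \<times> 'a"
type_synonym 'a hop = "'a hmod \<Rightarrow>\<^sub>L 'a hmod"

definition hmod_rmult :: "'a::real_vector hmod \<Rightarrow> quat \<Rightarrow> 'a hmod" where
  "hmod_rmult = (\<lambda>(x0, x1, x2, x3) a.
    (qc0 a *\<^sub>R x0 - qc1 a *\<^sub>R x1 - qc2 a *\<^sub>R x2 - qc3 a *\<^sub>R x3,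
     qc1 a *\<^sub>R x0 + qc0 a *\<^sub>R x1 + qc3 a *\<^sub>R x2 - qc2 a *\<^sub>R x3,
     qc2 a *\<^sub>R x0 - qc3 a *\<^sub>R x1 + qc0 a *\<^sub>R x2 + qc1 a *\<^sub>R x3,
     qc3 a *\<^sub>R x0 + qc2 a *\<^sub>R x1 - qc1 a *\<^sub>R x2 + qc0 a *\<^sub>R x3))"

text \<open>Left multiplication by \<open>a\<close>, as an operator on \<open>X\<close>. Thus \<open>aT\<close> is \<open>lmult a o\<^sub>L T\<close>
  and \<open>Ta\<close> is \<open>T o\<^sub>L lmult a\<close>.\<close>

lift_definition lmult :: "quat \<Rightarrow> 'a::real_normed_vector hop" is
  "\<lambda>a (x0, x1, x2, x3).
    (qc0 a *\<^sub>R x0 - qc1 a *\<^sub>R x1 - qc2 a *\<^sub>R x2 - qc3 a *\<^sub>R x3,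
     qc1 a *\<^sub>R x0 + qc0 a *\<^sub>R x1 - qc3 a *\<^sub>R x2 + qc2 a *\<^sub>R x3,
     qc2 a *\<^sub>R x0 + qc3 a *\<^sub>R x1 + qc0 a *\<^sub>R x2 - qc1 a *\<^sub>R x3,
     qc3 a *\<^sub>R x0 - qc2 a *\<^sub>R x1 + qc1 a *\<^sub>R x2 + qc0 a *\<^sub>R x3)"
  unfolding case_prod_beta
  by (intro bounded_linear_Pair bounded_linear_add bounded_linear_sub bounded_linear_const_scaleR
      bounded_linear_fst_comp bounded_linear_snd_comp bounded_linear_ident)

text \<open>The componentwise extension to \<open>X\<close> of an operator on \<open>X\<^sub>\<real>\<close>.\<close>

lift_definition extend_op :: "('a::real_normed_vector \<Rightarrow>\<^sub>L 'a) \<Rightarrow> 'a hop" is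
  "\<lambda>A (x0, x1, x2, x3). (A x0, A x1, A x2, A x3)"
  unfolding case_prod_beta
  by (intro bounded_linear_Pair; erule bounded_linear_compose;
      intro bounded_linear_fst_comp bounded_linear_snd_comp bounded_linear_ident)

definition op_of_components ::
  "('a::real_normed_vector \<Rightarrow>\<^sub>L 'a) \<Rightarrow> ('a \<Rightarrow>\<^sub>L 'a) \<Rightarrow> ('a \<Rightarrow>\<^sub>L 'a) \<Rightarrow> ('a \<Rightarrow>\<^sub>L 'a) \<Rightarrow> 'a hop" where
  "op_of_components A0 A1 A2 A3 = extend_op A0 + (extend_op A1 o\<^sub>L lmult qe1)
     + (extend_op A2 o\<^sub>L lmult qe2) + (extend_op A3 o\<^sub>L lmult qe3)"

definition BX :: "'a::real_normed_vector hop set" where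
  "BX = {A :: 'a hop. \<forall>x a. A (hmod_rmult x a) = hmod_rmult (A x) a}"

definition BCX :: "'a::real_normed_vector hop set" where
  "BCX = {op_of_components A0 A1 A2 A3 | A0 A1 A2 A3.
     \<forall>A\<in>{A0, A1, A2, A3}. \<forall>B\<in>{A0, A1, A2, A3}. A o\<^sub>L B = B o\<^sub>L A}"

text \<open>The components of an operator are read off from its action on \<open>X\<^sub>\<real> \<otimes> 1\<close>,
  see \<open>op_component_op_of_components\<close>.\<close>

lift_definition real_embed :: "'a::real_normed_vector \<Rightarrow>\<^sub>L 'a hmod" is "\<lambda>x. (x, 0, 0, 0)"
  by (intro bounded_linear_Pair bounded_linear_zero bounded_linear_ident)

definition op_component0 :: "'a::real_normed_vector hop \<Rightarrow> ('a \<Rightarrow>\<^sub>L 'a)" where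
  "op_component0 T = fst_blinfun o\<^sub>L T o\<^sub>L real_embed"
definition op_component1 :: "'a::real_normed_vector hop \<Rightarrow> ('a \<Rightarrow>\<^sub>L 'a)" where
  "op_component1 T = fst_blinfun o\<^sub>L snd_blinfun o\<^sub>L T o\<^sub>L real_embed"
definition op_component2 :: "'a::real_normed_vector hop \<Rightarrow> ('a \<Rightarrow>\<^sub>L 'a)" where
  "op_component2 T = fst_blinfun o\<^sub>L snd_blinfun o\<^sub>L snd_blinfun o\<^sub>L T o\<^sub>L real_embed"
definition op_component3 :: "'a::real_normed_vector hop \<Rightarrow> ('a \<Rightarrow>\<^sub>L 'a)" where
  "op_component3 T = snd_blinfun o\<^sub>L snd_blinfun o\<^sub>L snd_blinfun o\<^sub>L T o\<^sub>L real_embed"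

lemma op_component_op_of_components [simp]:
  "op_component0 (op_of_components A0 A1 A2 A3) = A0"
  "op_component1 (op_of_components A0 A1 A2 A3) = A1"
  "op_component2 (op_of_components A0 A1 A2 A3) = A2"
  "op_component3 (op_of_components A0 A1 A2 A3) = A3"
  by (rule blinfun_eqI; simp add: op_component0_def op_component1_def op_component2_def
      op_component3_def op_of_components_def real_embed.rep_eq extend_op.rep_eq lmult.rep_eq
      plus_blinfun.rep_eq blinfun.zero_right)+

definition op_conj :: "'a::real_normed_vector hop \<Rightarrow> 'a hop" where
  "op_conj T = op_of_components (op_component0 T)
     (- op_component1 T) (- op_component2 T) (- op_component3 T)"

definition op_scalar_part :: "'a::real_normed_vector hop \<Rightarrow> 'a hop" where
  "op_scalar_part T = extend_op (op_component0 T)"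

primrec op_pow :: "'a::real_normed_vector hop \<Rightarrow> nat \<Rightarrow> 'a hop" where
  "op_pow T 0 = id_blinfun"
| "op_pow T (Suc n) = T o\<^sub>L op_pow T n"

definition is_inverse_in_BX :: "'a::real_normed_vector hop \<Rightarrow> 'a hop \<Rightarrow> bool" where
  "is_inverse_in_BX A R \<longleftrightarrow> R \<in> BX \<and> A o\<^sub>L R = id_blinfun \<and> R o\<^sub>L A = id_blinfun"

definition op_inverse :: "'a::real_normed_vector hop \<Rightarrow> 'a hop" where
  "op_inverse A = (THE R. is_inverse_in_BX A R)"


section \<open>Spectra\<close>

text \<open>The spectrum of an operator on a real Banach space is that of its complexification;
  a pair \<open>(x, y)\<close> stands for \<open>x + iy\<close>, and the operator below is
  \<open>\<lambda>\<I> - A\<close> with \<open>\<lambda> = u + iv\<close>.\<close>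

lift_definition complexified_pencil ::
    "('a::real_normed_vector \<Rightarrow>\<^sub>L 'a) \<Rightarrow> complex \<Rightarrow> ('a \<times> 'a) \<Rightarrow>\<^sub>L ('a \<times> 'a)" is
  "\<lambda>A l (x, y). (Re l *\<^sub>R x - Im l *\<^sub>R y - A x, Im l *\<^sub>R x + Re l *\<^sub>R y - A y)"
  unfolding case_prod_beta
  by (intro bounded_linear_Pair bounded_linear_add bounded_linear_sub bounded_linear_const_scaleR
      bounded_linear_fst_comp bounded_linear_snd_comp bounded_linear_ident;
      erule bounded_linear_compose;
      intro bounded_linear_fst_comp bounded_linear_snd_comp bounded_linear_ident)

definition complex_spectrum :: "('a::real_normed_vector \<Rightarrow>\<^sub>L 'a) \<Rightarrow> complex set" where
  "complex_spectrum A = {l. \<not> (\<exists>R. complexified_pencil A l o\<^sub>L R = id_blinfun \<and>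
                                   R o\<^sub>L complexified_pencil A l = id_blinfun)}"

definition S_resolvent_set :: "'a::real_normed_vector hop \<Rightarrow> quat set" where
  "S_resolvent_set T = {s. \<exists>R. is_inverse_in_BX
     ((T o\<^sub>L T) - (2 * qc0 s) *\<^sub>R T + (norm s)\<^sup>2 *\<^sub>R id_blinfun) R}"

definition S_spectrum :: "'a::real_normed_vector hop \<Rightarrow> quat set" where
  "S_spectrum T = - S_resolvent_set T"


section \<open>The \<open>P\<^sub>2\<close>-functional calculus\<close>

definition Q_c :: "quat \<Rightarrow> 'a::real_normed_vector hop \<Rightarrow> 'a hop" where
  "Q_c s T = lmult (s\<^sup>2) - (lmult s o\<^sub>L (T + op_conj T)) + (T o\<^sub>L op_conj T)"

definition F_left :: "quat \<Rightarrow> 'a::real_normed_vector hop \<Rightarrow> 'a hop" where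
  "F_left s T = -4 *\<^sub>R ((lmult s - op_conj T) o\<^sub>L op_pow (op_inverse (Q_c s T)) 2)"

definition F_right :: "quat \<Rightarrow> 'a::real_normed_vector hop \<Rightarrow> 'a hop" where
  "F_right s T = -4 *\<^sub>R (op_pow (op_inverse (Q_c s T)) 2 o\<^sub>L (lmult s - op_conj T))"

definition P2_left :: "quat \<Rightarrow> 'a::real_normed_vector hop \<Rightarrow> 'a hop" where
  "P2_left s T = - (F_left s T o\<^sub>L lmult s) + (op_scalar_part T o\<^sub>L F_left s T)"

definition P2_right :: "quat \<Rightarrow> 'a::real_normed_vector hop \<Rightarrow> 'a hop" where
  "P2_right s T = - (lmult s o\<^sub>L F_right s T) + (op_scalar_part T o\<^sub>L F_right s T)"

text \<open>\<open>ds\<^sub>J = ds(-J)\<close> along a parametrised curve \<open>s = \<gamma>(t)\<close> in \<open>\<complex>\<^sub>J\<close>.\<close>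

definition ds_slice :: "quat \<Rightarrow> (real \<Rightarrow> complex) \<Rightarrow> real \<Rightarrow> quat" where
  "ds_slice J \<gamma> t = slice_embed J (vector_derivative \<gamma> (at t within {0..1})) * (- J)"

definition P2_integrand_left ::
    "'a::real_normed_vector hop \<Rightarrow> (quat \<Rightarrow> quat) \<Rightarrow> quat \<Rightarrow> (real \<Rightarrow> complex) \<Rightarrow> real \<Rightarrow> 'a hop" where
  "P2_integrand_left T f J \<gamma> t = P2_left (slice_embed J (\<gamma> t)) T
     o\<^sub>L lmult (ds_slice J \<gamma> t) o\<^sub>L lmult (f (slice_embed J (\<gamma> t)))"

definition P2_integrand_right ::
    "'a::real_normed_vector hop \<Rightarrow> (quat \<Rightarrow> quat) \<Rightarrow> quat \<Rightarrow> (real \<Rightarrow> complex) \<Rightarrow> real \<Rightarrow> 'a hop" where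
  "P2_integrand_right T f J \<gamma> t = lmult (f (slice_embed J (\<gamma> t)))
     o\<^sub>L lmult (ds_slice J \<gamma> t) o\<^sub>L P2_right (slice_embed J (\<gamma> t)) T"

definition admissible_contour ::
    "'a::real_normed_vector hop \<Rightarrow> quat set \<Rightarrow> quat \<Rightarrow> quat set \<Rightarrow> (real \<Rightarrow> complex) set \<Rightarrow> bool" where
  "admissible_contour T W J U G \<longleftrightarrow> J \<in> imag_units \<and>
     slice_Cauchy_domain U \<and> bounded U \<and> S_spectrum T \<subseteq> U \<and> closure U \<subseteq> W \<and>
     positively_oriented_boundary (slice J U) G"

text \<open>\<open>P2_value_left T W g A\<close> says that \<open>A\<close> is the value \<open>g(T)\<close> of the calculus at the
  function \<open>g\<close> on \<open>W\<close>: all admissible data (a left slice hyperholomorphic \<open>f\<close> on \<open>W\<close> with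
  \<open>g = Dbar_left f\<close>, an imaginary unit, a slice Cauchy domain, a parametrisation of the positively
  oriented boundary) yield \<open>A\<close>, and such data exist. So \<open>A\<close> is unique.\<close>

definition P2_value_left ::
    "'a::real_normed_vector hop \<Rightarrow> quat set \<Rightarrow> (quat \<Rightarrow> quat) \<Rightarrow> 'a hop \<Rightarrow> bool" where
  "P2_value_left T W g A \<longleftrightarrow> S_spectrum T \<subseteq> W \<and>
     (\<exists>f. slice_hyperholomorphic_left W f \<and> (\<forall>q\<in>W. g q = Dbar_left f q)) \<and>
     (\<exists>J U G. admissible_contour T W J U G) \<and>
     (\<forall>f J U G. slice_hyperholomorphic_left W f \<and> (\<forall>q\<in>W. g q = Dbar_left f q) \<and>
        admissible_contour T W J U G \<longrightarrow>
        (\<forall>\<gamma>\<in>G. P2_integrand_left T f J \<gamma> integrable_on {0..1}) \<and>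
        A = (1 / (2 * pi)) *\<^sub>R (\<Sum>\<gamma>\<in>G. integral {0..1} (P2_integrand_left T f J \<gamma>)))"

definition P2_value_right ::
    "'a::real_normed_vector hop \<Rightarrow> quat set \<Rightarrow> (quat \<Rightarrow> quat) \<Rightarrow> 'a hop \<Rightarrow> bool" where
  "P2_value_right T W g A \<longleftrightarrow> S_spectrum T \<subseteq> W \<and>
     (\<exists>f. slice_hyperholomorphic_right W f \<and> (\<forall>q\<in>W. g q = Dbar_right f q)) \<and>
     (\<exists>J U G. admissible_contour T W J U G) \<and>
     (\<forall>f J U G. slice_hyperholomorphic_right W f \<and> (\<forall>q\<in>W. g q = Dbar_right f q) \<and>
        admissible_contour T W J U G \<longrightarrow>
        (\<forall>\<gamma>\<in>G. P2_integrand_right T f J \<gamma> integrable_on {0..1}) \<and>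
        A = (1 / (2 * pi)) *\<^sub>R (\<Sum>\<gamma>\<in>G. integral {0..1} (P2_integrand_right T f J \<gamma>)))"

definition P2_power :: "'a::real_normed_vector hop \<Rightarrow> nat \<Rightarrow> 'a hop" where
  "P2_power T m = real m *\<^sub>R op_pow T (m - 1)
     + (\<Sum>k=1..m. op_pow T (m - k) o\<^sub>L op_pow (op_conj T) (k - 1))"

end

theory Submission
  imports Defs
begin

text \<open>
  Write \<open>T*\<close> for the conjugate of \<open>T\<close> and \<open>N = T T*\<close>. Since \<open>T\<close> has no third component, \<open>T* = - e\<^sub>3 T e\<^sub>3\<close>,
  and the identity \<open>Q\<^sub>c(s) Q\<^sub>c(s*) = Q\<^sub>s(T) Q\<^sub>s(T*)\<close>, where \<open>Q\<^sub>s(T) = T\<^sup>2 - 2 Re(s) T + |s|\<^sup>2\<close>, shows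
  that \<open>Q\<^sub>c(s)\<close> has an inverse \<open>R(s)\<close> off the S-spectrum. There \<open>R' = -2 (s - T\<^sub>0) R\<^sup>2\<close>, so both kernels \<open>P\<^sub>2\<close>
  equal \<open>-2 (s R' - T* R')\<close>, with \<open>s\<close> and \<open>T*\<close> acting from the appropriate sides. Integration by parts
  reduces the moments of \<open>P\<^sub>2\<close> on a large circle to the moments \<open>M(n)\<close> of \<open>R\<close>, which satisfy
  \<open>M(n+2) = 2 T\<^sub>0 M(n+1) - N M(n)\<close> and hence are the sums over \<open>k\<close> in the assertion.

  On the complex plane of an imaginary unit \<open>J\<close> a slice hyperholomorphic function splits into two
  holomorphic functions, and the operators form a complex Banach space under multiplication by \<open>J\<close>.
  Cauchy's theorem for cycles (by Dixon's argument), transferred to operator values by means of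
  bounded functionals, replaces any admissible contour by a circle inside the ball of convergence.
  Two slice hyperholomorphic functions with the same image under the conjugate Fueter operator differ
  by a constant on the ball, and constants contribute nothing because the moment of order \<open>0\<close> is zero.
\<close>

section \<open>Separation of points by bounded functionals\<close>

text \<open>The contour is a finite family of Jordan curves, possibly leaving the ball of
  convergence, and the slice of the domain need not be simply connected; hence the homological form
  of Cauchy's theorem. Operator identities and integrals are tested only by functionals that turn
  multiplication by J into the complex unit, so Hahn-Banach is the link back to operators. Formally
  \<open>Q_c s T\<close> is the product of s - T and s - \<open>Tb\<close>, although s and T do not
  commute. So R expands at infinity into z^(-n-1) times the complete homogeneous polynomials of
  degree n - 1 in T and \<open>Tb\<close>, the inner sums of the assertion. The extra term m T^(m-1)
  arises because integration by parts weights two consecutive moments by m + 1 and m. Left and right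
  versions are one argument over the quaternions and over the opposite algebra, selected by a
  Boolean. A unit k anticommuting with J splits the quaternions into the plane of J and that plane
  times k; only values in the plane of J meet the kernel, and k acts on the finished
  integrals.\<close>

definition sublinear :: "('a::real_normed_vector \<Rightarrow> real) \<Rightarrow> bool" where
  "sublinear p \<longleftrightarrow> (\<forall>x y. p (x + y) \<le> p x + p y) \<and> (\<forall>c x. 0 < c \<longrightarrow> p (c *\<^sub>R x) = c * p x)
     \<and> (\<forall>x. p x \<le> norm x)"

lemma sublinear_zero: "sublinear p \<Longrightarrow> p 0 = 0"
  unfolding sublinear_def by (metis mult_cancel_right1 scale_zero_right zero_less_numeral numeral_eq_one_iff semiring_norm(85))

lemma sublinear_lower: "sublinear p \<Longrightarrow> - p (- x) \<le> p x"
  using sublinear_zero[of p] unfolding sublinear_def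
  by (metis add.right_inverse minus_le_iff neg_le_iff_le add_le_same_cancel1 diff_ge_0_iff_ge diff_minus_eq_add)

lemma sublinear_lower_norm: "sublinear p \<Longrightarrow> - norm x \<le> p x"
  using sublinear_lower[of p x] unfolding sublinear_def
  by (metis norm_minus_cancel neg_le_iff_le order_trans)

text \<open>The Hahn-Banach modification of a sublinear functional: \<open>t = 0\<close> shows that
  it lies below \<open>p\<close>, and \<open>t = 1\<close> at \<open>x = - y\<close> pushes its
  value at \<open>- y\<close> down to at most \<open>- p y\<close>.\<close>

definition tilt :: "('a::real_normed_vector \<Rightarrow> real) \<Rightarrow> 'a \<Rightarrow> 'a \<Rightarrow> real" where
  "tilt p y x = (INF t\<in>{0..}. p (x + t *\<^sub>R y) - t * p y)"

lemma tilt_bdd_below: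
  assumes "sublinear p"
  shows "bdd_below ((\<lambda>t. p (x + t *\<^sub>R y) - t * p y) ` {0..})"
proof (rule bdd_belowI2)
  fix t :: real assume "t \<in> {0..}"
  then have "p (t *\<^sub>R y) = t * p y"
    using assms sublinear_zero[OF assms] unfolding sublinear_def by (cases "t = 0") auto
  moreover have "p (t *\<^sub>R y) \<le> p (x + t *\<^sub>R y) + p (- x)"
    using assms unfolding sublinear_def by (metis add.commute add_minus_cancel)
  ultimately show "- p (- x) \<le> p (x + t *\<^sub>R y) - t * p y" by simp
qed

lemma tilt_le:
  assumes "sublinear p" "0 \<le> t"
  shows "tilt p y x \<le> p (x + t *\<^sub>R y) - t * p y"
  unfolding tilt_def using assms by (intro cINF_lower tilt_bdd_below) auto

text \<open>Parameters add: choices \<open>s\<close> for \<open>x\<close> and \<open>t\<close> for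
  \<open>z\<close> give the admissible choice \<open>s + t\<close> for \<open>x + z\<close>. Scaling
  by \<open>c\<close> turns \<open>t\<close> into \<open>c * t\<close>.\<close>

lemma sublinear_tilt:
  assumes p: "sublinear p"
  shows "sublinear (tilt p y)"
proof -
  have scale: "tilt p y (c *\<^sub>R x) \<le> c * tilt p y x" if c: "0 < c" for c x
  proof -
    have "tilt p y (c *\<^sub>R x) / c \<le> tilt p y x"
      unfolding tilt_def[of p y x]
    proof (rule cINF_greatest)
      fix t :: real assume t: "t \<in> {0..}"
      have "tilt p y (c *\<^sub>R x) \<le> p (c *\<^sub>R x + (c * t) *\<^sub>R y) - (c * t) * p y"
        using t c p by (intro tilt_le) auto
      also have "\<dots> = c * (p (x + t *\<^sub>R y) - t * p y)"
        using p c unfolding sublinear_def by (simp add: algebra_simps flip: scaleR_scaleR scaleR_add_right)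
      finally show "tilt p y (c *\<^sub>R x) / c \<le> p (x + t *\<^sub>R y) - t * p y"
        using c by (simp add: field_simps)
    qed auto
    then show ?thesis using c by (simp add: field_simps)
  qed
  \<comment> \<open>The converse inequality is the same one for \<open>1 / c\<close>.\<close>
  have "tilt p y (c *\<^sub>R x) = c * tilt p y x" if c: "0 < c" for c x
    using scale[OF c, of x] scale[of "1 / c" "c *\<^sub>R x"] c by (simp add: field_simps)
  moreover have "tilt p y (x + z) \<le> tilt p y x + tilt p y z" for x z
  proof -
    have *: "tilt p y (x + z) - (p (z + t *\<^sub>R y) - t * p y) \<le> tilt p y x" if t: "0 \<le> t" for t
      unfolding tilt_def[of p y x]
    proof (rule cINF_greatest)
      fix s :: real assume s: "s \<in> {0..}"
      have "tilt p y (x + z) \<le> p ((x + z) + (s + t) *\<^sub>R y) - (s + t) * p y"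
        using s t p by (intro tilt_le) auto
      also have "p ((x + z) + (s + t) *\<^sub>R y) \<le> p (x + s *\<^sub>R y) + p (z + t *\<^sub>R y)"
      proof -
        have "(x + z) + (s + t) *\<^sub>R y = (x + s *\<^sub>R y) + (z + t *\<^sub>R y)" by (simp add: algebra_simps)
        then show ?thesis using p unfolding sublinear_def by metis
      qed
      finally show "tilt p y (x + z) - (p (z + t *\<^sub>R y) - t * p y) \<le> p (x + s *\<^sub>R y) - s * p y"
        by (simp add: algebra_simps)
    qed auto
    have "tilt p y (x + z) - tilt p y x \<le> p (z + t *\<^sub>R y) - t * p y" if "0 \<le> t" for t
      using *[OF that] by simp
    then have "tilt p y (x + z) - tilt p y x \<le> tilt p y z"
      unfolding tilt_def[of p y z] by (intro cINF_greatest) auto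
    then show ?thesis by simp
  qed
  moreover have "tilt p y x \<le> norm x" for x
  proof -
    have "tilt p y x \<le> p x" using tilt_le[OF p, of 0 y x] by simp
    also have "\<dots> \<le> norm x" using p unfolding sublinear_def by blast
    finally show ?thesis .
  qed
  ultimately show ?thesis unfolding sublinear_def by blast
qed

text \<open>Zorn's lemma for the reversed order. A nonempty chain has its pointwise infimum as lower
  bound, which is finite because every sublinear functional is at least
  \<open>- norm\<close>.\<close>

lemma minimal_sublinear_below:
  assumes q: "sublinear q"
  shows "\<exists>p. sublinear p \<and> p \<le> q \<and> (\<forall>p'. sublinear p' \<and> p' \<le> p \<longrightarrow> p' = p)"
proof -
  let ?A = "{p. sublinear p \<and> p \<le> q}"
  have "\<exists>m\<in>?A. \<forall>a\<in>?A. a \<le> m \<longrightarrow> a = m"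
  proof (rule predicate_Zorn)
    show "partial_order_on ?A (relation_of (\<lambda>m a. a \<le> m) ?A)"
      by (rule partial_order_on_relation_ofI) auto
    fix C assume C: "C \<in> Chains (relation_of (\<lambda>m a. a \<le> m) ?A)"
    then have sub: "sublinear p" and le: "p \<le> q" if "p \<in> C" for p
      using that by (auto simp: Chains_def relation_of_def)
    have chain: "p \<le> p' \<or> p' \<le> p" if "p \<in> C" "p' \<in> C" for p p'
      using that C by (auto simp: Chains_def relation_of_def)
    show "\<exists>u\<in>?A. \<forall>a\<in>C. u \<le> a"
    proof (cases "C = {}")
      case True then show ?thesis using q by auto
    next
      case False
      define u where "u = (\<lambda>x. INF p\<in>C. p x)"
      have u_le: "u x \<le> p x" if "p \<in> C" for p x
        unfolding u_def using that sublinear_lower_norm[OF sub]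
        by (intro cINF_lower bdd_belowI2[of _ "- norm x"])
      have scale: "u (c *\<^sub>R x) \<le> c * u x" if c: "0 < c" for c x
      proof -
        have "u (c *\<^sub>R x) / c \<le> u x"
          unfolding u_def
        proof (rule cINF_greatest[OF False])
          fix p assume "p \<in> C"
          then have "(INF p\<in>C. p (c *\<^sub>R x)) \<le> c * p x"
            using u_le[of p "c *\<^sub>R x"] sub[of p] c unfolding sublinear_def u_def by simp
          then show "(INF p\<in>C. p (c *\<^sub>R x)) / c \<le> p x" using c by (simp add: field_simps)
        qed
        then show ?thesis using c by (simp add: field_simps)
      qed
      have "u (c *\<^sub>R x) = c * u x" if c: "0 < c" for c x
        using scale[OF c, of x] scale[of "1 / c" "c *\<^sub>R x"] c by (simp add: field_simps)
      moreover have "u (x + y) \<le> u x + u y" for x y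
      proof -
        \<comment> \<open>The infima at \<open>x\<close> and at \<open>y\<close> are taken
          independently; in a chain the smaller of \<open>p\<close> and \<open>p'\<close> serves
          both arguments.\<close>
        have two: "u (x + y) \<le> p x + p' y" if pC: "p \<in> C" "p' \<in> C" for p p'
        proof -
          have "u (x + y) \<le> r x + r y" if "r \<in> C" for r
            using u_le[OF that, of "x + y"] sub[OF that] unfolding sublinear_def by (meson order_trans)
          then show ?thesis using chain[OF pC] pC unfolding le_fun_def
            by (meson add_left_mono add_right_mono order_trans)
        qed
        have *: "u (x + y) - p x \<le> u y" if "p \<in> C" for p
          unfolding fun_cong[OF u_def, of y]
          using two[OF that] by (intro cINF_greatest[OF False]) (simp add: algebra_simps)
        have "u (x + y) - u y \<le> p x" if "p \<in> C" for p using *[OF that] by simp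
        then have "u (x + y) - u y \<le> u x"
          unfolding fun_cong[OF u_def, of x] by (intro cINF_greatest[OF False])
        then show ?thesis by simp
      qed
      moreover obtain p0 where p0: "p0 \<in> C" using False by blast
      moreover have "u x \<le> norm x" for x
        using u_le[OF p0, of x] sub[OF p0] unfolding sublinear_def by (meson order_trans)
      ultimately have "sublinear u" unfolding sublinear_def by blast
      moreover have "u \<le> q" using u_le[OF p0] le[OF p0] by (auto simp: le_fun_def intro: order_trans)
      ultimately show ?thesis using u_le by (intro bexI[of _ u]) (auto simp: le_fun_def)
    qed
  qed
  then obtain m where "sublinear m" "m \<le> q" and min: "\<And>a. sublinear a \<Longrightarrow> a \<le> q \<Longrightarrow> a \<le> m \<Longrightarrow> a = m"
    by (simp add: Bex_def Ball_def) blast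
  moreover have "a = m" if "sublinear a" "a \<le> m" for a
    using min[OF that(1) order_trans[OF that(2) \<open>m \<le> q\<close>] that(2)] .
  ultimately show ?thesis by blast
qed

text \<open>A minimal sublinear functional is linear, since it is not changed by tilting.\<close>

lemma exists_bounded_functional_nonzero:
  fixes x0 :: "'a::real_normed_vector"
  assumes "x0 \<noteq> 0"
  shows "\<exists>\<phi>::'a \<Rightarrow> real. bounded_linear \<phi> \<and> \<phi> x0 \<noteq> 0"
proof -
  have nrm: "sublinear (norm :: 'a \<Rightarrow> real)" by (auto simp: sublinear_def norm_triangle_ineq)
  \<comment> \<open>Starting below \<open>tilt norm x0\<close> instead of \<open>norm\<close> forces
    \<open>p (- x0) \<le> - norm x0\<close>, which makes the functional nonzero at
    \<open>x0\<close>.\<close>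
  obtain p where p: "sublinear p" and pq: "p \<le> tilt norm x0"
    and min: "\<And>p'. sublinear p' \<Longrightarrow> p' \<le> p \<Longrightarrow> p' = p"
    using minimal_sublinear_below[OF sublinear_tilt[OF nrm], of x0] by blast
  have neg: "p (- y) = - p y" for y
  proof -
    have "tilt p y \<le> p"
      using tilt_le[OF p, of 0 y] by (simp add: le_fun_def)
    then have "tilt p y = p" using min sublinear_tilt[OF p] by blast
    \<comment> \<open>With \<open>t = 1\<close> at \<open>- y\<close> the argument of
      \<open>p\<close> in the tilt becomes 0, and minimality has identified the tilt with
      \<open>p\<close>.\<close>
    then have "p (- y) \<le> - p y" using tilt_le[OF p, of 1 y "- y"] sublinear_zero[OF p] by simp
    then show ?thesis using sublinear_lower[OF p, of "y"] by simp
  qed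
  have "p (x + y) = p x + p y" for x y
  proof -
    have "p x \<le> p (x + y) + p (- y)" using p unfolding sublinear_def by (metis add.commute minus_add_cancel)
    then show ?thesis using p neg[of y] unfolding sublinear_def by (smt (verit))
  qed
  moreover have "p (c *\<^sub>R x) = c * p x" for c x
  proof -
    have pos: "p (c *\<^sub>R x) = c * p x" if "0 < c" for c x using p that unfolding sublinear_def by blast
    show ?thesis
      using pos[of c x] pos[of "- c" x] neg[of "c *\<^sub>R x"] sublinear_zero[OF p]
      by (cases c "0 :: real" rule: linorder_cases) auto
  qed
  moreover have "norm (p x) \<le> norm x * 1" for x
  proof -
    have "p x \<le> norm x" "p (- x) \<le> norm (- x)" using p unfolding sublinear_def by blast+
    then show ?thesis using neg[of x] by simp
  qed
  ultimately have "bounded_linear p" by (intro bounded_linear_intro[of _ 1]) auto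
  moreover have "p (- x0) \<le> - norm x0"
    using tilt_le[OF nrm, of 1 x0 "- x0"] le_funD[OF pq, of "- x0"] by simp
  ultimately show ?thesis using assms neg[of x0] by (intro exI[of _ p]) auto
qed

lemma eqI_functional:
  fixes x y :: "'a::real_normed_vector"
  assumes "\<And>\<phi>::'a \<Rightarrow> real. bounded_linear \<phi> \<Longrightarrow> \<phi> x = \<phi> y"
  shows "x = y"
proof (rule ccontr)
  assume "x \<noteq> y"
  then obtain \<phi> where \<phi>: "bounded_linear \<phi>" "\<phi> (x - y) \<noteq> (0::real)"
    using exists_bounded_functional_nonzero[of "x - y"] by auto
  then show False using assms[OF \<phi>(1)] linear_diff[OF bounded_linear.linear[OF \<phi>(1)]] by simp
qed

section \<open>Cauchy's theorem for cycles\<close>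

definition difference_quotient :: "(complex \<Rightarrow> complex) \<Rightarrow> complex \<Rightarrow> complex \<Rightarrow> complex" where
  "difference_quotient f z w = (if w = z then deriv f z else (f w - f z) / (w - z))"

text \<open>Near a diagonal point \<open>(a, a)\<close>, subtracting the linear function of slope
  \<open>deriv f a\<close> leaves a function with small derivative on a ball. The mean value
  inequality then controls the quotients with \<open>w \<noteq> z\<close>, and continuity of the
  derivative those with \<open>w = z\<close>.\<close>

lemma continuous_on_difference_quotient:
  assumes f: "f holomorphic_on S" and S: "open S"
  shows "continuous_on (S \<times> S) (\<lambda>(z, w). difference_quotient f z w)"
proof -
  have fS: "continuous_on S f" using f holomorphic_on_imp_continuous_on by blast
  have contf: "isCont f x" if "x \<in> S" for x using fS S that continuous_on_eq_continuous_at by blast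
  have "isCont (\<lambda>p. difference_quotient f (fst p) (snd p)) (a, b)" if ab: "a \<in> S" "b \<in> S" for a b
  proof (cases "a = b")
    case False
    have "isCont (\<lambda>p. (f (snd p) - f (fst p)) / (snd p - fst p)) (a, b)"
    proof -
      have "isCont (\<lambda>p. f (fst p)) (a, b)" "isCont (\<lambda>p. f (snd p)) (a, b)"
        by (rule isCont_o2[where g = f]; use that contf in \<open>auto intro!: continuous_intros\<close>)+
      then show ?thesis using False by (intro continuous_intros) auto
    qed
    moreover have "eventually (\<lambda>p. p \<in> {p. fst p \<noteq> snd p}) (nhds (a, b))"
      using False by (intro eventually_nhds_in_open open_Collect_neq continuous_intros) auto
    then have "eventually (\<lambda>p. difference_quotient f (fst p) (snd p) = (f (snd p) - f (fst p)) / (snd p - fst p)) (nhds (a, b))"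
      by eventually_elim (auto simp: difference_quotient_def)
    ultimately show ?thesis by (simp add: isCont_cong)
  next
    case True
    have "continuous_on S (deriv f)"
      using f S holomorphic_deriv holomorphic_on_imp_continuous_on by blast
    then have cd: "isCont (deriv f) a" using S that continuous_on_eq_continuous_at by blast
    show ?thesis unfolding continuous_at_eps_delta
    proof (intro allI impI)
      fix e :: real assume e: "e > 0"
      from cd e have "\<exists>d>0. \<forall>x. dist x a < d \<longrightarrow> dist (deriv f x) (deriv f a) < e / 2"
        unfolding continuous_at_eps_delta by (metis half_gt_zero)
      then obtain d1 where d1: "d1 > 0" "\<And>x. dist x a < d1 \<Longrightarrow> dist (deriv f x) (deriv f a) < e / 2" by blast
      obtain d2 where d2: "d2 > 0" "ball a d2 \<subseteq> S" using openE[OF S ab(1)] by blast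
      define d where "d = min d1 d2"
      have d: "d > 0" "ball a d \<subseteq> S" "\<And>x. x \<in> ball a d \<Longrightarrow> norm (deriv f x - deriv f a) \<le> e / 2"
        using d1 d2 unfolding d_def by (auto simp: dist_norm norm_minus_commute less_imp_le)
      have le: "norm (difference_quotient f z w - deriv f a) \<le> e / 2" if z: "z \<in> ball a d" and w: "w \<in> ball a d" for z w
      proof (cases "w = z")
        case True then show ?thesis using d(3)[OF z] by (simp add: difference_quotient_def)
      next
        case False
        have "norm ((f w - deriv f a * w) - (f z - deriv f a * z)) \<le> e / 2 * norm (w - z)"
        proof (rule field_differentiable_bound[of "ball a d" _ "\<lambda>x. deriv f x - deriv f a"])
          fix x assume x: "x \<in> ball a d"
          then have "(f has_field_derivative deriv f x) (at x within ball a d)"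
            using f S d(2) holomorphic_derivI by (meson subsetD)
          then show "((\<lambda>w. f w - deriv f a * w) has_field_derivative deriv f x - deriv f a) (at x within ball a d)"
            by (auto intro!: derivative_eq_intros)
        qed (use d w z in auto)
        then have "norm ((f w - deriv f a * w) - (f z - deriv f a * z)) / norm (w - z) \<le> e / 2"
          using False by (simp add: pos_divide_le_eq)
        moreover have "difference_quotient f z w - deriv f a = ((f w - deriv f a * w) - (f z - deriv f a * z)) / (w - z)"
          using False by (simp add: difference_quotient_def field_simps)
        ultimately show ?thesis by (simp only: norm_divide)
      qed
      show "\<exists>d>0. \<forall>p. dist p (a, b) < d \<longrightarrow>
          dist (difference_quotient f (fst p) (snd p)) (difference_quotient f (fst (a, b)) (snd (a, b))) < e"
      proof (intro exI[of _ d] conjI allI impI)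
        fix p :: "complex \<times> complex" assume p: "dist p (a, b) < d"
        then have "fst p \<in> ball a d" "snd p \<in> ball a d"
          using dist_fst_le[of p "(a, b)"] dist_snd_le[of p "(a, b)"] True by (auto simp: dist_commute)
        from le[OF this] show "dist (difference_quotient f (fst p) (snd p)) (difference_quotient f (fst (a, b)) (snd (a, b))) < e"
          using True e by (simp add: dist_norm difference_quotient_def)
      qed (rule d)
    qed
  qed
  then show ?thesis
    unfolding case_prod_unfold by (intro continuous_at_imp_continuous_on) auto
qed

text \<open>Removable singularity: continuity at \<open>z = w\<close> upgrades holomorphy on the
  punctured set.\<close>

lemma holomorphic_difference_quotient:
  assumes f: "f holomorphic_on S" and S: "open S" and w: "w \<in> S"
  shows "(\<lambda>z. difference_quotient f z w) holomorphic_on S"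
proof (rule no_isolated_singularity)
  have "continuous_on S ((\<lambda>(z, w). difference_quotient f z w) \<circ> (\<lambda>z. (z, w)))"
    using w by (intro continuous_on_compose continuous_intros
        continuous_on_subset[OF continuous_on_difference_quotient[OF f S]]) auto
  then show "continuous_on S (\<lambda>z. difference_quotient f z w)" by (simp add: o_def)
  have "(\<lambda>z. (f w - f z) / (w - z)) holomorphic_on S - {w}"
    using f by (intro holomorphic_intros holomorphic_on_subset[OF f]) auto
  then show "(\<lambda>z. difference_quotient f z w) holomorphic_on S - {w}"
    by (rule holomorphic_transform) (auto simp: difference_quotient_def)
qed (use S in auto)

lemma holomorphic_difference_quotient2:
  assumes f: "f holomorphic_on S" and S: "open S" and z: "z \<in> S"
  shows "difference_quotient f z holomorphic_on S"
proof -
  have "difference_quotient f z w = difference_quotient f w z" for w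
    unfolding difference_quotient_def by (auto simp: divide_simps algebra_simps)
  then have "difference_quotient f z = (\<lambda>w. difference_quotient f w z)" by blast
  then show ?thesis using holomorphic_difference_quotient[OF assms] by simp
qed

text \<open>The integral inherits Cauchy's formula on small circles by swapping the two
  integrations, for which the velocity has to be continuous. Cauchy's formula for a continuous
  function then makes it differentiable.\<close>

lemma holomorphic_contour_integral_difference_quotient:
  assumes f: "f holomorphic_on S" and S: "open S"
    and p: "valid_path p" "path_image p \<subseteq> S" "continuous_on {0..1} (\<lambda>t. vector_derivative p (at t))"
  shows "(\<lambda>z. contour_integral p (difference_quotient f z)) holomorphic_on S"
proof -
  let ?F = "\<lambda>z. contour_integral p (difference_quotient f z)"
  have pc: "continuous_on {0..1} p" using p(1) valid_path_imp_path path_def by blast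
  have pim: "p t \<in> S" if "t \<in> {0..1}" for t using that p(2) by (auto simp: path_image_def)
  have contF: "continuous_on S ?F"
  proof -
    have "continuous_on (S \<times> {0..1}) (\<lambda>x. (\<lambda>(z, w). difference_quotient f z w) (fst x, p (snd x)))"
      using pim by (intro continuous_on_compose2[OF continuous_on_difference_quotient[OF f S]]
          continuous_intros continuous_on_compose2[OF pc]) auto
    then have "continuous_on (S \<times> cbox 0 1) (\<lambda>(z, t). difference_quotient f z (p t) * vector_derivative p (at t))"
      unfolding case_prod_unfold
      by (intro continuous_intros continuous_on_compose2[OF p(3)]) auto
    from integral_continuous_on_param[OF this] show ?thesis
      by (simp add: contour_integral_integral)
  qed
  have "?F analytic_on S"
    unfolding analytic_on_def
  proof
    fix z0 assume "z0 \<in> S"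
    then obtain r where r: "0 < r" "cball z0 r \<subseteq> S" using S open_contains_cball by blast
    let ?c = "circlepath z0 r"
    have cS: "path_image ?c \<subseteq> S" using r by (auto simp: sphere_def)
    have rep: "((\<lambda>u. ?F u / (u - w) ^ 1) has_contour_integral 2 * of_real pi * \<i> * ?F w) ?c"
      if w: "w \<in> ball z0 r" for w
    proof -
      have wc: "w \<notin> path_image ?c" using w r by (auto simp: dist_norm)
      have "(\<lambda>u. ?F u / (u - w)) contour_integrable_on ?c"
        using wc cS by (intro contour_integrable_continuous_circlepath continuous_intros
            continuous_on_subset[OF contF]) auto
      moreover have "contour_integral ?c (\<lambda>u. ?F u / (u - w)) = 2 * of_real pi * \<i> * ?F w"
      proof -
        have "contour_integral ?c (\<lambda>u. ?F u / (u - w))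
            = contour_integral ?c (\<lambda>u. contour_integral p (\<lambda>x. difference_quotient f u x / (u - w)))"
        proof (rule contour_integral_eq)
          fix u assume "u \<in> path_image ?c"
          then have "difference_quotient f u contour_integrable_on p"
            using cS by (intro contour_integrable_holomorphic_simple[OF holomorphic_difference_quotient2[OF f S] S p(1,2)]) auto
          then show "?F u / (u - w) = contour_integral p (\<lambda>x. difference_quotient f u x / (u - w))"
            by (simp add: contour_integral_div)
        qed
        also have "\<dots> = contour_integral p (\<lambda>x. contour_integral ?c (\<lambda>u. difference_quotient f u x / (u - w)))"
        proof (rule contour_integral_swap)
          have "continuous_on (path_image ?c \<times> path_image p) (\<lambda>x. difference_quotient f (fst x) (snd x))"
            using continuous_on_subset[OF continuous_on_difference_quotient[OF f S], of "path_image ?c \<times> path_image p"] cS p(2)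
            unfolding case_prod_unfold by blast
          then show "continuous_on (path_image ?c \<times> path_image p) (\<lambda>(u, x). difference_quotient f u x / (u - w))"
            unfolding case_prod_unfold using wc by (intro continuous_intros) auto
          show "continuous_on {0..1} (\<lambda>t. vector_derivative ?c (at t))"
            by (simp add: vector_derivative_circlepath continuous_intros)
        qed (use p in auto)
        also have "\<dots> = contour_integral p (\<lambda>x. 2 * of_real pi * \<i> * difference_quotient f w x)"
        proof (rule contour_integral_eq)
          fix x assume "x \<in> path_image p"
          then show "contour_integral ?c (\<lambda>u. difference_quotient f u x / (u - w)) = 2 * of_real pi * \<i> * difference_quotient f w x"
            using p(2) w r by (intro contour_integral_unique Cauchy_integral_circlepath_simple
                holomorphic_on_subset[OF holomorphic_difference_quotient[OF f S]])
              (auto simp: dist_norm norm_minus_commute)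
        qed
        also have "\<dots> = 2 * of_real pi * \<i> * ?F w"
          using w r by (intro contour_integral_lmul contour_integrable_holomorphic_simple[OF holomorphic_difference_quotient2[OF f S] S p(1,2)]) auto
        finally show ?thesis .
      qed
      ultimately show ?thesis using has_contour_integral_integral by fastforce
    qed
    have "(\<lambda>w. 2 * of_real pi * \<i> * ?F w) field_differentiable at w" if "w \<in> ball z0 r" for w
      using Cauchy_next_derivative_circlepath(2)[OF continuous_on_subset[OF contF cS] rep _ that]
      by (auto simp: field_differentiable_def)
    then have "(\<lambda>w. 2 * of_real pi * \<i> * ?F w) holomorphic_on ball z0 r"
      by (auto simp: holomorphic_on_def intro: field_differentiable_at_within)
    then have "(\<lambda>w. (2 * of_real pi * \<i> * ?F w) / (2 * of_real pi * \<i>)) holomorphic_on ball z0 r"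
      by (rule holomorphic_on_divide) auto
    then have "?F holomorphic_on ball z0 r" by simp
    then show "\<exists>\<epsilon>>0. ?F holomorphic_on ball z0 \<epsilon>" using r by auto
  qed
  then show ?thesis by (rule analytic_imp_holomorphic)
qed

section \<open>Cauchy transforms and the vanishing of Dixon's function\<close>

lemma bounded_path_image_data:
  assumes p: "valid_path p" and p': "continuous_on {0..1} (\<lambda>t. vector_derivative p (at t))"
  obtains R B where "\<And>t. t \<in> {0..1} \<Longrightarrow> norm (p t) \<le> R" "\<And>t. t \<in> {0..1} \<Longrightarrow> norm (vector_derivative p (at t)) \<le> B"
    "0 \<le> R" "0 \<le> B"
proof -
  have "continuous_on {0..1} p" using p valid_path_imp_path path_def by blast
  then have "bounded (p ` {0..1})" "bounded ((\<lambda>t. vector_derivative p (at t)) ` {0..1})"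
    using p' by (auto intro!: compact_imp_bounded compact_continuous_image)
  then show ?thesis using that unfolding bounded_pos by (metis image_eqI less_imp_le)
qed

text \<open>The transform is the outer half of Dixon's function. It decays because a path in the
  disc of radius \<open>R\<close> keeps distance at least \<open>norm z - R\<close> from
  \<open>z\<close>.\<close>

lemma Cauchy_transform_properties:
  assumes p: "valid_path p" and p': "continuous_on {0..1} (\<lambda>t. vector_derivative p (at t))"
    and g: "continuous_on (path_image p) g"
  shows "(\<lambda>z. contour_integral p (\<lambda>w. g w / (w - z))) holomorphic_on - path_image p" (is "?F holomorphic_on _")
    and "((\<lambda>z. contour_integral p (\<lambda>w. g w / (w - z))) \<longlongrightarrow> 0) at_infinity"
proof -
  obtain R B where R: "\<And>t. t \<in> {0..1} \<Longrightarrow> norm (p t) \<le> R" and B: "\<And>t. t \<in> {0..1} \<Longrightarrow> norm (vector_derivative p (at t)) \<le> B"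
    and R0: "0 \<le> R" and B0: "0 \<le> B" using bounded_path_image_data[OF p p'] by metis
  have pc: "continuous_on {0..1} p" using p valid_path_imp_path path_def by blast
  have cont: "continuous_on {0..1} (\<lambda>t. g (p t) / (p t - z) * vector_derivative p (at t))" if "z \<notin> path_image p" for z
    using that p' pc by (intro continuous_intros continuous_on_compose2[OF g pc])  (auto simp: path_image_def)
  have op: "open (- path_image p)" using p valid_path_imp_path closed_path_image by blast
  have "((\<lambda>u. g u / (u - w) ^ 1) has_contour_integral ?F w) p" if "w \<in> - path_image p - path_image p" for w
  proof -
    have "(\<lambda>t. g (p t) / (p t - w) * vector_derivative p (at t)) integrable_on {0..1}"
      using cont[of w] that integrable_continuous_real by blast
    then show ?thesis by (auto simp: contour_integrable_on intro!: has_contour_integral_integral)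
  qed
  then have "?F field_differentiable at w" if "w \<in> - path_image p" for w
    using Cauchy_next_derivative(2)[OF g B _ _ op p, of 1 ?F w] that
    by (auto simp: field_differentiable_def)
  then show "?F holomorphic_on - path_image p"
    by (auto simp: holomorphic_on_def intro: field_differentiable_at_within)
  obtain M where M: "\<And>w. w \<in> path_image p \<Longrightarrow> norm (g w) \<le> M" and M0: "0 \<le> M"
    using compact_imp_bounded[OF compact_continuous_image[OF g]] p valid_path_imp_path compact_path_image
    unfolding bounded_pos by (metis image_eqI less_imp_le)
  show "(?F \<longlongrightarrow> 0) at_infinity"
  proof (rule Lim_null_comparison)
    have "eventually (\<lambda>z. z \<notin> cball 0 R) (at_infinity :: complex filter)"
      unfolding eventually_at_infinity by (intro exI[of _ "R + 1"]) auto
    then show "eventually (\<lambda>z. norm (?F z) \<le> M * B / (norm z - R)) at_infinity"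
    proof eventually_elim
      case (elim z)
      then have z: "R < norm z" by auto
      have "z \<notin> path_image p" using z R by (force simp: path_image_def)
      then have "norm (integral {0..1} (\<lambda>t. g (p t) / (p t - z) * vector_derivative p (at t))) \<le> M * B / (norm z - R) * (1 - 0)"
      proof (intro integral_bound cont)
        fix t :: real assume t: "t \<in> {0..1}"
        have "norm z - R \<le> norm (p t - z)" using R[OF t] norm_triangle_ineq2[of z "p t"] by (simp add: norm_minus_commute)
        then have "norm (g (p t)) / norm (p t - z) \<le> M / (norm z - R)"
          using z M[of "p t"] M0 t by (intro frac_le) (auto simp: path_image_def)
        then have "norm (g (p t)) / norm (p t - z) * norm (vector_derivative p (at t)) \<le> M / (norm z - R) * B"
          using B[OF t] M0 z by (intro mult_mono) auto
        then show "norm (g (p t) / (p t - z) * vector_derivative p (at t)) \<le> M * B / (norm z - R)"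
          by (simp add: norm_mult norm_divide)
      qed auto
      then show ?case by (simp add: contour_integral_integral)
    qed
    have "filterlim (\<lambda>z::complex. norm z - R) at_top at_infinity"
      using filterlim_tendsto_add_at_top[OF tendsto_const filterlim_norm_at_top, of "- R"] by simp
    then show "((\<lambda>z::complex. M * B / (norm z - R)) \<longlongrightarrow> 0) at_infinity"
      by (intro tendsto_divide_0[OF tendsto_const] filterlim_at_top_imp_at_infinity)
  qed
qed

text \<open>Dixon's function \<open>\<Phi>\<close> is \<open>F\<close> on \<open>S\<close> and the
  plain Cauchy integral \<open>H\<close> elsewhere. On \<open>S\<close>, off the cycle,
  \<open>F\<close> and \<open>H\<close> differ by \<open>2 pi \<i> g z\<close> times the total
  winding number, so they agree on the part of \<open>S\<close> in \<open>V\<close>. As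
  \<open>S\<close> and \<open>V\<close> cover the plane, \<open>\<Phi>\<close> is entire; it
  vanishes at infinity and is zero by Liouville.\<close>

lemma cycle_difference_quotient_integral_zero:
  fixes p :: "'i \<Rightarrow> real \<Rightarrow> complex"
  assumes I: "finite I" and S: "open S" and g: "g holomorphic_on S"
    and p: "\<And>i. i \<in> I \<Longrightarrow> valid_path (p i)"
    and p': "\<And>i. i \<in> I \<Longrightarrow> continuous_on {0..1} (\<lambda>t. vector_derivative (p i) (at t))"
    and loop: "\<And>i. i \<in> I \<Longrightarrow> pathfinish (p i) = pathstart (p i)"
    and sub: "\<And>i. i \<in> I \<Longrightarrow> path_image (p i) \<subseteq> S"
    and wn: "\<And>z. z \<notin> S \<Longrightarrow> (\<Sum>i\<in>I. winding_number (p i) z) = 0"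
    and z: "z \<in> S"
  shows "(\<Sum>i\<in>I. contour_integral (p i) (difference_quotient g z)) = 0"
proof -
  define F where "F z = (\<Sum>i\<in>I. contour_integral (p i) (difference_quotient g z))" for z
  define H where "H z = (\<Sum>i\<in>I. contour_integral (p i) (\<lambda>w. g w / (w - z)))" for z
  define \<Phi> where "\<Phi> z = (if z \<in> S then F z else H z)" for z
  define V where "V = {z. (\<forall>i\<in>I. z \<notin> path_image (p i)) \<and> (\<Sum>i\<in>I. winding_number (p i) z) = 0}"
  have path: "path (p i)" if "i \<in> I" for i using p[OF that] valid_path_imp_path by blast
  have gS: "continuous_on S g" using g holomorphic_on_imp_continuous_on by blast
  have "open V"
  proof (subst open_subopen, intro ballI)
    fix z1 assume z1: "z1 \<in> V"
    \<comment> \<open>On \<open>?N\<close> every single winding number keeps its value at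
      \<open>z1\<close>, so their sum stays zero.\<close>
    let ?N = "\<Inter>i\<in>I. {z. z \<notin> path_image (p i) \<and> winding_number (p i) z = winding_number (p i) z1}"
    have "open ?N" using I path loop by (intro open_INT ballI open_winding_number_levelsets) auto
    moreover have "z1 \<in> ?N" using z1 by (auto simp: V_def)
    moreover have "?N \<subseteq> V"
    proof
      fix x assume x: "x \<in> ?N"
      then have "(\<Sum>i\<in>I. winding_number (p i) x) = (\<Sum>i\<in>I. winding_number (p i) z1)"
        by (intro sum.cong) auto
      then show "x \<in> V" using x z1 by (auto simp: V_def)
    qed
    ultimately show "\<exists>T. open T \<and> z1 \<in> T \<and> T \<subseteq> V" by blast
  qed
  have eqV: "\<Phi> z = H z" if z: "z \<in> V" for z
  proof (cases "z \<in> S")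
    case True
    have "contour_integral (p i) (difference_quotient g z)
        = contour_integral (p i) (\<lambda>w. g w / (w - z)) - g z * (2 * of_real pi * \<i> * winding_number (p i) z)"
      if i: "i \<in> I" for i
    proof -
      have zi: "z \<notin> path_image (p i)" using z i by (auto simp: V_def)
      have int1: "(\<lambda>w. g w / (w - z)) contour_integrable_on (p i)"
        using zi sub[OF i] S by (intro contour_integrable_holomorphic_simple[OF _ _ p[OF i], of _ "S - {z}"]
            holomorphic_intros holomorphic_on_subset[OF g]) auto
      have wn: "((\<lambda>w. 1 / (w - z)) has_contour_integral 2 * of_real pi * \<i> * winding_number (p i) z) (p i)"
        using has_contour_integral_winding_number[OF p[OF i] zi] by simp
      have "contour_integral (p i) (difference_quotient g z) = contour_integral (p i) (\<lambda>w. g w / (w - z) - g z * (1 / (w - z)))"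
        using zi by (intro contour_integral_eq) (auto simp: difference_quotient_def diff_divide_distrib)
      then show ?thesis
        using contour_integral_unique[OF has_contour_integral_diff[OF has_contour_integral_integral[OF int1] has_contour_integral_lmul[OF wn]]]
        by simp
    qed
    then have "F z = H z - g z * (2 * of_real pi * \<i> * (\<Sum>i\<in>I. winding_number (p i) z))"
      by (simp add: F_def H_def sum_subtractf sum_distrib_left)
    then show ?thesis using z True by (simp add: V_def \<Phi>_def)
  qed (simp add: \<Phi>_def)
  have holH: "H holomorphic_on V"
    unfolding H_def
    by (intro holomorphic_on_sum holomorphic_on_subset[OF Cauchy_transform_properties(1)[OF p p']]
        continuous_on_subset[OF gS]) (use sub in \<open>auto simp: V_def\<close>)
  have "F holomorphic_on S"
    unfolding F_def using p p' sub
    by (intro holomorphic_on_sum holomorphic_contour_integral_difference_quotient[OF g S]) auto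
  then have "\<Phi> holomorphic_on S" by (rule holomorphic_transform) (simp add: \<Phi>_def)
  moreover have "\<Phi> holomorphic_on V" using holH by (rule holomorphic_transform) (simp add: eqV)
  moreover have "S \<union> V = UNIV" using sub wn by (auto simp: V_def)
  ultimately have "\<Phi> holomorphic_on UNIV"
    using holomorphic_on_Un[of \<Phi> S V] S \<open>open V\<close> by auto
  moreover have "(\<Phi> \<longlongrightarrow> 0) at_infinity"
  proof (rule Lim_transform_eventually)
    show "(H \<longlongrightarrow> 0) at_infinity"
      unfolding H_def
      by (intro tendsto_null_sum Cauchy_transform_properties(2)[OF p p'] continuous_on_subset[OF gS])
        (use sub in auto)
    have "eventually (\<lambda>z. z \<notin> path_image (p i) \<and> winding_number (p i) z = 0) at_infinity" if i: "i \<in> I" for i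
    proof -
      obtain R where "path_image (p i) \<subseteq> ball 0 R" using bounded_path_image[OF path[OF i]]
        by (meson bounded_subset_ballD)
      moreover obtain B where "\<And>z. B \<le> norm z \<Longrightarrow> winding_number (p i) z = 0"
        using winding_number_zero_at_infinity[OF path[OF i] loop[OF i]] by blast
      ultimately show ?thesis unfolding eventually_at_infinity
        by (intro exI[of _ "max R B"]) (auto simp: subset_eq)
    qed
    then have "eventually (\<lambda>z. \<forall>i\<in>I. z \<notin> path_image (p i) \<and> winding_number (p i) z = 0) at_infinity"
      using I by (simp add: eventually_ball_finite)
    then show "eventually (\<lambda>z. H z = \<Phi> z) at_infinity"
      by eventually_elim (simp add: eqV V_def)
  qed
  ultimately have "\<Phi> z = 0" by (rule Liouville_weak_0)
  then show ?thesis using z by (simp add: \<Phi>_def F_def)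
qed

text \<open>A valid path may have a discontinuous velocity, while Dixon's argument wants a
  continuous one. A polynomial loop close to each path has the same integrals of functions
  holomorphic on \<open>S\<close>; applied to \<open>1 / (w - z)\<close>, this gives the same
  winding numbers about points outside \<open>S\<close>.\<close>

theorem Cauchy_theorem_cycle:
  fixes \<gamma> :: "'i \<Rightarrow> real \<Rightarrow> complex"
  assumes I: "finite I" and S: "open S" and f: "f holomorphic_on S"
    and \<gamma>: "\<And>i. i \<in> I \<Longrightarrow> valid_path (\<gamma> i)"
    and loop: "\<And>i. i \<in> I \<Longrightarrow> pathfinish (\<gamma> i) = pathstart (\<gamma> i)"
    and sub: "\<And>i. i \<in> I \<Longrightarrow> path_image (\<gamma> i) \<subseteq> S"
    and wn: "\<And>z. z \<notin> S \<Longrightarrow> (\<Sum>i\<in>I. winding_number (\<gamma> i) z) = 0"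
  shows "(\<Sum>i\<in>I. contour_integral (\<gamma> i) f) = 0"
proof -
  have "\<exists>q. polynomial_function q \<and> pathfinish q = pathstart q \<and> path_image q \<subseteq> S \<and>
      (\<forall>h. h holomorphic_on S \<longrightarrow> contour_integral q h = contour_integral (\<gamma> i) h)" if i: "i \<in> I" for i
  proof -
    have path: "path (\<gamma> i)" using \<gamma>[OF i] valid_path_imp_path by blast
    obtain d where "0 < d" and d: "\<forall>g h. valid_path g \<and> valid_path h \<and>
        (\<forall>t\<in>{0..1}. norm (g t - \<gamma> i t) < d \<and> norm (h t - \<gamma> i t) < d) \<and>
        pathstart h = pathstart g \<and> pathfinish h = pathfinish g \<longrightarrow>
        path_image g \<subseteq> S \<and> path_image h \<subseteq> S \<and>
          (\<forall>f. f holomorphic_on S \<longrightarrow> contour_integral h f = contour_integral g f)"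
      using contour_integral_nearby_ends[OF S path sub[OF i]] by (elim exE conjE)
    obtain q where q: "polynomial_function q" "pathstart q = pathstart (\<gamma> i)" "pathfinish q = pathfinish (\<gamma> i)"
      "\<forall>t\<in>{0..1}. norm (q t - \<gamma> i t) < d"
      using path_approx_polynomial_function[OF path \<open>0 < d\<close>] by metis
    have "path_image q \<subseteq> S \<and> (\<forall>h. h holomorphic_on S \<longrightarrow> contour_integral q h = contour_integral (\<gamma> i) h)"
      using d[rule_format, of "\<gamma> i" q] \<gamma>[OF i] valid_path_polynomial_function[OF q(1)] q \<open>0 < d\<close> by simp
    then show ?thesis using q loop[OF i] by auto
  qed
  then obtain q where q: "\<And>i. i \<in> I \<Longrightarrow> polynomial_function (q i)"
      "\<And>i. i \<in> I \<Longrightarrow> pathfinish (q i) = pathstart (q i)" "\<And>i. i \<in> I \<Longrightarrow> path_image (q i) \<subseteq> S"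
      "\<And>i h. i \<in> I \<Longrightarrow> h holomorphic_on S \<Longrightarrow> contour_integral (q i) h = contour_integral (\<gamma> i) h"
    by metis
  have "(\<Sum>i\<in>I. contour_integral (q i) (difference_quotient g z0)) = 0"
    if g: "g holomorphic_on S" and z0: "z0 \<in> S" for g z0
  proof (rule cycle_difference_quotient_integral_zero[OF I S g _ _ _ _ _ z0])
    fix i assume i: "i \<in> I"
    show "valid_path (q i)" using q(1)[OF i] valid_path_polynomial_function by blast
    obtain q' where "polynomial_function q'" "\<And>x. (q i has_vector_derivative q' x) (at x)"
      using has_vector_derivative_polynomial_function[OF q(1)[OF i]] by metis
    then have "(\<lambda>t. vector_derivative (q i) (at t)) = q'" "continuous_on {0..1} q'"
      using vector_derivative_at continuous_on_polymonial_function by blast+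
    then show "continuous_on {0..1} (\<lambda>t. vector_derivative (q i) (at t))" by (simp only:)
  next
    fix z assume z: "z \<notin> S"
    have "winding_number (q i) z = winding_number (\<gamma> i) z" if i: "i \<in> I" for i
    proof -
      have "(\<lambda>w. 1 / (w - z)) holomorphic_on S" using z by (intro holomorphic_intros) auto
      moreover have "z \<notin> path_image (q i)" "z \<notin> path_image (\<gamma> i)" using z q(3) sub i by blast+
      ultimately show ?thesis
        using q(1,4) i \<gamma>[OF i] by (simp add: winding_number_valid_path valid_path_polynomial_function)
    qed
    then show "(\<Sum>i\<in>I. winding_number (q i) z) = 0" using wn[OF z] by simp
  qed (use q in auto)
  note dq_zero = this
  show ?thesis
  proof (cases "S = {}")
    case True
    then have "I = {}" using sub path_image_nonempty by blast
    then show ?thesis by simp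
  next
    case False
    then obtain z0 where z0: "z0 \<in> S" by blast
    \<comment> \<open>The difference quotient of \<open>f w * (w - z0)\<close> at \<open>z0\<close> is \<open>f\<close> even where \<open>w = z0\<close>, so \<open>z0\<close> may lie on the cycle.\<close>
    let ?g = "\<lambda>w. f w * (w - z0)"
    have "(?g has_field_derivative f z0) (at z0)"
      using holomorphic_derivI[OF f S z0] by (auto intro!: derivative_eq_intros)
    then have "difference_quotient ?g z0 = f"
      by (auto simp: difference_quotient_def DERIV_imp_deriv fun_eq_iff)
    moreover have "?g holomorphic_on S" using f by (intro holomorphic_intros)
    ultimately have "(\<Sum>i\<in>I. contour_integral (q i) f) = 0" using dq_zero[OF _ z0, of ?g] by simp
    then show ?thesis using q(4)[OF _ f] by simp
  qed
qed

abbreviation velocity :: "(real \<Rightarrow> complex) \<Rightarrow> real \<Rightarrow> complex" where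
  "velocity \<gamma> t \<equiv> vector_derivative \<gamma> (at t within {0..1})"

section \<open>Integration of holomorphic functions with values in a real Banach space\<close>

text \<open>A real Banach space is made complex by \<open>j\<close> with \<open>j\<^sup>2 = -1\<close>. The norm is not assumed to be
  complex homogeneous, so the scalar multiplication \<open>cs\<close> is only a bounded bilinear map.\<close>

locale complex_structure =
  fixes j :: "'e::banach \<Rightarrow> 'e"
  assumes bounded_linear_j: "bounded_linear j" and j_j: "\<And>x. j (j x) = - x"
begin

sublocale j: bounded_linear j by (rule bounded_linear_j)

definition cs :: "complex \<Rightarrow> 'e \<Rightarrow> 'e" where
  "cs z x = Re z *\<^sub>R x + Im z *\<^sub>R j x"

sublocale cs: bounded_bilinear cs
proof
  obtain K where K: "\<And>x. norm (j x) \<le> norm x * K" using j.bounded by blast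
  have "norm (cs z x) \<le> norm z * norm x * (1 + K)" for z x
  proof -
    have "norm (cs z x) \<le> \<bar>Re z\<bar> * norm x + \<bar>Im z\<bar> * norm (j x)"
      unfolding cs_def by (rule order_trans[OF norm_triangle_ineq]) simp
    also have "\<dots> \<le> norm z * norm x + norm z * (norm x * K)"
      by (intro add_mono mult_mono abs_Re_le_cmod abs_Im_le_cmod K) auto
    finally show ?thesis by (simp add: algebra_simps)
  qed
  then show "\<exists>K. \<forall>a b. norm (cs a b) \<le> norm a * norm b * K" by blast
qed (simp_all add: cs_def j.add j.scaleR algebra_simps)

lemma cs_one [simp]: "cs 1 x = x"
  by (simp add: cs_def)

lemma cs_mult: "cs (z * w) x = cs z (cs w x)"
  by (simp add: cs_def j.add j.scaleR j.diff j_j algebra_simps)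

lemma cs_commute: "cs z (cs w x) = cs w (cs z x)"
  by (metis cs_mult mult.commute)

definition cfun :: "('e \<Rightarrow> complex) \<Rightarrow> bool" where
  "cfun \<mu> \<longleftrightarrow> bounded_linear \<mu> \<and> (\<forall>x. \<mu> (j x) = \<i> * \<mu> x)"

lemma cfun_bounded_linear: "cfun \<mu> \<Longrightarrow> bounded_linear \<mu>"
  by (simp add: cfun_def)

lemma cfun_cs: "cfun \<mu> \<Longrightarrow> \<mu> (cs z x) = z * \<mu> x"
proof -
  assume "cfun \<mu>"
  then interpret bounded_linear \<mu> by (simp add: cfun_def)
  have "\<mu> (j x) = \<i> * \<mu> x" using \<open>cfun \<mu>\<close> by (simp add: cfun_def)
  then have "\<mu> (cs z x) = of_real (Re z) * \<mu> x + of_real (Im z) * (\<i> * \<mu> x)"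
    by (simp add: cs_def add scaleR scaleR_conv_of_real)
  also have "\<dots> = (of_real (Re z) + \<i> * of_real (Im z)) * \<mu> x" by (simp add: algebra_simps)
  finally show ?thesis by (metis complex_eq)
qed

lemma cfun_compose:
  assumes "cfun \<mu>" "bounded_linear L" "\<And>x. L (j x) = j (L x)"
  shows "cfun (\<lambda>x. \<mu> (L x))"
  using assms bounded_linear_compose unfolding cfun_def by auto

text \<open>Complexifying a real functional as \<open>\<phi> x - \<i> * \<phi> (j x)\<close> makes
  it complex linear and keeps \<open>\<phi>\<close> as its real part; real functionals separate
  points.\<close>

lemma eqI_cfun:
  assumes "\<And>\<mu>. cfun \<mu> \<Longrightarrow> \<mu> x = \<mu> y"
  shows "x = y"
proof (rule eqI_functional)
  fix \<phi> :: "'e \<Rightarrow> real" assume \<phi>: "bounded_linear \<phi>"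
  let ?l = "\<lambda>x. of_real (\<phi> x) - \<i> * of_real (\<phi> (j x))"
  have 1: "bounded_linear (\<lambda>x. complex_of_real (\<phi> x))"
    by (rule bounded_linear_compose[OF bounded_linear_of_real \<phi>])
  have "bounded_linear (\<lambda>x. complex_of_real (\<phi> (j x)))"
    by (rule bounded_linear_compose[OF 1 bounded_linear_j])
  then have "bounded_linear ?l"
    by (intro bounded_linear_sub 1 bounded_linear_const_mult)
  then have "cfun ?l"
    unfolding cfun_def by (simp add: j_j linear_neg[OF bounded_linear.linear[OF \<phi>]] algebra_simps)
  from assms[OF this] have "Re (?l x) = Re (?l y)" by simp
  then show "\<phi> x = \<phi> y" by simp
qed

text \<open>As \<open>'e\<close> is only a real normed space, complex differentiability is expressed
  by a real derivative that is complex linear through \<open>cs\<close>.\<close>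

definition holo :: "(complex \<Rightarrow> 'e) \<Rightarrow> complex set \<Rightarrow> bool" where
  "holo F S \<longleftrightarrow> (\<forall>z\<in>S. \<exists>D. (F has_derivative (\<lambda>h. cs h D)) (at z))"

lemma holo_continuous: "holo F S \<Longrightarrow> continuous_on S F"
  unfolding holo_def
  by (meson continuous_at_imp_continuous_on has_derivative_continuous)

lemma cfun_has_field_derivative:
  assumes "cfun \<mu>" "(F has_derivative (\<lambda>h. cs h D)) (at z)"
  shows "((\<lambda>z. \<mu> (F z)) has_field_derivative \<mu> D) (at z)"
  using bounded_linear.has_derivative[OF cfun_bounded_linear[OF assms(1)] assms(2)]
  unfolding has_field_derivative_def cfun_cs[OF assms(1)] by (simp add: mult_commute_abs)

lemma cfun_holo: "cfun \<mu> \<Longrightarrow> holo F S \<Longrightarrow> (\<lambda>z. \<mu> (F z)) holomorphic_on S"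
  unfolding holo_def holomorphic_on_def field_differentiable_def
  using cfun_has_field_derivative[of \<mu> F, THEN has_field_derivative_at_within] by blast

lemma has_derivative_cs:
  assumes "(h has_field_derivative h') (at z)" "(F has_derivative (\<lambda>k. cs k D)) (at z)"
  shows "((\<lambda>z. cs (h z) (F z)) has_derivative (\<lambda>k. cs k (cs (h z) D + cs h' (F z)))) (at z)"
proof -
  have "((\<lambda>z. cs (h z) (F z)) has_derivative (\<lambda>k. cs (h z) (cs k D) + cs (h' * k) (F z))) (at z)"
    using cs.FDERIV[of h "(*) h'" z UNIV F] assms by (simp add: has_field_derivative_def)
  moreover have "cs (h z) (cs k D) + cs (h' * k) (F z) = cs k (cs (h z) D + cs h' (F z))" for k
    by (simp add: cs.add_right cs_mult cs_commute)
  ultimately show ?thesis by simp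
qed

lemma holo_cs:
  assumes h: "h holomorphic_on S" and S: "open S" and F: "holo F S"
  shows "holo (\<lambda>z. cs (h z) (F z)) S"
  unfolding holo_def
proof
  fix z assume z: "z \<in> S"
  then obtain D where "(F has_derivative (\<lambda>h. cs h D)) (at z)" using F unfolding holo_def by blast
  from has_derivative_cs[OF holomorphic_derivI[OF h S z] this]
  show "\<exists>D. ((\<lambda>z. cs (h z) (F z)) has_derivative (\<lambda>k. cs k D)) (at z)" by blast
qed

lemma holo_linear:
  assumes F: "holo F S" and L: "bounded_linear L" "\<And>x. L (j x) = j (L x)"
  shows "holo (\<lambda>z. L (F z)) S"
  unfolding holo_def
proof
  interpret L: bounded_linear L by fact
  fix z assume z: "z \<in> S"
  then obtain D where D: "(F has_derivative (\<lambda>h. cs h D)) (at z)" using F unfolding holo_def by blast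
  have "L (cs h D) = cs h (L D)" for h by (simp add: cs_def L.add L.scaleR L(2))
  then show "\<exists>D. ((\<lambda>z. L (F z)) has_derivative (\<lambda>h. cs h D)) (at z)"
    using L.has_derivative[OF D] by auto
qed

lemma holo_diff:
  assumes "holo F S" "holo G S"
  shows "holo (\<lambda>z. F z - G z) S"
  unfolding holo_def
proof
  fix z assume "z \<in> S"
  then obtain D E where "(F has_derivative (\<lambda>h. cs h D)) (at z)" "(G has_derivative (\<lambda>h. cs h E)) (at z)"
    using assms unfolding holo_def by blast
  from has_derivative_diff[OF this]
  show "\<exists>D. ((\<lambda>z. F z - G z) has_derivative (\<lambda>h. cs h D)) (at z)"
    by (auto simp flip: cs.diff_right)
qed

lemma holo_subset: "holo F S \<Longrightarrow> S' \<subseteq> S \<Longrightarrow> holo F S'"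
  unfolding holo_def by blast

lemma cfun_integral:
  assumes "cfun \<mu>" "(\<lambda>t. cs (g t) (G t)) integrable_on {0..1}"
  shows "((\<lambda>t. \<mu> (G t) * g t) has_integral \<mu> (integral {0..1} (\<lambda>t. cs (g t) (G t)))) {0..1}"
  using has_integral_linear[OF integrable_integral[OF assms(2)] cfun_bounded_linear[OF assms(1)]]
  by (simp add: o_def cfun_cs[OF assms(1)] mult.commute)

text \<open>Segment integrals from the centre give the primitive. Their additivity along a triangle
  is tested with complex functionals, where the scalar theorem for convex sets applies.\<close>

lemma local_primitive:
  assumes F: "holo F (ball z0 r)" and r: "0 < r"
  shows "\<exists>\<Phi>. \<forall>z\<in>ball z0 r. (\<Phi> has_derivative (\<lambda>h. cs h (F z))) (at z)"
proof -
  define I where "I a b = integral {0..1} (\<lambda>t. cs (b - a) (F (linepath a b t)))" for a b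
  have contF: "continuous_on (ball z0 r) F" using holo_continuous[OF F] .
  have seg: "linepath a b t \<in> ball z0 r" if "a \<in> ball z0 r" "b \<in> ball z0 r" "t \<in> {0..1}" for a b t
    using closed_segment_subset[OF that(1,2) convex_ball] that(3) linepath_in_path by blast
  have contl: "continuous_on {0..1} (\<lambda>t. F (linepath a b t))" if "a \<in> ball z0 r" "b \<in> ball z0 r" for a b
    by (intro continuous_on_compose2[OF contF continuous_on_linepath] subsetI) (use seg[OF that] in blast)
  have int: "(\<lambda>t. cs (b - a) (F (linepath a b t))) integrable_on {0..1}" if "a \<in> ball z0 r" "b \<in> ball z0 r" for a b
    by (intro integrable_continuous_real cs.continuous_on continuous_intros contl[OF that])
  have add: "I z0 w - I z0 z = I z w" if z: "z \<in> ball z0 r" and w: "w \<in> ball z0 r" for z w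
  proof (rule eqI_cfun)
    fix \<mu> assume l: "cfun \<mu>"
    have "(\<lambda>z. \<mu> (F z)) holomorphic_on ball z0 r" using cfun_holo[OF l F] .
    then obtain g where g: "\<And>x. x \<in> ball z0 r \<Longrightarrow> (g has_field_derivative \<mu> (F x)) (at x within ball z0 r)"
      using holomorphic_convex_primitive'[OF convex_ball open_ball] by metis
    have *: "\<mu> (I a b) = g b - g a" if "a \<in> ball z0 r" "b \<in> ball z0 r" for a b
    proof -
      have "((\<lambda>z. \<mu> (F z)) has_contour_integral g b - g a) (linepath a b)"
        using contour_integral_primitive[OF g, of "linepath a b"] closed_segment_subset[OF that convex_ball] by simp
      moreover have "((\<lambda>z. \<mu> (F z)) has_contour_integral \<mu> (I a b)) (linepath a b)"
        unfolding has_contour_integral_linepath I_def using cfun_integral[OF l int[OF that]] .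
      ultimately show ?thesis by (metis contour_integral_unique)
    qed
    interpret l: bounded_linear \<mu> using cfun_bounded_linear[OF l] .
    have "z0 \<in> ball z0 r" using r by simp
    then show "\<mu> (I z0 w - I z0 z) = \<mu> (I z w)" using z w by (simp add: l.diff *)
  qed
  obtain K where K: "K > 0" "\<And>z x. norm (cs z x) \<le> norm z * norm x * K" using cs.pos_bounded by blast
  have "(I z0 has_derivative (\<lambda>h. cs h (F z))) (at z)" if z: "z \<in> ball z0 r" for z
    unfolding has_derivative_at_alt
  proof (intro conjI allI impI)
    show "bounded_linear (\<lambda>h. cs h (F z))" by (rule cs.bounded_linear_left)
    fix e :: real assume e: "0 < e"
    have "isCont F z" using contF z by (simp add: continuous_on_eq_continuous_at)
    moreover have "0 < e / K" using e K by simp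
    ultimately obtain d1 where d1: "0 < d1" "\<And>y. dist y z < d1 \<Longrightarrow> dist (F y) (F z) < e / K"
      unfolding continuous_at_eps_delta by metis
    obtain d2 where d2: "0 < d2" "ball z d2 \<subseteq> ball z0 r" using openE[OF open_ball z] .
    show "\<exists>d>0. \<forall>y. norm (y - z) < d \<longrightarrow> norm (I z0 y - I z0 z - cs (y - z) (F z)) \<le> e * norm (y - z)"
    proof (intro exI[of _ "min d1 d2"] conjI allI impI)
      fix y assume y: "norm (y - z) < min d1 d2"
      then have yb: "y \<in> ball z0 r" using d2 by (simp add: subset_eq dist_norm norm_minus_commute)
      \<comment> \<open>Writing \<open>cs (y - z) (F z)\<close> as the integral of a constant leaves
        only the oscillation of \<open>F\<close> along the segment.\<close>
      have "I z0 y - I z0 z - cs (y - z) (F z) = I z y - integral {0..1} (\<lambda>t::real. cs (y - z) (F z))"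
        using add[OF z yb] by simp
      also have "\<dots> = integral {0..1} (\<lambda>t. cs (y - z) (F (linepath z y t)) - cs (y - z) (F z))"
        unfolding I_def by (rule integral_diff[symmetric, OF int[OF z yb]]) auto
      also have "norm \<dots> \<le> e * norm (y - z) * (1 - 0)"
      proof (rule integral_bound)
        show "continuous_on {0..1} (\<lambda>t. cs (y - z) (F (linepath z y t)) - cs (y - z) (F z))"
          by (intro continuous_intros cs.continuous_on contl[OF z yb])
        fix t :: real assume t: "t \<in> {0..1}"
        have "norm (linepath z y t - z) \<le> norm (y - z)"
        proof -
          have "linepath z y t - z = t *\<^sub>R (y - z)" by (simp add: linepath_def algebra_simps)
          then show ?thesis using t by (simp add: mult_left_le_one_le)
        qed
        then have "norm (F (linepath z y t) - F z) \<le> e / K"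
          using d1(2)[of "linepath z y t"] y by (simp add: dist_norm less_imp_le)
        then have "norm (y - z) * norm (F (linepath z y t) - F z) * K \<le> norm (y - z) * (e / K) * K"
          using K by (intro mult_right_mono mult_left_mono) auto
        then show "norm (cs (y - z) (F (linepath z y t)) - cs (y - z) (F z)) \<le> e * norm (y - z)"
          using K(2)[of "y - z" "F (linepath z y t) - F z"] K(1) by (simp add: cs.diff_right mult.commute)
      qed simp
      finally show "norm (I z0 y - I z0 z - cs (y - z) (F z)) \<le> e * norm (y - z)" by simp
    qed (use d1 d2 in auto)
  qed
  then show ?thesis by blast
qed

text \<open>The velocity may be unbounded near the finitely many exceptional parameters, so
  continuity does not settle integrability. Locally it follows from the fundamental theorem of
  calculus for a primitive composed with the path.\<close>

lemma holo_path_integrable: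
  assumes F: "holo F S" and S: "open S" and \<gamma>: "valid_path \<gamma>" "path_image \<gamma> \<subseteq> S"
  shows "(\<lambda>t. cs (velocity \<gamma> t) (F (\<gamma> t))) integrable_on {0..1}"
proof -
  let ?f = "\<lambda>t. cs (velocity \<gamma> t) (F (\<gamma> t))"
  have gc: "continuous_on {0..1} \<gamma>" using \<gamma>(1) valid_path_imp_path path_def by blast
  from \<gamma>(1) obtain B where B: "finite B" and C1: "\<gamma> C1_differentiable_on ({0..1} - B)"
    unfolding valid_path_def piecewise_C1_differentiable_on_def by blast
  have "?f integrable_on cbox 0 1"
  proof (rule integrable_on_little_subintervals, intro ballI)
    fix x :: real assume "x \<in> cbox 0 1"
    then have x: "x \<in> {0..1}" by simp
    then have "\<gamma> x \<in> S" using \<gamma>(2) by (auto simp: path_image_def)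
    then obtain r where r: "0 < r" "ball (\<gamma> x) r \<subseteq> S" using openE[OF S] by metis
    obtain \<Phi> where \<Phi>: "\<And>z. z \<in> ball (\<gamma> x) r \<Longrightarrow> (\<Phi> has_derivative (\<lambda>h. cs h (F z))) (at z)"
      using local_primitive[OF holo_subset[OF F r(2)] r(1)] by blast
    obtain d where d: "0 < d" "\<And>t. t \<in> {0..1} \<Longrightarrow> dist t x < d \<Longrightarrow> dist (\<gamma> t) (\<gamma> x) < r"
      using gc x r(1) unfolding continuous_on_iff by metis
    have "?f integrable_on {u..v}" if ux: "u \<le> x" "x \<le> v" and sub: "{u..v} \<subseteq> ball x d" "{u..v} \<subseteq> {0..1}" for u v
    proof -
      have inb: "\<gamma> t \<in> ball (\<gamma> x) r" if "t \<in> {u..v}" for t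
        using d(2)[of t] that sub by (auto simp: dist_commute)
      have cont\<Phi>: "continuous_on (ball (\<gamma> x) r) \<Phi>"
        using \<Phi> by (meson continuous_at_imp_continuous_on has_derivative_continuous)
      have "(?f has_integral ((\<lambda>t. \<Phi> (\<gamma> t)) v - (\<lambda>t. \<Phi> (\<gamma> t)) u)) {u..v}"
      proof (rule fundamental_theorem_of_calculus_interior_strong[OF B])
        show "u \<le> v" using ux by simp
        show "continuous_on {u..v} (\<lambda>t. \<Phi> (\<gamma> t))"
          by (intro continuous_on_compose2[OF cont\<Phi> continuous_on_subset[OF gc sub(2)]] subsetI)
            (use inb in blast)
        fix t assume t: "t \<in> {u<..<v} - B"
        then have t': "t \<in> {u..v}" "t \<in> {0..1} - B" using sub(2) by auto
        then obtain D where D: "(\<gamma> has_vector_derivative D) (at t)"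
          using C1 unfolding C1_differentiable_on_def by blast
        have "velocity \<gamma> t = D"
          using vector_derivative_at_within_ivl[OF D] t' by auto
        moreover have "((\<lambda>t. \<Phi> (\<gamma> t)) has_derivative (\<lambda>h. cs (h *\<^sub>R D) (F (\<gamma> t)))) (at t)"
          using diff_chain_at[OF D[unfolded has_vector_derivative_def] \<Phi>[OF inb[OF t'(1)]]]
          by (simp add: o_def)
        ultimately show "((\<lambda>t. \<Phi> (\<gamma> t)) has_vector_derivative ?f t) (at t)"
          by (simp add: has_vector_derivative_def cs.scaleR_left)
      qed
      then show ?thesis by blast
    qed
    then show "\<exists>d>0. \<forall>u v. x \<in> cbox u v \<and> cbox u v \<subseteq> ball x d \<and> cbox u v \<subseteq> cbox 0 1 \<longrightarrow> ?f integrable_on cbox u v"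
      using d(1) by (intro exI[of _ d]) (simp del: atLeastatMost_subset_iff)
  qed
  then show ?thesis by simp
qed

text \<open>The bridge to scalar contour integration; by \<open>eqI_cfun\<close> these values
  determine the vector-valued integral.\<close>

lemma cfun_path_integral:
  assumes F: "holo F S" and S: "open S" and \<gamma>: "valid_path \<gamma>" "path_image \<gamma> \<subseteq> S" and l: "cfun \<mu>"
  shows "\<mu> (integral {0..1} (\<lambda>t. cs (velocity \<gamma> t) (F (\<gamma> t))))
     = contour_integral \<gamma> (\<lambda>z. \<mu> (F z))"
  using cfun_integral[OF l holo_path_integrable[OF F S \<gamma>]]
  by (intro contour_integral_unique[symmetric]) (simp add: has_contour_integral_def)

end

section \<open>Moving a cycle to a circle and letting circles grow\<close>

lemma Cauchy_theorem_cycle_eq_circle: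
  fixes \<gamma> :: "'i \<Rightarrow> real \<Rightarrow> complex"
  assumes I: "finite I" and S: "open S" and f: "f holomorphic_on S"
    and \<gamma>: "\<And>i. i \<in> I \<Longrightarrow> valid_path (\<gamma> i)"
    and loop: "\<And>i. i \<in> I \<Longrightarrow> pathfinish (\<gamma> i) = pathstart (\<gamma> i)"
    and sub: "\<And>i. i \<in> I \<Longrightarrow> path_image (\<gamma> i) \<subseteq> S"
    and circ: "path_image (circlepath a \<rho>) \<subseteq> S"
    and wn: "\<And>z. z \<notin> S \<Longrightarrow> (\<Sum>i\<in>I. winding_number (\<gamma> i) z) = winding_number (circlepath a \<rho>) z"
  shows "(\<Sum>i\<in>I. contour_integral (\<gamma> i) f) = contour_integral (circlepath a \<rho>) f"
proof -
  \<comment> \<open>\<open>None\<close> indexes the reversed circle, which brings the total winding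
    number outside \<open>S\<close> to zero.\<close>
  define \<delta> where "\<delta> = case_option (reversepath (circlepath a \<rho>)) \<gamma>"
  let ?I = "insert None (Some ` I)"
  have sum: "(\<Sum>i\<in>?I. F (\<delta> i)) = F (reversepath (circlepath a \<rho>)) + (\<Sum>i\<in>I. F (\<gamma> i))"
    for F :: "(real \<Rightarrow> complex) \<Rightarrow> complex"
    using I by (subst sum.insert) (auto simp: sum.reindex \<delta>_def)
  have "(\<Sum>i\<in>?I. contour_integral (\<delta> i) f) = 0"
  proof (rule Cauchy_theorem_cycle[OF _ S f])
    fix z assume z: "z \<notin> S"
    then have "z \<notin> path_image (circlepath a \<rho>)" using circ by blast
    then show "(\<Sum>i\<in>?I. winding_number (\<delta> i) z) = 0"
      unfolding sum[of "\<lambda>p. winding_number p z"] using wn[OF z] by (simp add: winding_number_reversepath valid_path_imp_path)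
  qed (use I \<gamma> loop circ in \<open>auto simp: \<delta>_def dest: subsetD[OF sub]\<close>)
  then show ?thesis unfolding sum[of "\<lambda>p. contour_integral p f"] by (simp add: contour_integral_reversepath)
qed

text \<open>Outside the disc the radius can be enlarged without changing the integral, while
  circumference times maximum of \<open>norm (g z)\<close> tends to zero.\<close>

lemma contour_integral_circle_eq_0:
  assumes g: "g holomorphic_on - cball 0 s" and s: "0 \<le> s" "s < \<rho>"
    and lim: "((\<lambda>z. z * g z) \<longlongrightarrow> 0) at_infinity"
  shows "contour_integral (circlepath 0 \<rho>) g = 0"
proof -
  have S: "open (- cball 0 s :: complex set)" by auto
  have \<rho>: "0 < \<rho>" using s by simp
  have eq: "contour_integral (circlepath 0 \<rho>) g = contour_integral (circlepath 0 \<rho>2) g" if "\<rho> \<le> \<rho>2" for \<rho>2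
  proof -
    \<comment> \<open>The one-element index set turns the smaller circle into a cycle.\<close>
    have "(\<Sum>i\<in>{()}. contour_integral (circlepath 0 \<rho>) g) = contour_integral (circlepath 0 \<rho>2) g"
    proof (rule Cauchy_theorem_cycle_eq_circle[OF _ S g])
      fix z :: complex assume "z \<notin> - cball 0 s"
      then have "norm (z - 0) < \<rho>" "norm (z - 0) < \<rho>2" using s that by auto
      then show "(\<Sum>i\<in>{()}. winding_number (circlepath 0 \<rho>) z) = winding_number (circlepath 0 \<rho>2) z"
        by (simp only: winding_number_circlepath) simp
    qed (use s that in \<open>auto simp: sphere_def\<close>)
    then show ?thesis by simp
  qed
  have "norm (contour_integral (circlepath 0 \<rho>) g) \<le> e" if e: "0 < e" for e
  proof -
    have "0 < e / (2 * pi)" using e by simp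
    then have "eventually (\<lambda>z. norm (z * g z) < e / (2 * pi)) at_infinity"
      using tendstoD[OF lim] by simp
    then obtain B where B: "\<And>z. B \<le> norm z \<Longrightarrow> norm (z * g z) < e / (2 * pi)"
      unfolding eventually_at_infinity by blast
    define \<rho>2 where "\<rho>2 = max B \<rho>"
    have r2: "0 < \<rho>2" "\<rho> \<le> \<rho>2" "B \<le> \<rho>2" using \<rho> by (auto simp: \<rho>2_def)
    have "g contour_integrable_on circlepath 0 \<rho>2"
      using r2 s by (intro contour_integrable_holomorphic_simple[OF g S]) (auto simp: sphere_def)
    then have "norm (contour_integral (circlepath 0 \<rho>2) g) \<le> e / (2 * pi) / \<rho>2 * (2 * pi * \<rho>2)"
    proof (rule has_contour_integral_bound_circlepath[OF has_contour_integral_integral])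
      fix x :: complex assume x: "norm (x - 0) = \<rho>2"
      then have "norm x * norm (g x) \<le> e / (2 * pi)" using B[of x] r2 by (simp add: norm_mult)
      then show "norm (g x) \<le> e / (2 * pi) / \<rho>2" using x r2 by (simp add: field_simps)
    qed (use e r2 in auto)
    also have "\<dots> = e" using r2 by simp
    finally show ?thesis using eq[OF r2(2)] by simp
  qed
  then have "norm (contour_integral (circlepath 0 \<rho>) g) \<le> 0" by (meson field_le_epsilon add_0 order_refl add.commute le_add_same_cancel1 zero_le_numeral dense_ge)
  then show ?thesis by simp
qed

text \<open>Leaves room for a circle of radius strictly between \<open>s\<close> and
  \<open>r\<close>.\<close>

lemma compact_subset_smaller_cball:
  fixes K :: "'a::real_normed_vector set"
  assumes "compact K" "K \<subseteq> ball 0 r" "0 < r"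
  obtains s where "0 \<le> s" "s < r" "K \<subseteq> cball 0 s"
proof (cases "K = {}")
  case True then show ?thesis using that[of 0] assms by auto
next
  case False
  obtain x where "x \<in> K" "\<And>y. y \<in> K \<Longrightarrow> norm y \<le> norm x"
    using continuous_attains_sup[OF assms(1) False, of norm] continuous_on_norm_id by blast
  then show ?thesis using assms(2) by (intro that[of "norm x"]) (auto simp: subset_eq)
qed

section \<open>The calculus of a quadratic resolvent\<close>

text \<open>The homology condition: towards \<open>K\<close> and towards the complement of
  \<open>\<Omega>\<close>, the cycle has the winding numbers of a circle around \<open>K\<close>
  bounding a disc in \<open>\<Omega>\<close>.\<close>

definition encircles :: "(real \<Rightarrow> complex) set \<Rightarrow> complex set \<Rightarrow> complex set \<Rightarrow> bool" where
  "encircles G K \<Omega> \<longleftrightarrow> finite G \<and>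
     (\<forall>\<gamma>\<in>G. valid_path \<gamma> \<and> pathfinish \<gamma> = pathstart \<gamma> \<and> path_image \<gamma> \<subseteq> \<Omega> - K) \<and>
     (\<forall>z\<in>K. (\<Sum>\<gamma>\<in>G. winding_number \<gamma> z) = 1) \<and>
     (\<forall>z. z \<notin> \<Omega> \<longrightarrow> (\<Sum>\<gamma>\<in>G. winding_number \<gamma> z) = 0)"

text \<open>In the application \<open>K\<close> is a slice of the S-spectrum, \<open>e\<close> the
  identity operator, \<open>L\<close> and \<open>N\<close> are compositions with the scalar part and
  with the product of the operator and its conjugate, and \<open>Lb\<close> multiplies by the
  conjugate from the side that the kernel dictates.\<close>

locale quadratic_resolvent = complex_structure j for j :: "'e::banach \<Rightarrow> 'e" +
  fixes R R' :: "complex \<Rightarrow> 'e" and K :: "complex set" and L N Lb :: "'e \<Rightarrow> 'e" and e :: 'e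
  assumes bounded_linear_L: "bounded_linear L" and bounded_linear_N: "bounded_linear N"
    and bounded_linear_Lb: "bounded_linear Lb"
    and L_j: "\<And>x. L (j x) = j (L x)" and N_j: "\<And>x. N (j x) = j (N x)" and Lb_j: "\<And>x. Lb (j x) = j (Lb x)"
    and compact_K: "compact K"
    and R_has_derivative: "\<And>z. z \<notin> K \<Longrightarrow> (R has_derivative (\<lambda>h. cs h (R' z))) (at z)"
    and holo_R': "holo R' (- K)"
    and resolvent_eq: "\<And>z. z \<notin> K \<Longrightarrow> cs (z\<^sup>2) (R z) - 2 *\<^sub>R cs z (L (R z)) + N (R z) = e"
begin

text \<open>Formally the coefficients of \<open>z^(-n-1)\<close> in the expansion of
  \<open>R\<close> at infinity; the recursion compares coefficients in \<open>resolvent_eq\<close>.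
  The first one is 0 because \<open>R\<close> decays like \<open>z^(-2)\<close>.\<close>

fun moment :: "nat \<Rightarrow> 'e" where
  "moment 0 = 0"
| "moment (Suc 0) = e"
| "moment (Suc (Suc n)) = 2 *\<^sub>R L (moment (Suc n)) - N (moment n)"

definition kernel :: "complex \<Rightarrow> 'e" where
  "kernel z = -2 *\<^sub>R (cs z (R' z) - Lb (R' z))"

text \<open>Integration by parts turns the moment of order \<open>n\<close> of \<open>R'\<close>
  into \<open>- n\<close> times the moment of order \<open>n - 1\<close> of \<open>R\<close>; this
  yields the weights \<open>m + 1\<close> and \<open>m\<close>. At \<open>m = 0\<close> the
  truncated \<open>m - 1\<close> is harmless, its weight being 0.\<close>

definition kernel_moment :: "nat \<Rightarrow> 'e" where
  "kernel_moment m = 2 *\<^sub>R (real (m + 1) *\<^sub>R moment m - real m *\<^sub>R Lb (moment (m - 1)))"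

lemma open_compl_K: "open (- K)"
  using compact_K compact_imp_closed by blast

lemma holo_R: "holo R (- K)"
  unfolding holo_def using R_has_derivative by blast

lemma holo_kernel: "holo kernel (- K)"
proof -
  have "bounded_linear (\<lambda>x. -2 *\<^sub>R (x :: 'e))" by (rule bounded_linear_scaleR_right)
  from holo_linear[OF holo_diff[OF holo_cs[OF holomorphic_on_ident open_compl_K holo_R']
          holo_linear[OF holo_R' bounded_linear_Lb Lb_j]] this]
  show ?thesis unfolding kernel_def by (simp add: j.scaleR j.neg)
qed

lemma cfun_L: "cfun \<mu> \<Longrightarrow> cfun (\<lambda>x. \<mu> (L x))"
  and cfun_N: "cfun \<mu> \<Longrightarrow> cfun (\<lambda>x. \<mu> (N x))"
  and cfun_Lb: "cfun \<mu> \<Longrightarrow> cfun (\<lambda>x. \<mu> (Lb x))"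
  by (rule cfun_compose; simp add: bounded_linear_L bounded_linear_N bounded_linear_Lb L_j N_j Lb_j)+

text \<open>Solving \<open>resolvent_eq\<close> for \<open>cs (z^2) (R z)\<close> leaves
  \<open>e\<close> and terms of size at most a constant times \<open>norm z * norm (R z)\<close>,
  which for large \<open>z\<close> are absorbed into the left-hand side.\<close>

lemma R_decay: "\<exists>C B. \<forall>z. B \<le> norm z \<longrightarrow> norm (R z) \<le> C / (norm z)\<^sup>2"
proof -
  obtain k where k: "0 < k" "\<And>z x. norm (cs z x) \<le> norm z * norm x * k" using cs.pos_bounded by blast
  obtain a where a: "0 < a" "\<And>x. norm (L x) \<le> norm x * a" using bounded_linear.pos_bounded[OF bounded_linear_L] by blast
  obtain b where b: "0 < b" "\<And>x. norm (N x) \<le> norm x * b" using bounded_linear.pos_bounded[OF bounded_linear_N] by blast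
  obtain c where c: "\<And>z. z \<in> K \<Longrightarrow> norm z \<le> c" using compact_imp_bounded[OF compact_K] unfolding bounded_iff by blast
  \<comment> \<open>\<open>d\<close> collects the bounds of \<open>cs\<close>, \<open>L\<close> and
    \<open>N\<close>: once \<open>norm z\<close> exceeds \<open>2 * d\<close>, the terms with
    \<open>R\<close> amount to at most half of the left-hand side. The bound \<open>c + 1\<close> in
    \<open>B\<close> keeps \<open>z\<close> off \<open>K\<close>.\<close>
  define d where "d = k * (2 * k * a + b)"
  define B where "B = max (max 1 (2 * d)) (c + 1)"
  have d: "0 < d" unfolding d_def by (intro mult_pos_pos add_pos_pos k a b) auto
  have "norm (R z) \<le> (2 * k * norm e) / (norm z)\<^sup>2" if "B \<le> norm z" for z
  proof -
    have z: "1 \<le> norm z" "2 * d \<le> norm z" "z \<notin> K" using that c[of z] by (auto simp: B_def)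
    let ?x = "R z" and ?n = "norm z"
    have z0: "z \<noteq> 0" using z by auto
    have eq: "cs (z\<^sup>2) ?x = e + 2 *\<^sub>R cs z (L ?x) - N ?x"
      using resolvent_eq[OF z(3)] by (simp add: algebra_simps)
    have "?x = cs (1 / z\<^sup>2) (cs (z\<^sup>2) ?x)" using z0 by (simp flip: cs_mult)
    then have "norm ?x \<le> norm (1 / z\<^sup>2) * norm (e + 2 *\<^sub>R cs z (L ?x) - N ?x) * k"
      using k(2)[of "1 / z\<^sup>2" "cs (z\<^sup>2) ?x"] unfolding eq by metis
    also have "norm (e + 2 *\<^sub>R cs z (L ?x) - N ?x) \<le> norm e + 2 * (?n * (norm ?x * a) * k) + norm ?x * b"
    proof -
      have "norm (cs z (L ?x)) \<le> ?n * norm (L ?x) * k" by (rule k)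
      also have "\<dots> \<le> ?n * (norm ?x * a) * k" using k a by (intro mult_right_mono mult_left_mono) auto
      finally have "norm (2 *\<^sub>R cs z (L ?x)) \<le> 2 * (?n * (norm ?x * a) * k)" by simp
      then show ?thesis using b(2)[of ?x] norm_triangle_ineq4[of "e + 2 *\<^sub>R cs z (L ?x)" "N ?x"]
          norm_triangle_ineq[of e "2 *\<^sub>R cs z (L ?x)"] by linarith
    qed
    also have "\<dots> \<le> norm e + ?n * (2 * k * a + b) * norm ?x"
    proof -
      have "norm ?x * b \<le> ?n * (norm ?x * b)" using mult_right_mono[OF z(1), of "norm ?x * b"] b(1) by simp
      then show ?thesis by (simp add: algebra_simps)
    qed
    finally have "norm ?x \<le> norm (1 / z\<^sup>2) * (norm e + ?n * (2 * k * a + b) * norm ?x) * k"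
      using k by (simp add: mult_left_mono mult_right_mono)
    then have "norm ?x \<le> (k * norm e + ?n * d * norm ?x) / ?n\<^sup>2"
      by (simp add: d_def norm_divide norm_power algebra_simps add_divide_distrib)
    then have "norm ?x * ?n\<^sup>2 \<le> k * norm e + ?n * d * norm ?x"
      using z0 by (simp add: pos_le_divide_eq)
    moreover have "?n * d * norm ?x \<le> ?n * (?n / 2) * norm ?x"
      using z by (intro mult_right_mono mult_left_mono) auto
    ultimately have "norm ?x * ?n\<^sup>2 \<le> 2 * k * norm e" by (simp add: power2_eq_square algebra_simps)
    then show ?thesis using z0 by (simp add: pos_le_divide_eq)
  qed
  then show ?thesis by blast
qed

text \<open>The second form serves the moment of order 1, where the resolvent equation is divided by
  \<open>z\<close>.\<close>

lemma R_tendsto: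
  assumes "cfun \<mu>"
  shows "((\<lambda>z. z * \<mu> (R z)) \<longlongrightarrow> 0) at_infinity" and "((\<lambda>z. z * (inverse z * \<mu> (R z))) \<longlongrightarrow> 0) at_infinity"
proof -
  obtain C B where CB: "\<And>z. B \<le> norm z \<Longrightarrow> norm (R z) \<le> C / (norm z)\<^sup>2" using R_decay by blast
  obtain M where M: "0 < M" "\<And>x. norm (\<mu> x) \<le> norm x * M"
    using bounded_linear.pos_bounded[OF cfun_bounded_linear[OF assms]] by blast
  show 1: "((\<lambda>z. z * \<mu> (R z)) \<longlongrightarrow> 0) at_infinity"
  proof (rule Lim_null_comparison)
    have "norm (z * \<mu> (R z)) \<le> C * M / norm z" if z: "max B 1 \<le> norm z" for z
    proof -
      have "norm (\<mu> (R z)) \<le> C / (norm z)\<^sup>2 * M"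
        using M(2)[of "R z"] CB[of z] z M(1) by (meson max.boundedE mult_right_mono order_trans less_imp_le)
      then have "norm z * norm (\<mu> (R z)) \<le> norm z * (C / (norm z)\<^sup>2 * M)" by (intro mult_left_mono) auto
      moreover have "z \<noteq> 0" using z by auto
      ultimately show ?thesis by (simp add: norm_mult power2_eq_square)
    qed
    then show "eventually (\<lambda>z. norm (z * \<mu> (R z)) \<le> C * M / norm z) at_infinity"
      unfolding eventually_at_infinity by blast
    show "((\<lambda>z::complex. C * M / norm z) \<longlongrightarrow> 0) at_infinity"
      by (intro tendsto_divide_0[OF tendsto_const] filterlim_at_top_imp_at_infinity filterlim_norm_at_top)
  qed
  have "((\<lambda>z. inverse z * (z * \<mu> (R z))) \<longlongrightarrow> 0 * 0) at_infinity"
    by (intro tendsto_mult 1 tendsto_inverse_0)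
  then show "((\<lambda>z. z * (inverse z * \<mu> (R z))) \<longlongrightarrow> 0) at_infinity"
    by (simp add: mult.left_commute)
qed

context
  fixes \<rho> :: real
  assumes \<rho>: "0 < \<rho>" and K_in: "K \<subseteq> ball 0 \<rho>"
begin

lemma circle_outside_K: "path_image (circlepath 0 \<rho>) \<subseteq> - K"
  using \<rho> K_in by (auto simp: subset_eq)

lemma circle_integrable: "f holomorphic_on - K \<Longrightarrow> f contour_integrable_on circlepath 0 \<rho>"
  using contour_integrable_holomorphic_simple[OF _ open_compl_K _ circle_outside_K] by simp

text \<open>The induction varies \<open>\<mu>\<close>, since the recursion replaces it by its
  compositions with \<open>L\<close> and \<open>N\<close>. Order 0 vanishes by decay; in order 1
  only \<open>\<mu> e / z\<close> survives; in higher orders the polynomial term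
  \<open>z ^ n * \<mu> e\<close> integrates to zero.\<close>

lemma circle_integral_resolvent:
  "cfun \<mu> \<Longrightarrow> contour_integral (circlepath 0 \<rho>) (\<lambda>z. z ^ m * \<mu> (R z)) = 2 * of_real pi * \<i> * \<mu> (moment m)"
proof (induction m arbitrary: \<mu> rule: moment.induct)
  obtain s where s: "0 \<le> s" "s < \<rho>" "K \<subseteq> cball 0 s"
    using compact_subset_smaller_cball[OF compact_K K_in \<rho>] by blast
  have hol: "(\<lambda>z. \<mu> (R z)) holomorphic_on - K" if "cfun \<mu>" for \<mu> using cfun_holo[OF that holo_R] .
  have hol_s: "(\<lambda>z. \<mu> (R z)) holomorphic_on - cball 0 s" if "cfun \<mu>" for \<mu>
    using holomorphic_on_subset[OF hol[OF that]] s(3) by blast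
  have eq: "z\<^sup>2 * \<mu> (R z) = \<mu> e + 2 * (z * \<mu> (L (R z))) - \<mu> (N (R z))" if "cfun \<mu>" "z \<notin> K" for \<mu> z
  proof -
    interpret \<mu>: bounded_linear \<mu> using cfun_bounded_linear[OF that(1)] .
    have "\<mu> e = z\<^sup>2 * \<mu> (R z) - 2 * (z * \<mu> (L (R z))) + \<mu> (N (R z))"
      unfolding resolvent_eq[OF that(2), symmetric]
      by (simp add: \<mu>.add \<mu>.diff \<mu>.scaleR cfun_cs[OF that(1)] scaleR_conv_of_real)
    then show ?thesis by (simp add: algebra_simps)
  qed
  {
    case (1 \<mu>)
    have "contour_integral (circlepath 0 \<rho>) (\<lambda>z. \<mu> (R z)) = 0"
      by (rule contour_integral_circle_eq_0[OF hol_s[OF 1] s(1,2) R_tendsto(1)[OF 1]])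
    moreover have "\<mu> 0 = 0" using bounded_linear.linear[OF cfun_bounded_linear[OF 1]] linear_0 by blast
    ultimately show ?case by simp
  next
    case (2 \<mu>)
    have "contour_integral (circlepath 0 \<rho>) (\<lambda>z. z * \<mu> (R z))
        = contour_integral (circlepath 0 \<rho>) (\<lambda>z. \<mu> e / (z - 0) + (2 * \<mu> (L (R z)) - inverse z * \<mu> (N (R z))))"
    proof (rule contour_integral_eq)
      fix z assume z: "z \<in> path_image (circlepath 0 \<rho>)"
      then have "z \<noteq> 0" "z \<notin> K" using \<rho> circle_outside_K by auto
      then show "z * \<mu> (R z) = \<mu> e / (z - 0) + (2 * \<mu> (L (R z)) - inverse z * \<mu> (N (R z)))"
        using eq[OF 2, of z] by (simp add: field_simps power2_eq_square)
    qed
    also have "\<dots> = 2 * of_real pi * \<i> * \<mu> e + (2 * 0 - 0)"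
    proof (intro contour_integral_unique has_contour_integral_add has_contour_integral_diff has_contour_integral_lmul)
      show "((\<lambda>z. \<mu> e / (z - 0)) has_contour_integral 2 * of_real pi * \<i> * \<mu> e) (circlepath 0 \<rho>)"
        using \<rho> by (intro Cauchy_integral_circlepath_simple) auto
      have "contour_integral (circlepath 0 \<rho>) (\<lambda>z. \<mu> (L (R z))) = 0"
        by (rule contour_integral_circle_eq_0[OF hol_s[OF cfun_L[OF 2]] s(1,2) R_tendsto(1)[OF cfun_L[OF 2]]])
      then show "((\<lambda>z. \<mu> (L (R z))) has_contour_integral 0) (circlepath 0 \<rho>)"
        using has_contour_integral_integral[OF circle_integrable[OF hol[OF cfun_L[OF 2]]]] by simp
      have h: "(\<lambda>z. inverse z * \<mu> (N (R z))) holomorphic_on - cball 0 s"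
        using hol_s[OF cfun_N[OF 2]] s(1) by (intro holomorphic_intros) auto
      have "contour_integral (circlepath 0 \<rho>) (\<lambda>z. inverse z * \<mu> (N (R z))) = 0"
        by (rule contour_integral_circle_eq_0[OF h s(1,2) R_tendsto(2)[OF cfun_N[OF 2]]])
      moreover have "(\<lambda>z. inverse z * \<mu> (N (R z))) contour_integrable_on circlepath 0 \<rho>"
        using s by (intro contour_integrable_holomorphic_simple[OF h]) auto
      ultimately show "((\<lambda>z. inverse z * \<mu> (N (R z))) has_contour_integral 0) (circlepath 0 \<rho>)"
        using has_contour_integral_integral by fastforce
    qed
    finally show ?case by simp
  next
    case (3 n \<mu>)
    interpret \<mu>: bounded_linear \<mu> using cfun_bounded_linear[OF 3(3)] .
    have "contour_integral (circlepath 0 \<rho>) (\<lambda>z. z ^ Suc (Suc n) * \<mu> (R z))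
        = contour_integral (circlepath 0 \<rho>) (\<lambda>z. z ^ n * \<mu> e + (2 * (z ^ Suc n * \<mu> (L (R z))) - z ^ n * \<mu> (N (R z))))"
    proof (rule contour_integral_eq)
      fix z assume z: "z \<in> path_image (circlepath 0 \<rho>)"
      then have "z ^ n * (z\<^sup>2 * \<mu> (R z)) = z ^ n * (\<mu> e + 2 * (z * \<mu> (L (R z))) - \<mu> (N (R z)))"
        using eq[OF 3(3), of z] circle_outside_K by auto
      then show "z ^ Suc (Suc n) * \<mu> (R z) = z ^ n * \<mu> e + (2 * (z ^ Suc n * \<mu> (L (R z))) - z ^ n * \<mu> (N (R z)))"
        by (simp add: power2_eq_square algebra_simps)
    qed
    also have "\<dots> = 0 + (2 * (2 * of_real pi * \<i> * \<mu> (L (moment (Suc n)))) - 2 * of_real pi * \<i> * \<mu> (N (moment n)))"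
    proof (intro contour_integral_unique has_contour_integral_add has_contour_integral_diff has_contour_integral_lmul)
      show "((\<lambda>z. z ^ n * \<mu> e) has_contour_integral 0) (circlepath 0 \<rho>)"
        by (rule Cauchy_theorem_convex_simple[of _ UNIV]) (auto intro!: holomorphic_intros)
      have "(\<lambda>z. z ^ Suc n * \<mu> (L (R z))) holomorphic_on - K"
        by (intro holomorphic_intros hol cfun_L 3(3))
      from has_contour_integral_integral[OF circle_integrable[OF this]]
      show "((\<lambda>z. z ^ Suc n * \<mu> (L (R z))) has_contour_integral 2 * of_real pi * \<i> * \<mu> (L (moment (Suc n)))) (circlepath 0 \<rho>)"
        using 3(1)[OF cfun_L[OF 3(3)]] by simp
      have "(\<lambda>z. z ^ n * \<mu> (N (R z))) holomorphic_on - K"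
        by (intro holomorphic_intros hol cfun_N 3(3))
      from has_contour_integral_integral[OF circle_integrable[OF this]]
      show "((\<lambda>z. z ^ n * \<mu> (N (R z))) has_contour_integral 2 * of_real pi * \<i> * \<mu> (N (moment n))) (circlepath 0 \<rho>)"
        using 3(2)[OF cfun_N[OF 3(3)]] by simp
    qed
    finally show ?case by (simp add: \<mu>.diff \<mu>.scaleR scaleR_conv_of_real algebra_simps)
  }
qed

text \<open>Integration by parts: the derivative of \<open>z ^ m * \<mu> (R z)\<close> has integral
  zero over a closed path.\<close>

lemma circle_integral_resolvent_derivative:
  assumes "cfun \<mu>"
  shows "((\<lambda>z. z ^ m * \<mu> (R' z)) has_contour_integral - of_nat m * (2 * of_real pi * \<i> * \<mu> (moment (m - 1)))) (circlepath 0 \<rho>)"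
proof -
  have hol: "(\<lambda>z. \<mu> (R z)) holomorphic_on - K" "(\<lambda>z. \<mu> (R' z)) holomorphic_on - K"
    using cfun_holo[OF assms] holo_R holo_R' by auto
  have "((\<lambda>z. z ^ m * \<mu> (R z)) has_field_derivative of_nat m * (z ^ (m - 1) * \<mu> (R z)) + z ^ m * \<mu> (R' z)) (at z within - K)"
    if "z \<in> - K" for z
  proof -
    have "((\<lambda>z. z ^ m) has_field_derivative of_nat m * z ^ (m - 1)) (at z)"
      using DERIV_power[OF DERIV_ident, of m z UNIV] by simp
    moreover have "((\<lambda>z. \<mu> (R z)) has_field_derivative \<mu> (R' z)) (at z)"
      using cfun_has_field_derivative[OF assms R_has_derivative] that by simp
    ultimately have "((\<lambda>z. z ^ m * \<mu> (R z)) has_field_derivative of_nat m * z ^ (m - 1) * \<mu> (R z) + \<mu> (R' z) * z ^ m) (at z within - K)"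
      by (rule has_field_derivative_at_within[OF DERIV_mult])
    then show ?thesis by (simp only: mult.assoc mult.commute[of "z ^ m"])
  qed
  from contour_integral_primitive[OF this _ circle_outside_K]
  have 1: "((\<lambda>z. of_nat m * (z ^ (m - 1) * \<mu> (R z)) + z ^ m * \<mu> (R' z)) has_contour_integral 0) (circlepath 0 \<rho>)"
    by simp
  have "(\<lambda>z. z ^ (m - 1) * \<mu> (R z)) holomorphic_on - K" by (intro holomorphic_intros hol)
  from has_contour_integral_integral[OF circle_integrable[OF this]]
  have 2: "((\<lambda>z. z ^ (m - 1) * \<mu> (R z)) has_contour_integral 2 * of_real pi * \<i> * \<mu> (moment (m - 1))) (circlepath 0 \<rho>)"
    using circle_integral_resolvent[OF assms] by simp
  show ?thesis
    using has_contour_integral_diff[OF 1 has_contour_integral_lmul[OF 2, of "of_nat m"]] by simp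
qed

lemma circle_integral_kernel:
  assumes \<mu>: "cfun \<mu>"
  shows "contour_integral (circlepath 0 \<rho>) (\<lambda>z. z ^ m * \<mu> (kernel z)) = 2 * of_real pi * \<i> * \<mu> (kernel_moment m)"
proof -
  interpret \<mu>: bounded_linear \<mu> using cfun_bounded_linear[OF \<mu>] .
  have "(\<lambda>z. z ^ m * \<mu> (kernel z)) = (\<lambda>z. -2 * (z ^ Suc m * \<mu> (R' z) - z ^ m * \<mu> (Lb (R' z))))"
    by (simp add: kernel_def \<mu>.scaleR \<mu>.diff \<mu>.neg cfun_cs[OF \<mu>] scaleR_conv_of_real algebra_simps)
  then have "contour_integral (circlepath 0 \<rho>) (\<lambda>z. z ^ m * \<mu> (kernel z))
      = -2 * (- of_nat (Suc m) * (2 * of_real pi * \<i> * \<mu> (moment (Suc m - 1)))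
          - (- of_nat m * (2 * of_real pi * \<i> * \<mu> (Lb (moment (m - 1))))))"
    using contour_integral_unique[OF has_contour_integral_lmul[OF has_contour_integral_diff[OF
          circle_integral_resolvent_derivative[OF \<mu>, of "Suc m"] circle_integral_resolvent_derivative[OF cfun_Lb[OF \<mu>], of m]], of "-2"]]
    by (simp only:)
  moreover have "\<mu> (kernel_moment m) = 2 * (of_nat (Suc m) * \<mu> (moment m) - of_nat m * \<mu> (Lb (moment (m - 1))))"
    unfolding kernel_moment_def \<mu>.scaleR \<mu>.diff scaleR_conv_of_real by simp
  ultimately show ?thesis by (simp only: diff_Suc_1) (simp add: algebra_simps)
qed

end

end

section \<open>The power series calculus on an arbitrary cycle\<close>

context quadratic_resolvent
begin

text \<open>The cycle may leave the disc of convergence, so the series cannot be integrated along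
  it. Holomorphy of \<open>h\<close> on \<open>\<Omega>\<close> first moves the integral to a circle
  in the disc, where the partial sums converge uniformly and the moments evaluate them.\<close>

theorem calculus_power_series:
  assumes \<Omega>: "open \<Omega>" and r: "0 < r" and K_r: "K \<subseteq> ball 0 r" and r_\<Omega>: "ball 0 r \<subseteq> \<Omega>"
    and h: "h holomorphic_on \<Omega>" and h_sums: "\<And>z. z \<in> ball 0 r \<Longrightarrow> (\<lambda>m. c m * z ^ m) sums h z"
    and G: "encircles G K \<Omega>"
  shows "\<And>\<gamma>. \<gamma> \<in> G \<Longrightarrow>
      (\<lambda>t. cs (h (\<gamma> t) * (velocity \<gamma> t * - \<i>)) (kernel (\<gamma> t))) integrable_on {0..1}"
    and "(\<lambda>m. cs (c m) (kernel_moment m)) sums ((1 / (2 * pi)) *\<^sub>R (\<Sum>\<gamma>\<in>G. integral {0..1}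
      (\<lambda>t. cs (h (\<gamma> t) * (velocity \<gamma> t * - \<i>)) (kernel (\<gamma> t)))))"
proof -
  have fin: "finite G" and \<gamma>: "\<And>\<gamma>. \<gamma> \<in> G \<Longrightarrow> valid_path \<gamma>"
    and loop: "\<And>\<gamma>. \<gamma> \<in> G \<Longrightarrow> pathfinish \<gamma> = pathstart \<gamma>"
    and sub: "\<And>\<gamma>. \<gamma> \<in> G \<Longrightarrow> path_image \<gamma> \<subseteq> \<Omega> - K"
    and wn1: "\<And>z. z \<in> K \<Longrightarrow> (\<Sum>\<gamma>\<in>G. winding_number \<gamma> z) = 1"
    and wn0: "\<And>z. z \<notin> \<Omega> \<Longrightarrow> (\<Sum>\<gamma>\<in>G. winding_number \<gamma> z) = 0"
    using G unfolding encircles_def by simp_all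
  \<comment> \<open>The factor \<open>- \<i>\<close> stems from the slice differential; it cancels
    the \<open>\<i>\<close> in Cauchy's \<open>2 pi \<i>\<close>.\<close>
  define F where "F g z = cs (- \<i> * g z) (kernel z)" for g z
  define V where "V g \<gamma> = integral {0..1} (\<lambda>t. cs (velocity \<gamma> t) (F g (\<gamma> t)))" for g \<gamma>
  have eqF: "cs (g (\<gamma> t) * (velocity \<gamma> t * - \<i>)) (kernel (\<gamma> t))
      = cs (velocity \<gamma> t) (F g (\<gamma> t))" for g \<gamma> t
    by (simp add: F_def mult_ac flip: cs_mult)
  have S: "open (\<Omega> - K)" using \<Omega> open_compl_K by (simp add: Diff_eq open_Int)
  have holoF: "holo (F g) (\<Omega> - K)" if "g holomorphic_on \<Omega>" for g
    unfolding F_def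
    by (intro holo_cs S holo_subset[OF holo_kernel] holomorphic_intros holomorphic_on_subset[OF that]) auto
  have cfunF: "\<mu> (F g z) = - \<i> * g z * \<mu> (kernel z)" if "cfun \<mu>" for \<mu> g z
    by (simp add: F_def cfun_cs[OF that])
  obtain s where s: "0 \<le> s" "s < r" "K \<subseteq> cball 0 s"
    using compact_subset_smaller_cball[OF compact_K K_r r] by blast
  define \<rho> where "\<rho> = (s + r) / 2"
  have \<rho>: "0 < \<rho>" "\<rho> < r" "K \<subseteq> ball 0 \<rho>" "s < \<rho>" using s by (auto simp: \<rho>_def)
  let ?c = "circlepath 0 \<rho>"
  have c_in: "path_image ?c \<subseteq> \<Omega> - K"
    using \<rho> r_\<Omega> circle_outside_K[OF \<rho>(1,3)] by (auto simp: subset_eq)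
  have V_G: "(\<Sum>\<gamma>\<in>G. V h \<gamma>) = V h ?c"
  proof (rule eqI_cfun)
    fix \<mu> assume \<mu>: "cfun \<mu>"
    have "\<mu> (\<Sum>\<gamma>\<in>G. V h \<gamma>) = (\<Sum>\<gamma>\<in>G. \<mu> (V h \<gamma>))"
      by (rule linear_sum[OF bounded_linear.linear[OF cfun_bounded_linear[OF \<mu>]]])
    also have "\<dots> = (\<Sum>\<gamma>\<in>G. contour_integral \<gamma> (\<lambda>z. \<mu> (F h z)))"
      unfolding V_def by (intro sum.cong cfun_path_integral[OF holoF[OF h] S \<gamma> sub \<mu>]) auto
    also have "\<dots> = contour_integral ?c (\<lambda>z. \<mu> (F h z))"
    proof (rule Cauchy_theorem_cycle_eq_circle[OF fin S cfun_holo[OF \<mu> holoF[OF h]] \<gamma> loop sub c_in])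
      fix z assume z: "z \<notin> \<Omega> - K"
      show "(\<Sum>\<gamma>\<in>G. winding_number \<gamma> z) = winding_number ?c z"
      proof (cases "z \<in> K")
        case True
        then have "norm (z - 0) < \<rho>" using \<rho>(3) by auto
        then show ?thesis using wn1[OF True] by (simp only: winding_number_circlepath)
      next
        case False
        then have z': "z \<notin> \<Omega>" using z by blast
        have "winding_number ?c z = 0"
        proof (rule winding_number_zero_outside[of _ "cball 0 \<rho>"])
          show "z \<notin> cball 0 \<rho>" using z' subsetD[OF r_\<Omega>, of z] \<rho> by auto
        qed (use \<rho> in \<open>auto simp: valid_path_imp_path\<close>)
        then show ?thesis using wn0[OF z'] by simp
      qed
    qed
    also have "\<dots> = \<mu> (V h ?c)"
      unfolding V_def by (rule cfun_path_integral[OF holoF[OF h] S _ c_in \<mu>, symmetric]) simp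
    finally show "\<mu> (\<Sum>\<gamma>\<in>G. V h \<gamma>) = \<mu> (V h ?c)" .
  qed
  define p where "p n z = (\<Sum>m<n. c m * z ^ m)" for n z
  have p_hol: "p n holomorphic_on \<Omega>" for n unfolding p_def by (intro holomorphic_intros)
  have V_p: "V (p n) ?c = (\<Sum>m<n. cs (c m) ((2 * pi) *\<^sub>R kernel_moment m))" for n
  proof (rule eqI_cfun)
    fix \<mu> assume \<mu>: "cfun \<mu>"
    interpret \<mu>: bounded_linear \<mu> using cfun_bounded_linear[OF \<mu>] .
    have "((\<lambda>z. \<Sum>m<n. (- \<i> * c m) * (z ^ m * \<mu> (kernel z))) has_contour_integral
        (\<Sum>m<n. (- \<i> * c m) * (2 * of_real pi * \<i> * \<mu> (kernel_moment m)))) ?c"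
    proof (intro has_contour_integral_sum has_contour_integral_lmul)
      fix m
      have "(\<lambda>z. z ^ m * \<mu> (kernel z)) holomorphic_on - K"
        by (intro holomorphic_intros cfun_holo[OF \<mu> holo_kernel])
      from has_contour_integral_integral[OF circle_integrable[OF \<rho>(1,3) this]]
      show "((\<lambda>z. z ^ m * \<mu> (kernel z)) has_contour_integral 2 * of_real pi * \<i> * \<mu> (kernel_moment m)) ?c"
        using circle_integral_kernel[OF \<rho>(1,3) \<mu>] by simp
    qed simp
    moreover have "(\<lambda>z. \<mu> (F (p n) z)) = (\<lambda>z. \<Sum>m<n. (- \<i> * c m) * (z ^ m * \<mu> (kernel z)))"
      by (simp add: cfunF[OF \<mu>] p_def sum_distrib_left sum_distrib_right mult_ac)
    ultimately have "contour_integral ?c (\<lambda>z. \<mu> (F (p n) z)) = (\<Sum>m<n. (- \<i> * c m) * (2 * of_real pi * \<i> * \<mu> (kernel_moment m)))"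
      by (simp add: contour_integral_unique)
    also have "\<dots> = \<mu> (\<Sum>m<n. cs (c m) ((2 * pi) *\<^sub>R kernel_moment m))"
      by (simp add: \<mu>.sum cfun_cs[OF \<mu>] \<mu>.scaleR scaleR_conv_of_real algebra_simps)
    finally show "\<mu> (V (p n) ?c) = \<mu> (\<Sum>m<n. cs (c m) ((2 * pi) *\<^sub>R kernel_moment m))"
      unfolding V_def using cfun_path_integral[OF holoF[OF p_hol] S _ c_in \<mu>] by simp
  qed
  obtain k where k: "0 < k" "\<And>z x. norm (cs z x) \<le> norm z * norm x * k" using cs.pos_bounded by blast
  have "compact (kernel ` path_image ?c)"
    by (intro compact_continuous_image continuous_on_subset[OF holo_continuous[OF holo_kernel]]
        compact_path_image valid_path_imp_path circle_outside_K \<rho>) simp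
  from compact_imp_bounded[OF this]
  obtain M where M0: "0 < M" and M1: "\<forall>x\<in>kernel ` path_image ?c. norm x \<le> M"
    unfolding bounded_pos by (elim exE conjE)
  then have M: "0 < M" "norm (kernel z) \<le> M" if "z \<in> path_image ?c" for z
    using that by (simp_all only: ball_simps)
  have V_lim: "(\<lambda>n. V (p n) ?c) \<longlonglongrightarrow> V h ?c"
  proof (rule tendstoI)
    fix e :: real assume e: "0 < e"
    \<comment> \<open>Speed of the circle times the bound of the kernel, with one factor
      \<open>k\<close> for each of the two applications of \<open>cs\<close>.\<close>
    define C where "C = 2 * pi * \<rho> * M * k * k"
    have C: "0 < C" using \<rho> M0 k by (simp add: C_def)
    have *: "summable (\<lambda>m. c m * of_real \<rho>' ^ m)" if "0 \<le> \<rho>'" "\<rho>' < r" for \<rho>'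
      using h_sums[of "of_real \<rho>'"] that sums_summable by force
    \<comment> \<open>Convergence at a radius between \<open>\<rho>\<close> and \<open>r\<close>
      gives absolute convergence at \<open>\<rho>\<close>, the majorant on the whole circle.\<close>
    have "summable (\<lambda>m. c m * of_real ((\<rho> + r) / 2) ^ m)" by (rule *) (use \<rho>(1,2) in auto)
    moreover have "norm (of_real \<rho> :: complex) < norm (of_real ((\<rho> + r) / 2) :: complex)"
      unfolding norm_of_real using \<rho>(1,2) by simp
    ultimately have "summable (\<lambda>m. norm (c m * of_real \<rho> ^ m))" by (rule powser_insidea)
    then have "uniform_limit (sphere 0 \<rho>) (\<lambda>n z. \<Sum>m<n. c m * z ^ m) (\<lambda>z. \<Sum>m. c m * z ^ m) sequentially"
      by (intro Weierstrass_m_test) (use \<rho> in \<open>auto simp: norm_mult norm_power\<close>)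
    moreover have "0 < e / (2 * C)" using e C by simp
    ultimately have "eventually (\<lambda>n. \<forall>z\<in>sphere 0 \<rho>. dist (\<Sum>m<n. c m * z ^ m) (\<Sum>m. c m * z ^ m) < e / (2 * C)) sequentially"
      unfolding uniform_limit_iff by blast
    then show "eventually (\<lambda>n. dist (V (p n) ?c) (V h ?c) < e) sequentially"
    proof eventually_elim
      case (elim n)
      have close: "norm (p n z - h z) \<le> e / (2 * C)" if "z \<in> path_image ?c" for z
      proof -
        have z: "z \<in> sphere 0 \<rho>" using that \<rho> by simp
        then have "(\<Sum>m. c m * z ^ m) = h z" using h_sums[of z] \<rho> sums_unique by force
        then show ?thesis using elim[rule_format, OF z] by (simp add: p_def dist_norm less_imp_le)
      qed
      have int: "(\<lambda>t. cs (velocity ?c t) (F g (?c t))) integrable_on {0..1}"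
        if "g holomorphic_on \<Omega>" for g
        using holo_path_integrable[OF holoF[OF that] S _ c_in] by simp
      have "V (p n) ?c - V h ?c = integral {0..1} (\<lambda>t. cs (velocity ?c t) (F (p n) (?c t))
          - cs (velocity ?c t) (F h (?c t)))"
        unfolding V_def by (rule integral_diff[symmetric, OF int[OF p_hol] int[OF h]])
      also have "norm \<dots> \<le> integral {0..1} (\<lambda>t::real. e / 2)"
      proof (rule integral_norm_bound_integral)
        show "(\<lambda>t. cs (velocity ?c t) (F (p n) (?c t))
          - cs (velocity ?c t) (F h (?c t))) integrable_on {0..1}"
          by (rule integrable_diff[OF int[OF p_hol] int[OF h]])
        fix t :: real assume t: "t \<in> {0..1}"
        let ?v = "velocity ?c t" and ?z = "?c t"
        have z: "?z \<in> path_image ?c" using t by (auto simp: path_image_def)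
        have v: "norm ?v = 2 * pi * \<rho>" using t \<rho>(1) by (simp add: vector_derivative_circlepath01 norm_mult)
        have "cs ?v (F (p n) ?z) - cs ?v (F h ?z) = cs ?v (cs (- \<i> * (p n ?z - h ?z)) (kernel ?z))"
          by (simp add: F_def algebra_simps flip: cs.diff_right cs.diff_left)
        also have "norm \<dots> \<le> norm ?v * norm (cs (- \<i> * (p n ?z - h ?z)) (kernel ?z)) * k" by (rule k)
        also have "\<dots> \<le> norm ?v * (norm (- \<i> * (p n ?z - h ?z)) * norm (kernel ?z) * k) * k"
          by (intro mult_right_mono mult_left_mono k(2) less_imp_le[OF k(1)] norm_ge_zero)
        also have "\<dots> \<le> norm ?v * (e / (2 * C) * M * k) * k"
          using k M0 M(2)[OF z] close[OF z] e C
          by (intro mult_right_mono mult_left_mono mult_mono) (auto simp: norm_mult)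
        also have "\<dots> = C * (e / (2 * C))" unfolding v C_def by simp
        also have "\<dots> = e / 2" using C by simp
        finally show "norm (cs ?v (F (p n) ?z) - cs ?v (F h ?z)) \<le> e / 2" .
      qed auto
      finally show ?case using e by (simp add: dist_norm)
    qed
  qed
  show "(\<lambda>t. cs (h (\<gamma> t) * (velocity \<gamma> t * - \<i>)) (kernel (\<gamma> t))) integrable_on {0..1}"
    if "\<gamma> \<in> G" for \<gamma>
    unfolding eqF using holo_path_integrable[OF holoF[OF h] S \<gamma>[OF that] sub[OF that]] .
  have "(\<lambda>n. (1 / (2 * pi)) *\<^sub>R V (p n) ?c) \<longlonglongrightarrow> (1 / (2 * pi)) *\<^sub>R V h ?c"
    by (intro tendsto_intros V_lim)
  then show "(\<lambda>m. cs (c m) (kernel_moment m)) sums ((1 / (2 * pi)) *\<^sub>R (\<Sum>\<gamma>\<in>G. integral {0..1}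
      (\<lambda>t. cs (h (\<gamma> t) * (velocity \<gamma> t * - \<i>)) (kernel (\<gamma> t)))))"
    unfolding eqF V_def[symmetric] V_G V_p sums_def
    by (simp add: scaleR_sum_right cs.scaleR_right)
qed

end

section \<open>Invertible operators\<close>

interpretation blinfun_compose: bounded_bilinear "(o\<^sub>L)"
  by (rule bounded_bilinear_blinfun_compose)

lemma blinfun_compose_assoc: "(A o\<^sub>L B) o\<^sub>L C = A o\<^sub>L (B o\<^sub>L C)"
  by (rule blinfun_eqI) simp

lemma blinfun_compose_id [simp]: "A o\<^sub>L id_blinfun = A" "id_blinfun o\<^sub>L A = A"
  by (rule blinfun_eqI, simp)+

lemmas blinfun_ops = plus_blinfun.rep_eq minus_blinfun.rep_eq uminus_blinfun.rep_eq scaleR_blinfun.rep_eq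
  blinfun.add_right blinfun.diff_right blinfun.minus_right blinfun.scaleR_right

lemma norm_op_pow: "norm (op_pow P n) \<le> norm P ^ n"
proof (induction n)
  case 0 show ?case by (simp add: norm_blinfun_id_le)
next
  case (Suc n)
  have "norm (P o\<^sub>L op_pow P n) \<le> norm P * norm (op_pow P n)" by (rule norm_blinfun_compose)
  also have "\<dots> \<le> norm P * norm P ^ n" by (intro mult_left_mono Suc) auto
  finally show ?case by simp
qed

lemma op_pow_commute:
  assumes "A o\<^sub>L P = P o\<^sub>L A"
  shows "A o\<^sub>L op_pow P n = op_pow P n o\<^sub>L A"
proof (induction n)
  case (Suc n)
  have "A o\<^sub>L op_pow P (Suc n) = (A o\<^sub>L P) o\<^sub>L op_pow P n" by (simp add: blinfun_compose_assoc)
  also have "\<dots> = P o\<^sub>L (A o\<^sub>L op_pow P n)" by (simp add: assms blinfun_compose_assoc)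
  finally show ?case by (simp add: Suc blinfun_compose_assoc)
qed (auto intro: blinfun_eqI)

lemma Neumann_series:
  fixes P :: "'a::banach hop"
  assumes "norm P < 1"
  shows "\<exists>S. (id_blinfun - P) o\<^sub>L S = id_blinfun \<and> S o\<^sub>L (id_blinfun - P) = id_blinfun"
proof -
  define S where "S = (\<Sum>n. op_pow P n)"
  have sm: "summable (op_pow P)"
    by (rule summable_comparison_test'[of "\<lambda>n. norm P ^ n" 0]) (use assms norm_op_pow in auto)
  have "P o\<^sub>L S = (\<Sum>n. P o\<^sub>L op_pow P n)"
    unfolding S_def by (rule bounded_linear.suminf[OF blinfun_compose.bounded_linear_right sm])
  also have "\<dots> = S - id_blinfun" using suminf_split_head[OF sm] by (simp add: S_def)
  finally have 1: "P o\<^sub>L S = S - id_blinfun" .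
  have "S o\<^sub>L P = (\<Sum>n. op_pow P n o\<^sub>L P)"
    unfolding S_def by (rule bounded_linear.suminf[OF blinfun_compose.bounded_linear_left sm])
  also have "\<dots> = S - id_blinfun"
    using suminf_split_head[OF sm] by (simp add: S_def flip: op_pow_commute)
  finally have 2: "S o\<^sub>L P = S - id_blinfun" .
  show ?thesis
    using 1 2 by (intro exI[of _ S])
      (simp add: blinfun_compose.diff_left blinfun_compose.diff_right)
qed

text \<open>\<open>X\<close> factors as \<open>A\<close> times the identity minus
  \<open>B (A - X)\<close>, and the second factor is inverted by the Neumann series.\<close>

lemma invertible_near:
  fixes A :: "'a::banach hop"
  assumes AB: "A o\<^sub>L B = id_blinfun" "B o\<^sub>L A = id_blinfun" and X: "norm (X - A) * norm B < 1"
  shows "\<exists>Y. X o\<^sub>L Y = id_blinfun \<and> Y o\<^sub>L X = id_blinfun"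
proof -
  define P where "P = B o\<^sub>L (A - X)"
  have "norm P \<le> norm B * norm (A - X)" unfolding P_def by (rule norm_blinfun_compose)
  then have "norm P < 1" using X by (simp add: norm_minus_commute mult.commute)
  then obtain S where S: "(id_blinfun - P) o\<^sub>L S = id_blinfun" "S o\<^sub>L (id_blinfun - P) = id_blinfun"
    using Neumann_series by blast
  have P: "A (B x) = x" "B (A x) = x" for x using AB by (metis blinfun_apply_blinfun_compose id_blinfun.rep_eq id_apply)+
  have X_eq: "X = A o\<^sub>L (id_blinfun - P)"
    by (rule blinfun_eqI) (simp add: P_def P blinfun.diff_left blinfun.diff_right)
  have "X o\<^sub>L (S o\<^sub>L B) = A o\<^sub>L ((id_blinfun - P) o\<^sub>L S) o\<^sub>L B"
    unfolding X_eq by (simp add: blinfun_compose_assoc)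
  moreover have "(S o\<^sub>L B) o\<^sub>L X = S o\<^sub>L ((B o\<^sub>L A) o\<^sub>L (id_blinfun - P))"
    unfolding X_eq by (simp add: blinfun_compose_assoc)
  ultimately show ?thesis using S AB by (intro exI[of _ "S o\<^sub>L B"]) simp
qed

lemma inverse_commute:
  assumes R: "Q o\<^sub>L R = id_blinfun" "R o\<^sub>L Q = id_blinfun" and C: "C o\<^sub>L Q = Q o\<^sub>L C"
  shows "C o\<^sub>L R = R o\<^sub>L C"
proof (rule blinfun_eqI)
  fix x
  have 1: "Q (R y) = y" "R (Q y) = y" for y using R by (metis blinfun_apply_blinfun_compose id_blinfun.rep_eq id_apply)+
  have 2: "C (Q y) = Q (C y)" for y using C by (metis blinfun_apply_blinfun_compose)
  show "blinfun_apply (C o\<^sub>L R) x = blinfun_apply (R o\<^sub>L C) x"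
    using 1(2)[of "C (R x)"] 2[of "R x"] 1(1)[of x] by simp
qed

text \<open>The product splits into \<open>B (g w) (f z)\<close> and
  \<open>B (g z - g w) (f z)\<close>. As \<open>f w = 0\<close>, the latter is of smaller order than
  \<open>z - w\<close>, so continuity of \<open>g\<close> takes the place of
  differentiability.\<close>

lemma has_derivative_bilinear_vanishing:
  assumes B: "bounded_bilinear B" and g: "isCont g w" and f: "(f has_derivative f') (at w)" and f0: "f w = 0"
  shows "((\<lambda>z. B (g z) (f z)) has_derivative (\<lambda>h. B (g w) (f' h))) (at w)"
proof -
  interpret bounded_bilinear B by fact
  have 1: "((\<lambda>z. B (g w) (f z)) has_derivative (\<lambda>h. B (g w) (f' h))) (at w)"
    by (rule bounded_linear.has_derivative[OF bounded_linear_right f])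
  have "((\<lambda>z. B (g z - g w) (f z)) has_derivative (\<lambda>h. 0)) (at w)"
    unfolding has_derivative_iff_norm
  proof (intro conjI bounded_linear_zero)
    obtain k where k: "0 < k" "\<And>x y. norm (B x y) \<le> norm x * norm y * k" using pos_bounded by blast
    interpret f': bounded_linear f' using f has_derivative_bounded_linear by blast
    obtain M where M: "0 < M" "\<And>h. norm (f' h) \<le> norm h * M" using f'.pos_bounded by blast
    let ?q = "\<lambda>z. norm (f z - f w - f' (z - w)) / norm (z - w)"
    have q: "(?q \<longlongrightarrow> 0) (at w)" using f unfolding has_derivative_iff_norm by simp
    have gl: "((\<lambda>z. norm (g z - g w)) \<longlongrightarrow> 0) (at w)"
      using g by (simp add: isCont_def tendsto_norm_zero_iff LIM_zero_iff)
    have "((\<lambda>z. norm (g z - g w) * (?q z + M) * k) \<longlongrightarrow> 0 * (0 + M) * k) (at w)"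
      by (intro tendsto_intros q gl)
    then have lim: "((\<lambda>z. norm (g z - g w) * (?q z + M) * k) \<longlongrightarrow> 0) (at w)" by simp
    show "((\<lambda>z. norm (B (g z - g w) (f z) - B (g w - g w) (f w) - 0) / norm (z - w)) \<longlongrightarrow> 0) (at w)"
    proof (rule Lim_null_comparison[OF _ lim])
      have "norm (f z) / norm (z - w) \<le> ?q z + M" if "z \<noteq> w" for z
      proof -
        have "norm (f z) \<le> norm (f z - f w - f' (z - w)) + norm (f' (z - w))"
          using norm_triangle_sub[of "f z" "f' (z - w)"] f0 by simp
        also have "\<dots> \<le> norm (f z - f w - f' (z - w)) + norm (z - w) * M" using M(2) by simp
        finally have "norm (f z) / norm (z - w) \<le> (norm (f z - f w - f' (z - w)) + norm (z - w) * M) / norm (z - w)"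
          by (rule divide_right_mono) simp
        then show ?thesis using that by (simp add: add_divide_distrib)
      qed
      then have "norm (B (g z - g w) (f z)) / norm (z - w) \<le> norm (g z - g w) * (?q z + M) * k" if "z \<noteq> w" for z
      proof -
        have "norm (B (g z - g w) (f z)) / norm (z - w) \<le> (norm (g z - g w) * norm (f z) * k) / norm (z - w)"
          by (intro divide_right_mono k) auto
        also have "\<dots> = norm (g z - g w) * (norm (f z) / norm (z - w)) * k" by simp
        also have "\<dots> \<le> norm (g z - g w) * (?q z + M) * k"
          using k \<open>\<And>z. z \<noteq> w \<Longrightarrow> norm (f z) / norm (z - w) \<le> ?q z + M\<close>[OF that]
          by (intro mult_right_mono mult_left_mono) auto
        finally show ?thesis .
      qed
      then show "eventually (\<lambda>z. norm (norm (B (g z - g w) (f z) - B (g w - g w) (f w) - 0) / norm (z - w))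
          \<le> norm (g z - g w) * (?q z + M) * k) (at w)"
        by (auto simp: eventually_at_filter zero_left f0 zero_right)
    qed
  qed
  from has_derivative_add[OF this 1] show ?thesis by (simp add: diff_left)
qed

text \<open>The resolvent identity writes \<open>R z - R w\<close> as \<open>R z\<close> times a
  factor vanishing at \<open>w\<close>. It yields first a local bound, then continuity of
  \<open>R\<close>, and with the preceding product rule the derivative.\<close>

lemma has_derivative_operator_inverse:
  fixes Q R :: "complex \<Rightarrow> 'a::banach hop"
  assumes S: "open S" "w \<in> S" and R: "\<And>z. z \<in> S \<Longrightarrow> Q z o\<^sub>L R z = id_blinfun" "\<And>z. z \<in> S \<Longrightarrow> R z o\<^sub>L Q z = id_blinfun"
    and Q: "(Q has_derivative Q') (at w)"
  shows "(R has_derivative (\<lambda>h. - (R w o\<^sub>L Q' h o\<^sub>L R w))) (at w)"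
proof -
  have diff: "R z - R w = - (R z o\<^sub>L ((Q z - Q w) o\<^sub>L R w))" if z: "z \<in> S" for z
  proof (rule blinfun_eqI)
    fix x
    have "Q w (R w x) = x" "R z (Q z (R w x)) = R w x"
      using R(1)[OF S(2)] R(2)[OF z] by (metis blinfun_apply_blinfun_compose id_blinfun.rep_eq id_apply)+
    then show "blinfun_apply (R z - R w) x = blinfun_apply (- (R z o\<^sub>L ((Q z - Q w) o\<^sub>L R w))) x"
      by (simp add: blinfun.diff_left blinfun.diff_right blinfun.minus_left)
  qed
  have norm_diff: "norm (R z - R w) \<le> norm (R z) * (norm (Q z - Q w) * norm (R w))" if "z \<in> S" for z
    unfolding diff[OF that] norm_minus_cancel
    by (meson norm_blinfun_compose mult_left_mono norm_ge_zero order_trans)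
  have evS: "eventually (\<lambda>z. z \<in> S) (at w)" using S eventually_at_topological by blast
  have contQ: "((\<lambda>z. norm (Q z - Q w)) \<longlongrightarrow> 0) (at w)"
    using has_derivative_continuous[OF Q] by (simp add: isCont_def tendsto_norm_zero_iff LIM_zero_iff)
  have lim0: "((\<lambda>z. norm (Q z - Q w) * norm (R w)) \<longlongrightarrow> 0) (at w)"
    using tendsto_mult_right[OF contQ, of "norm (R w)"] by simp
  \<comment> \<open>Below \<open>1 / 2\<close>, the difference \<open>R z - R w\<close> is at most
    half of \<open>R z\<close> in norm, whence
    \<open>norm (R z) \<le> 2 * norm (R w)\<close>.\<close>
  then have "eventually (\<lambda>z. norm (Q z - Q w) * norm (R w) < 1 / 2) (at w)"
    by (rule order_tendstoD(2)) simp
  with evS have "eventually (\<lambda>z. norm (R z - R w) \<le> (2 * norm (R w)) * (norm (Q z - Q w) * norm (R w))) (at w)"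
  proof eventually_elim
    case (elim z)
    have "norm (R z) * (norm (Q z - Q w) * norm (R w)) \<le> norm (R z) * (1 / 2)"
      using elim(2) by (intro mult_left_mono) auto
    then have "norm (R z) \<le> 2 * norm (R w)"
      using norm_diff[OF elim(1)] norm_triangle_sub[of "R z" "R w"] by simp
    then show ?case using norm_diff[OF elim(1)] by (meson mult_right_mono norm_ge_zero mult_nonneg_nonneg order_trans)
  qed
  moreover have "((\<lambda>z. (2 * norm (R w)) * (norm (Q z - Q w) * norm (R w))) \<longlongrightarrow> 0) (at w)"
    using tendsto_mult_left[OF lim0, of "2 * norm (R w)"] by simp
  ultimately have "((\<lambda>z. R z - R w) \<longlongrightarrow> 0) (at w)" by (rule Lim_null_comparison)
  then have contR: "isCont R w" by (simp add: isCont_def LIM_zero_iff)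
  have "((\<lambda>z. (Q z - Q w) o\<^sub>L R w) has_derivative (\<lambda>h. Q' h o\<^sub>L R w)) (at w)"
    using bounded_linear.has_derivative[OF blinfun_compose.bounded_linear_left
        has_derivative_diff[OF Q has_derivative_const]] by simp
  from has_derivative_bilinear_vanishing[OF bounded_bilinear_blinfun_compose contR this]
  have "((\<lambda>z. R z o\<^sub>L ((Q z - Q w) o\<^sub>L R w)) has_derivative (\<lambda>h. R w o\<^sub>L (Q' h o\<^sub>L R w))) (at w)"
    by (simp add: blinfun_eqI)
  from has_derivative_diff[OF has_derivative_const[of "R w"] this]
  have "((\<lambda>z. R w - (R z o\<^sub>L ((Q z - Q w) o\<^sub>L R w))) has_derivative (\<lambda>h. - (R w o\<^sub>L (Q' h o\<^sub>L R w)))) (at w)"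
    by simp
  moreover have "R w - (R z o\<^sub>L ((Q z - Q w) o\<^sub>L R w)) = R z" if "z \<in> S" for z
    using diff[OF that] by (simp add: algebra_simps)
  ultimately show ?thesis
    using has_derivative_transform_within_open[of _ _ w UNIV S R] S by (simp add: blinfun_compose_assoc)
qed

section \<open>Paravector operators\<close>

lemma lmult_mult: "lmult (a * b) x = lmult a (lmult b x)"
  by (cases x) (simp add: lmult.rep_eq times_quat_def algebra_simps)

lemma lmult_add: "lmult (a + b) = lmult a + lmult b"
  by (rule blinfun_eqI) (auto simp: lmult.rep_eq plus_quat_def plus_blinfun.rep_eq algebra_simps)

lemma lmult_scaleR: "lmult (r *\<^sub>R a) = r *\<^sub>R lmult a"
  by (rule blinfun_eqI) (auto simp: lmult.rep_eq scaleR_quat_def scaleR_blinfun.rep_eq algebra_simps)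

lemma linear_lmult: "linear lmult"
  by (rule linearI) (simp_all add: lmult_add lmult_scaleR)

lemma bounded_linear_lmult: "bounded_linear lmult"
  using linear_lmult linear_conv_bounded_linear by blast

lemmas lmult_minus = linear_neg[OF linear_lmult]

lemma lmult_one [simp]: "lmult 1 = id_blinfun"
  by (rule blinfun_eqI) (auto simp: lmult.rep_eq one_quat_def)

lemma lmult_of_real: "lmult (of_real r) = r *\<^sub>R id_blinfun"
  by (simp add: of_real_def lmult_scaleR)

lemma lmult_compose: "lmult (a * b) = lmult a o\<^sub>L lmult b"
  by (rule blinfun_eqI) (simp add: lmult_mult)

lemma extend_op_lmult: "extend_op A (lmult a x) = lmult a (extend_op A x)"
  by (cases x) (simp add: lmult.rep_eq extend_op.rep_eq blinfun_ops)

lemma extend_op_compose: "extend_op (A o\<^sub>L B) x = extend_op A (extend_op B x)"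
  by (cases x) (simp add: extend_op.rep_eq)

lemma extend_op_add: "extend_op (A + B) x = extend_op A x + extend_op B x"
  by (cases x) (simp add: extend_op.rep_eq plus_blinfun.rep_eq)

lemma extend_op_minus: "extend_op (- A) x = - extend_op A x"
  by (cases x) (simp add: extend_op.rep_eq uminus_blinfun.rep_eq)

lemma extend_op_zero [simp]: "extend_op 0 x = 0"
  by (cases x) (simp add: extend_op.rep_eq zero_prod_def)

lemma BX_lmult: "lmult a \<in> BX"
  unfolding BX_def by (auto simp: lmult.rep_eq hmod_rmult_def algebra_simps)

lemma BX_extend_op: "extend_op A \<in> BX"
  unfolding BX_def
  by (auto simp: extend_op.rep_eq hmod_rmult_def blinfun_ops)

lemma BX_iff: "A \<in> BX \<longleftrightarrow> (\<forall>x a. A (hmod_rmult x a) = hmod_rmult (A x) a)"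
  unfolding BX_def by blast

lemma BX_compose: "A \<in> BX \<Longrightarrow> B \<in> BX \<Longrightarrow> A o\<^sub>L B \<in> BX"
  by (simp add: BX_iff del: split_paired_All)

lemma hmod_rmult_linear:
  "hmod_rmult (x + y) a = hmod_rmult x a + hmod_rmult y a"
  "hmod_rmult (r *\<^sub>R x) a = r *\<^sub>R hmod_rmult x a"
  by (cases x; cases y; simp add: hmod_rmult_def algebra_simps)+

lemma BX_add: "A \<in> BX \<Longrightarrow> B \<in> BX \<Longrightarrow> A + B \<in> BX"
  unfolding BX_def by (simp add: plus_blinfun.rep_eq hmod_rmult_linear)

lemma BX_scaleR: "A \<in> BX \<Longrightarrow> r *\<^sub>R A \<in> BX"
  unfolding BX_def by (simp add: scaleR_blinfun.rep_eq hmod_rmult_linear)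

lemma BX_id: "id_blinfun \<in> BX"
  unfolding BX_def by simp

lemma BX_diff: "A \<in> BX \<Longrightarrow> B \<in> BX \<Longrightarrow> A - B \<in> BX"
  using BX_add[of A "-1 *\<^sub>R B"] BX_scaleR[of B "-1"] by simp

lemma BX_op_of_components: "op_of_components A0 A1 A2 A3 \<in> BX"
  unfolding op_of_components_def by (intro BX_add BX_compose BX_extend_op BX_lmult)

lemma blinfun_inverse_apply:
  assumes "A o\<^sub>L R = id_blinfun"
  shows "A (R x) = x"
  using assms by (metis blinfun_apply_blinfun_compose blinfun_apply_id_blinfun)

text \<open>Right linearity passes to a two-sided inverse, so it has to be verified for
  \<open>A\<close> alone.\<close>

lemma is_inverse_in_BXI:
  assumes A: "A \<in> BX" and R: "A o\<^sub>L R = id_blinfun" "R o\<^sub>L A = id_blinfun"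
  shows "is_inverse_in_BX A R"
proof -
  have "R (hmod_rmult x a) = hmod_rmult (R x) a" for x a
  proof -
    have "hmod_rmult (A (R x)) a = A (hmod_rmult (R x) a)" using A by (simp add: BX_iff del: split_paired_All)
    then have "R (hmod_rmult x a) = R (A (hmod_rmult (R x) a))"
      by (simp add: blinfun_inverse_apply[OF R(1)])
    then show ?thesis by (simp add: blinfun_inverse_apply[OF R(2)])
  qed
  then show ?thesis using R by (simp add: is_inverse_in_BX_def BX_iff del: split_paired_All)
qed

lemma op_inverse_works:
  assumes "is_inverse_in_BX A R"
  shows "A o\<^sub>L op_inverse A = id_blinfun" "op_inverse A o\<^sub>L A = id_blinfun"
proof -
  have "R' = R" if "is_inverse_in_BX A R'" for R'
  proof -
    have "R' = R' o\<^sub>L (A o\<^sub>L R)" using assms by (simp add: is_inverse_in_BX_def)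
    also have "\<dots> = (R' o\<^sub>L A) o\<^sub>L R" by (simp add: blinfun_compose_assoc)
    finally show ?thesis using that by (simp add: is_inverse_in_BX_def)
  qed
  then have "op_inverse A = R" unfolding op_inverse_def using assms by (intro the_equality)
  then show "A o\<^sub>L op_inverse A = id_blinfun" "op_inverse A o\<^sub>L A = id_blinfun"
    using assms by (simp_all add: is_inverse_in_BX_def)
qed

text \<open>The quadratic pencil depends continuously on \<open>s\<close> and invertibility survives
  small perturbations. Together with boundedness this makes the S-spectrum compact.\<close>

lemma open_S_resolvent_set:
  fixes T :: "'a::banach hop"
  assumes T: "T \<in> BX"
  shows "open (S_resolvent_set T)"
proof (rule openI)
  define Q where "Q s = (T o\<^sub>L T) - (2 * qc0 s) *\<^sub>R T + (norm s)\<^sup>2 *\<^sub>R id_blinfun" for s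
  have QBX: "Q s \<in> BX" for s
    unfolding Q_def using T by (intro BX_add BX_diff BX_scaleR BX_compose BX_id)
  fix s assume "s \<in> S_resolvent_set T"
  then obtain R where R: "Q s o\<^sub>L R = id_blinfun" "R o\<^sub>L Q s = id_blinfun"
    unfolding S_resolvent_set_def Q_def is_inverse_in_BX_def by blast
  have "qc0 = (\<lambda>s. inner s 1)" by (simp add: fun_eq_iff inner_quat_def one_quat_def)
  moreover have "continuous_on UNIV (\<lambda>s::quat. inner s 1)" by (intro continuous_intros)
  ultimately have "continuous_on UNIV qc0" by (simp only:)
  then have "continuous_on UNIV Q" unfolding Q_def by (intro continuous_intros) auto
  then have "isCont Q s" by (simp add: continuous_on_eq_continuous_at)
  then have "isCont (\<lambda>x. norm (Q x - Q s) * norm R) s" by (intro continuous_intros)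
  from this[unfolded continuous_at_eps_delta, rule_format, of 1]
  obtain d where "0 < d" "\<forall>x. dist x s < d \<longrightarrow> dist (norm (Q x - Q s) * norm R) (norm (Q s - Q s) * norm R) < 1"
    by auto
  then have d: "0 < d" "\<And>x. dist x s < d \<Longrightarrow> norm (Q x - Q s) * norm R < 1"
    by (simp_all add: dist_real_def)
  have "x \<in> S_resolvent_set T" if xd: "x \<in> ball s d" for x
  proof -
    have "dist x s < d" using xd by (simp add: dist_commute)
    obtain Y where "Q x o\<^sub>L Y = id_blinfun" "Y o\<^sub>L Q x = id_blinfun"
      using invertible_near[OF R d(2)[OF \<open>dist x s < d\<close>]] by blast
    then have "is_inverse_in_BX (Q x) Y" using is_inverse_in_BXI[OF QBX] by blast
    then show ?thesis unfolding S_resolvent_set_def Q_def by blast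
  qed
  then show "\<exists>e>0. ball s e \<subseteq> S_resolvent_set T" using d(1) by blast
qed

definition qconj :: "quat \<Rightarrow> quat" where
  "qconj q = Quat (qc0 q) (- qc1 q) (- qc2 q) (- qc3 q)"

text \<open>These symmetric combinations are the coefficients in the product of \<open>Q_c\<close>
  at \<open>s\<close> and at \<open>qconj s\<close>. They are real because \<open>s\<close> and
  \<open>qconj s\<close> commute and have real sum and product.\<close>

lemma qconj_identities:
  "s\<^sup>2 * (qconj s)\<^sup>2 = of_real ((inner s s)\<^sup>2)" "s\<^sup>2 * qconj s + s * (qconj s)\<^sup>2 = of_real (2 * qc0 s * inner s s)"
  "s\<^sup>2 + (qconj s)\<^sup>2 = of_real (4 * (qc0 s)\<^sup>2 - 2 * inner s s)" "s * qconj s = of_real (inner s s)"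
  "s + qconj s = of_real (2 * qc0 s)"
proof -
  have 1: "s * qconj s = of_real (inner s s)" and 2: "s + qconj s = of_real (2 * qc0 s)"
    by (simp_all add: qconj_def quat_eq_iff quat_arith_defs inner_quat_def of_real_def)
  have 3: "qconj s * s = of_real (inner s s)"
    by (simp add: qconj_def quat_eq_iff quat_arith_defs inner_quat_def of_real_def)
  have comm: "s * of_real r = of_real r * s" for r by (simp add: of_real_def)
  have "s\<^sup>2 * (qconj s)\<^sup>2 = s * (s * qconj s) * qconj s" by (simp add: power2_eq_square mult.assoc)
  also have "\<dots> = s * of_real (inner s s) * qconj s" by (simp only: 1)
  also have "\<dots> = of_real (inner s s) * (s * qconj s)" by (simp only: comm mult.assoc)
  also have "\<dots> = of_real ((inner s s)\<^sup>2)" by (simp only: 1 of_real_mult power2_eq_square)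
  finally show "s\<^sup>2 * (qconj s)\<^sup>2 = of_real ((inner s s)\<^sup>2)" .
  have "s\<^sup>2 * qconj s + s * (qconj s)\<^sup>2 = s * (s * qconj s) + (s * qconj s) * qconj s" by (simp add: power2_eq_square mult.assoc)
  also have "\<dots> = of_real (inner s s) * (s + qconj s)" by (simp only: 1 comm distrib_left)
  also have "\<dots> = of_real (2 * qc0 s * inner s s)" by (simp only: 2 mult.commute of_real_mult[symmetric])
  finally show "s\<^sup>2 * qconj s + s * (qconj s)\<^sup>2 = of_real (2 * qc0 s * inner s s)" .
  have "s\<^sup>2 + (qconj s)\<^sup>2 = (s + qconj s) * (s + qconj s) - s * qconj s - qconj s * s"
    by (simp add: power2_eq_square algebra_simps)
  then show "s\<^sup>2 + (qconj s)\<^sup>2 = of_real (4 * (qc0 s)\<^sup>2 - 2 * inner s s)"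
    unfolding 1 2 3 of_real_mult[symmetric] of_real_diff[symmetric] by (simp only: power2_eq_square) (simp add: algebra_simps)
qed (simp_all add: qconj_def quat_eq_iff quat_arith_defs inner_quat_def of_real_def)

locale paravector_operator =
  fixes T0 T1 T2 :: "'a::banach \<Rightarrow>\<^sub>L 'a"
  assumes comm01: "T0 o\<^sub>L T1 = T1 o\<^sub>L T0" and comm02: "T0 o\<^sub>L T2 = T2 o\<^sub>L T0" and comm12: "T1 o\<^sub>L T2 = T2 o\<^sub>L T1"
begin

definition T :: "'a hop" where "T = op_of_components T0 T1 T2 0"
definition Tb :: "'a hop" where "Tb = op_conj T"
definition A :: "'a hop" where "A = extend_op T0"
text \<open>Given by components, so that it visibly commutes with left multiplication by
  quaternions; \<open>T_Tb\<close> identifies it with the product of \<open>T\<close> and its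
  conjugate.\<close>

definition N :: "'a hop" where "N = extend_op ((T0 o\<^sub>L T0) + (T1 o\<^sub>L T1) + (T2 o\<^sub>L T2))"

lemma T_apply: "T x = A x + lmult qe1 (extend_op T1 x) + lmult qe2 (extend_op T2 x)"
  by (simp add: T_def A_def op_of_components_def plus_blinfun.rep_eq extend_op_lmult)

lemma Tb_apply: "Tb x = 2 *\<^sub>R A x - T x"
proof -
  have "Tb = op_of_components T0 (- T1) (- T2) (- 0)"
    unfolding Tb_def op_conj_def T_def op_component_op_of_components ..
  then have "Tb x = A x - lmult qe1 (extend_op T1 x) - lmult qe2 (extend_op T2 x)"
    by (simp add: op_of_components_def A_def plus_blinfun.rep_eq extend_op_lmult extend_op_minus blinfun.minus_right)
  then show ?thesis by (simp add: T_apply scaleR_2)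
qed

lemma A_lmult: "A (lmult a x) = lmult a (A x)" and N_lmult: "N (lmult a x) = lmult a (N x)"
  by (simp_all add: A_def N_def extend_op_lmult)

lemma extend_commute:
  "extend_op T1 (A x) = A (extend_op T1 x)" "extend_op T2 (A x) = A (extend_op T2 x)"
  "extend_op T2 (extend_op T1 x) = extend_op T1 (extend_op T2 x)"
  unfolding A_def extend_op_compose[symmetric] by (simp_all add: comm01 comm02 comm12)

lemma N_apply: "N x = A (A x) + extend_op T1 (extend_op T1 x) + extend_op T2 (extend_op T2 x)"
  by (simp add: N_def A_def extend_op_add extend_op_compose)

lemma T_A: "T (A x) = A (T x)" and N_A: "N (A x) = A (N x)" and T_N: "T (N x) = N (T x)"
  by (simp_all add: T_apply N_apply blinfun.add_right A_lmult extend_op_lmult extend_commute)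

text \<open>The quadratic equation of a paravector: the mixed terms cancel because
  \<open>qe1\<close> and \<open>qe2\<close> anticommute while \<open>T1\<close> and
  \<open>T2\<close> commute.\<close>

lemma T_T: "T (T x) = 2 *\<^sub>R A (T x) - N x"
proof -
  have "lmult qe1 (lmult qe1 y) = - y" "lmult qe2 (lmult qe2 y) = - y"
    "lmult qe2 (lmult qe1 y) = - lmult qe1 (lmult qe2 y)" for y :: "'a hmod"
  proof -
    have "qe1 * qe1 = - 1" "qe2 * qe2 = - 1" "qe2 * qe1 = - (qe1 * qe2)" by (simp_all add: quat_arith_defs)
    then show "lmult qe1 (lmult qe1 y) = - y" "lmult qe2 (lmult qe2 y) = - y"
      "lmult qe2 (lmult qe1 y) = - lmult qe1 (lmult qe2 y)"
      by (simp_all flip: lmult_mult) (simp_all add: lmult_minus uminus_blinfun.rep_eq)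
  qed
  then show ?thesis
    by (simp add: T_apply N_apply blinfun.add_right A_lmult extend_op_lmult extend_commute scaleR_2)
qed

text \<open>\<open>qe3\<close> anticommutes with \<open>qe1\<close> and \<open>qe2\<close> and has
  the inverse \<open>- qe3\<close>, so conjugation by it flips exactly the two imaginary
  components.\<close>

lemma Tb_conjugate: "Tb = lmult qe3 o\<^sub>L T o\<^sub>L lmult (- qe3)"
proof (rule blinfun_eqI)
  fix x
  have "lmult qe3 (lmult (- qe3) x) = x" "lmult qe3 (lmult qe1 (lmult (- qe3) y)) = - lmult qe1 y"
    "lmult qe3 (lmult qe2 (lmult (- qe3) y)) = - lmult qe2 y" for x y :: "'a hmod"
    by (simp_all add: quat_arith_defs flip: lmult_mult one_quat_def)
      (simp_all add: lmult.rep_eq split: prod.split)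
  then show "Tb x = (lmult qe3 o\<^sub>L T o\<^sub>L lmult (- qe3)) x"
    by (simp add: Tb_apply T_apply blinfun.add_right A_lmult extend_op_lmult scaleR_2)
qed

lemma Q_c_apply: "Q_c s T x = lmult (s\<^sup>2) x - 2 *\<^sub>R lmult s (A x) + N x"
proof -
  have "T (Tb x) = N x" by (simp add: Tb_apply blinfun.diff_right blinfun.scaleR_right T_A T_T)
  then show ?thesis
    by (simp add: Q_c_def plus_blinfun.rep_eq minus_blinfun.rep_eq flip: Tb_def)
      (simp add: Tb_apply blinfun.scaleR_right)
qed

definition Q_s :: "'a hop \<Rightarrow> quat \<Rightarrow> 'a hop" where
  "Q_s X s = (X o\<^sub>L X) - (2 * qc0 s) *\<^sub>R X + (norm s)\<^sup>2 *\<^sub>R id_blinfun"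

lemma Q_s_apply: "Q_s X s x = X (X x) - (2 * qc0 s) *\<^sub>R X x + inner s s *\<^sub>R x"
  by (simp add: Q_s_def blinfun_ops dot_square_norm)

text \<open>If \<open>s\<close> commuted with \<open>T\<close>, both sides would be the product of
  \<open>s - T\<close>, \<open>s - Tb\<close>, \<open>qconj s - T\<close> and
  \<open>qconj s - Tb\<close>. In fact both expand into the same polynomial in \<open>A\<close> and
  \<open>N\<close> with real coefficients, once \<open>T_T\<close> has removed the powers of
  \<open>T\<close>.\<close>

lemma Q_c_Q_c_conj: "Q_c s T (Q_c (qconj s) T x) = Q_s T s (Q_s Tb s x)"
proof -
  let ?n = "inner s s" and ?u = "qc0 s"
  have "Q_c s T (Q_c (qconj s) T x) = lmult (s\<^sup>2 * (qconj s)\<^sup>2) x - 2 *\<^sub>R lmult (s\<^sup>2 * qconj s + s * (qconj s)\<^sup>2) (A x)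
      + lmult (s\<^sup>2 + (qconj s)\<^sup>2) (N x) + 4 *\<^sub>R lmult (s * qconj s) (A (A x)) - 2 *\<^sub>R lmult (s + qconj s) (A (N x)) + N (N x)"
    by (simp add: Q_c_apply blinfun_ops A_lmult N_lmult N_A
        lmult_mult lmult_add plus_blinfun.rep_eq scaleR_add_right scaleR_diff_right)
  also have "\<dots> = ?n\<^sup>2 *\<^sub>R x - 2 *\<^sub>R (2 * ?u * ?n) *\<^sub>R A x + (4 * ?u\<^sup>2 - 2 * ?n) *\<^sub>R N x + 4 *\<^sub>R ?n *\<^sub>R A (A x)
      - 2 *\<^sub>R (2 * ?u) *\<^sub>R A (N x) + N (N x)"
    unfolding qconj_identities lmult_of_real by (simp add: scaleR_blinfun.rep_eq)
  also have "\<dots> = Q_s T s (Q_s Tb s x)"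
  \<comment> \<open>A real functional turns the comparison of coefficients into an identity of real
    numbers.\<close>
  proof (rule eqI_functional)
    fix \<phi> :: "'a hmod \<Rightarrow> real" assume "bounded_linear \<phi>"
    then interpret \<phi>: bounded_linear \<phi> .
    show "\<phi> (?n\<^sup>2 *\<^sub>R x - 2 *\<^sub>R (2 * ?u * ?n) *\<^sub>R A x + (4 * ?u\<^sup>2 - 2 * ?n) *\<^sub>R N x + 4 *\<^sub>R ?n *\<^sub>R A (A x)
      - 2 *\<^sub>R (2 * ?u) *\<^sub>R A (N x) + N (N x)) = \<phi> (Q_s T s (Q_s Tb s x))"
      unfolding Q_s_apply Tb_apply
      by (simp add: blinfun_ops T_A T_N T_T N_A
          \<phi>.add \<phi>.diff \<phi>.scaleR) (simp add: algebra_simps power2_eq_square)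
  qed
  finally show ?thesis .
qed

lemma BX_T: "T \<in> BX" and BX_Tb: "Tb \<in> BX"
  unfolding T_def Tb_def op_conj_def by (rule BX_op_of_components)+

lemma BX_Q_c: "Q_c s T \<in> BX"
  unfolding Q_c_def Tb_def[symmetric] by (intro BX_add BX_diff BX_compose BX_lmult BX_T BX_Tb)

text \<open>The hypothesis inverts \<open>Q_s T s\<close>; conjugation by \<open>qe3\<close> then
  inverts \<open>Q_s Tb s\<close>. Their product is that of \<open>Q_c\<close> at \<open>s\<close>
  and at \<open>qconj s\<close> in either order, because \<open>Q_s\<close> sees only the real part
  and the norm of \<open>s\<close>. So \<open>Q_c s T\<close> has both a right and a left
  inverse.\<close>

lemma Q_c_inverse:
  assumes "s \<in> S_resolvent_set T"
  shows "Q_c s T o\<^sub>L op_inverse (Q_c s T) = id_blinfun" "op_inverse (Q_c s T) o\<^sub>L Q_c s T = id_blinfun"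
proof -
  obtain R1 where R1: "Q_s T s o\<^sub>L R1 = id_blinfun" "R1 o\<^sub>L Q_s T s = id_blinfun"
    using assms unfolding S_resolvent_set_def Q_s_def is_inverse_in_BX_def by blast
  define E E' where "E = (lmult qe3 :: 'a hop)" and "E' = (lmult (- qe3) :: 'a hop)"
  have E: "E (E' x) = x" "E' (E x) = x" for x
    unfolding E_def E'_def by (simp_all add: quat_arith_defs flip: lmult_mult one_quat_def)
  have Tb: "Tb x = E (T (E' x))" for x by (simp add: Tb_conjugate E_def E'_def)
  have Qb: "Q_s Tb s x = E (Q_s T s (E' x))" for x
    by (simp add: Q_s_apply Tb E blinfun_ops)
  define R2 where "R2 = E o\<^sub>L R1 o\<^sub>L E'"
  have r: "Q_s T s (R1 x) = x" "R1 (Q_s T s x) = x" "Q_s Tb s (R2 x) = x" "R2 (Q_s Tb s x) = x" for x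
    by (simp_all add: Qb R2_def E blinfun_inverse_apply[OF R1(1)] blinfun_inverse_apply[OF R1(2)])
  have conj: "qconj (qconj s) = s" "Q_s X (qconj s) = Q_s X s" for X
    by (simp_all add: qconj_def quat_eq_iff Q_s_def norm_eq_sqrt_inner inner_quat_def)
  let ?C = "Q_c s T" and ?D = "Q_c (qconj s) T"
  have CD: "?C (?D x) = Q_s T s (Q_s Tb s x)" "?D (?C x) = Q_s T s (Q_s Tb s x)" for x
    using Q_c_Q_c_conj[of s x] Q_c_Q_c_conj[of "qconj s" x] by (simp_all add: conj)
  define Y where "Y = ?D o\<^sub>L R2 o\<^sub>L R1"
  have CY: "?C (Y x) = x" for x by (simp add: Y_def CD r)
  have ZC: "R2 (R1 (?D (?C x))) = x" for x by (simp add: CD r)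
  have "Y (?C x) = x" for x using ZC[of "Y (?C x)"] unfolding CY ZC by simp
  then have "is_inverse_in_BX ?C Y"
    using CY by (intro is_inverse_in_BXI BX_Q_c blinfun_eqI) simp_all
  from op_inverse_works[OF this]
  show "?C o\<^sub>L op_inverse ?C = id_blinfun" "op_inverse ?C o\<^sub>L ?C = id_blinfun" .
qed

end

section \<open>The slice resolvent\<close>

lemma imag_units_iff: "J \<in> imag_units \<longleftrightarrow> qc0 J = 0 \<and> norm J = 1"
proof
  assume "J \<in> imag_units"
  then have 1: "(qc0 J)\<^sup>2 - (qc1 J)\<^sup>2 - (qc2 J)\<^sup>2 - (qc3 J)\<^sup>2 = -1" "qc0 J * qc1 J = 0" "qc0 J * qc2 J = 0" "qc0 J * qc3 J = 0"
    by (auto simp: imag_units_def quat_eq_iff quat_arith_defs power2_eq_square)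
  have 0: "qc0 J = 0"
  proof (rule ccontr)
    assume "qc0 J \<noteq> 0"
    then have "(qc0 J)\<^sup>2 = -1" using 1 by simp
    then show False using zero_le_power2[of "qc0 J"] by linarith
  qed
  then have "inner J J = 1" using 1(1) by (simp add: inner_quat_def power2_eq_square)
  then show "qc0 J = 0 \<and> norm J = 1" using 0 by (simp add: norm_eq_sqrt_inner)
next
  assume J: "qc0 J = 0 \<and> norm J = 1"
  then have "inner J J = 1" by (simp add: dot_square_norm)
  then show "J \<in> imag_units"
    using J by (simp add: imag_units_def quat_eq_iff quat_arith_defs inner_quat_def)
qed

lemma slice_embed_scaleR: "slice_embed J z = Re z *\<^sub>R 1 + Im z *\<^sub>R J"
  by (simp add: slice_embed_def of_real_def)

lemma bounded_linear_slice_embed: "bounded_linear (slice_embed J)"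
  unfolding slice_embed_scaleR
  by (intro bounded_linear_add bounded_linear_scaleR_left[THEN bounded_linear_compose] bounded_linear_Re bounded_linear_Im)

lemma slice_embed_mult:
  assumes "J \<in> imag_units"
  shows "slice_embed J (z * w) = slice_embed J z * slice_embed J w"
proof -
  have J: "J * J = -1" using assms by (simp add: imag_units_def)
  show ?thesis unfolding slice_embed_scaleR by (simp add: J algebra_simps)
qed

lemma slice_embed_simps [simp]: "slice_embed J \<i> = J" "slice_embed J 1 = 1" "slice_embed J (of_real r) = of_real r"
  by (simp_all add: slice_embed_def)

lemma norm_slice_embed:
  assumes "J \<in> imag_units"
  shows "norm (slice_embed J z) = norm z"
proof -
  have J: "qc0 J = 0" "inner J J = 1" using assms by (auto simp: imag_units_iff dot_square_norm)
  have "inner (slice_embed J z) (slice_embed J z) = (Re z)\<^sup>2 * 1 + (Im z)\<^sup>2 * inner J J"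
    using J(1) by (simp add: slice_embed_scaleR inner_quat_def plus_quat_def scaleR_quat_def one_quat_def power2_eq_square algebra_simps)
  then show ?thesis unfolding J norm_eq_sqrt_inner[of "slice_embed J z"] cmod_def by simp
qed

text \<open>For \<open>left = False\<close> this is the product of the opposite algebra, over which
  a right slice hyperholomorphic function becomes a left one.\<close>

definition sided_mult :: "bool \<Rightarrow> quat \<Rightarrow> quat \<Rightarrow> quat" where
  "sided_mult left a b = (if left then a * b else b * a)"

text \<open>In the left calculus the coefficients stand to the right of the kernel, in the right
  calculus to its left. The factor nearest to the kernel acts first.\<close>

definition sided_act :: "bool \<Rightarrow> quat \<Rightarrow> 'a::real_normed_vector hop \<Rightarrow> 'a hop" where
  "sided_act left a X = (if left then X o\<^sub>L lmult a else lmult a o\<^sub>L X)"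

lemma sided_act_mult: "sided_act left (sided_mult left a b) X = sided_act left b (sided_act left a X)"
  by (simp add: sided_act_def sided_mult_def lmult_compose blinfun_compose_assoc)

lemma bounded_bilinear_sided_act: "bounded_bilinear (sided_act left :: quat \<Rightarrow> 'a::real_normed_vector hop \<Rightarrow> _)"
proof -
  have "bounded_bilinear (\<lambda>a (X :: 'a hop). X o\<^sub>L lmult a)"
    by (rule bounded_bilinear.flip[OF blinfun_compose.comp[OF bounded_linear_ident bounded_linear_lmult]])
  moreover have "bounded_bilinear (\<lambda>a (X :: 'a hop). lmult a o\<^sub>L X)"
    using blinfun_compose.comp1[OF bounded_linear_lmult] .
  ultimately show ?thesis unfolding sided_act_def by (cases left) simp_all
qed

section \<open>Sums of mixed powers and their recursion\<close>

context paravector_operator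
begin

lemma Tb_A: "Tb (A x) = A (Tb x)" and T_Tb: "T (Tb x) = N x" and Tb_T: "Tb (T x) = N x"
  by (simp_all add: Tb_apply blinfun.diff_right blinfun.scaleR_right T_A T_T)

text \<open>For positive \<open>n\<close>, the complete homogeneous polynomial of degree
  \<open>n - 1\<close> in the commuting operators \<open>T\<close> and \<open>Tb\<close>.\<close>

definition power_sum :: "nat \<Rightarrow> 'a hop" where
  "power_sum n = (\<Sum>k=1..n. op_pow T (n - k) o\<^sub>L op_pow Tb (k - 1))"

lemma power_sum_Suc: "power_sum (Suc n) x = T (power_sum n x) + op_pow Tb n x"
proof -
  have "power_sum (Suc n) = (\<Sum>k=1..n. T o\<^sub>L (op_pow T (n - k) o\<^sub>L op_pow Tb (k - 1))) + op_pow Tb n"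
    unfolding power_sum_def by (simp add: Suc_diff_le blinfun_compose_assoc)
  then show ?thesis
    by (simp add: power_sum_def plus_blinfun.rep_eq blinfun.sum_left blinfun.sum_right)
qed

lemma Tb_op_pow: "Tb (op_pow Tb n x) = op_pow Tb n (Tb x)"
  by (induction n) auto

text \<open>Splits off the summand \<open>k = 1\<close>, where \<open>power_sum_Suc\<close> splits
  off the last one. This form produces the powers of \<open>T\<close> in
  \<open>P2_power\<close>.\<close>

lemma power_sum_Suc2: "power_sum (Suc n) x = power_sum n (Tb x) + op_pow T n x"
proof (induction n arbitrary: x)
  case 0 show ?case by (simp add: power_sum_def)
next
  case (Suc n)
  have "power_sum (Suc (Suc n)) x = T (power_sum n (Tb x) + op_pow T n x) + op_pow Tb n (Tb x)"
    by (subst power_sum_Suc) (simp add: Suc.IH Tb_op_pow)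
  also have "\<dots> = power_sum (Suc n) (Tb x) + op_pow T (Suc n) x"
    by (simp add: power_sum_Suc blinfun.add_right)
  finally show ?case .
qed

lemma Tb_power_sum: "Tb (power_sum n x) = power_sum n (Tb x)"
proof (induction n)
  case 0 show ?case by (simp add: power_sum_def blinfun.zero_right)
next
  case (Suc n)
  have "Tb (T y) = T (Tb y)" for y by (simp add: Tb_T T_Tb)
  then show ?case by (simp add: power_sum_Suc blinfun.add_right Suc Tb_op_pow)
qed

text \<open>After replacing the outer \<open>T\<close> by \<open>2 A - Tb\<close>, the power
  \<open>op_pow Tb (Suc n)\<close> contained in \<open>Tb (power_sum (Suc n) x)\<close> cancels the
  one split off by \<open>power_sum_Suc\<close>.\<close>

lemma power_sum_recursion: "power_sum (Suc (Suc n)) x = 2 *\<^sub>R A (power_sum (Suc n) x) - N (power_sum n x)"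
proof -
  have "Tb (power_sum (Suc n) x) = N (power_sum n x) + op_pow Tb (Suc n) x"
    unfolding power_sum_Suc[of n] by (simp add: blinfun.add_right Tb_T)
  moreover have "T (power_sum (Suc n) x) = 2 *\<^sub>R A (power_sum (Suc n) x) - Tb (power_sum (Suc n) x)"
    by (simp add: Tb_apply)
  ultimately show ?thesis by (subst power_sum_Suc) simp
qed

end

locale paravector_slice = paravector_operator T0 T1 T2 for T0 T1 T2 :: "'a::banach \<Rightarrow>\<^sub>L 'a" +
  fixes J :: quat and left :: bool and r :: real
  assumes J: "J \<in> imag_units" and spectrum_bounded: "S_spectrum T \<subseteq> ball 0 r"
begin

abbreviation \<iota> :: "complex \<Rightarrow> quat" where "\<iota> \<equiv> slice_embed J"

definition R :: "complex \<Rightarrow> 'a hop" where "R z = op_inverse (Q_c (\<iota> z) T)"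
definition R' :: "complex \<Rightarrow> 'a hop" where "R' z = -2 *\<^sub>R ((lmult (\<iota> z) - A) o\<^sub>L (R z o\<^sub>L R z))"
definition K :: "complex set" where "K = slice J (S_spectrum T)"

lemma K_iff: "z \<in> K \<longleftrightarrow> \<iota> z \<notin> S_resolvent_set T"
  by (simp add: K_def slice_def S_spectrum_def)

lemma K_ball: "K \<subseteq> ball 0 r"
  using spectrum_bounded norm_slice_embed[OF J] by (fastforce simp: K_def slice_def)

lemma compact_K: "compact K"
proof -
  have "closed (S_spectrum T)"
    unfolding S_spectrum_def using open_S_resolvent_set[OF BX_T] by (simp add: closed_def)
  moreover have "continuous_on UNIV \<iota>" by (rule linear_continuous_on[OF bounded_linear_slice_embed])
  ultimately have "closed K" unfolding K_def slice_def by (rule closed_vimage)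
  moreover have "bounded K" by (rule bounded_subset[OF bounded_ball K_ball])
  ultimately show ?thesis by (simp add: compact_eq_bounded_closed)
qed

lemma open_K: "open (- K)"
  using compact_K compact_imp_closed by blast

lemma Q_R: "z \<notin> K \<Longrightarrow> Q_c (\<iota> z) T o\<^sub>L R z = id_blinfun" and R_Q: "z \<notin> K \<Longrightarrow> R z o\<^sub>L Q_c (\<iota> z) T = id_blinfun"
  using Q_c_inverse[of "\<iota> z"] by (auto simp: K_iff R_def)

lemma \<iota>_commute: "\<iota> z * \<iota> w = \<iota> w * \<iota> z"
  by (metis slice_embed_mult[OF J] mult.commute)

lemma lmult_\<iota>_commute: "lmult (\<iota> z) (lmult (\<iota> w) x) = lmult (\<iota> w) (lmult (\<iota> z) x)"
  by (metis lmult_mult \<iota>_commute)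

lemma R_commute:
  fixes C :: "'a hop"
  assumes z: "z \<notin> K" and C: "\<And>x. C (Q_c (\<iota> z) T x) = Q_c (\<iota> z) T (C x)"
  shows "R z (C x) = C (R z x)"
proof -
  have "C o\<^sub>L Q_c (\<iota> z) T = Q_c (\<iota> z) T o\<^sub>L C" by (rule blinfun_eqI) (simp add: C)
  from inverse_commute[OF Q_R[OF z] R_Q[OF z] this] have "C o\<^sub>L R z = R z o\<^sub>L C" .
  then show ?thesis by (metis blinfun_apply_blinfun_compose)
qed

text \<open>The quaternion coefficients of \<open>Q_c\<close> at a point of the plane of
  \<open>J\<close> lie in that plane and commute with it. Other quaternions need not commute with
  \<open>R z\<close>.\<close>

lemma R_\<iota>: "z \<notin> K \<Longrightarrow> R z (lmult (\<iota> w) x) = lmult (\<iota> w) (R z x)"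
  by (rule R_commute)
    (simp_all add: Q_c_apply blinfun_ops A_lmult N_lmult
      power2_eq_square lmult_mult lmult_\<iota>_commute[of w z])

lemma R_A: "z \<notin> K \<Longrightarrow> R z (A x) = A (R z x)"
  by (rule R_commute)
    (simp_all add: Q_c_apply blinfun_ops A_lmult N_A)

lemma Q_c_has_derivative:
  "((\<lambda>z. Q_c (\<iota> z) T) has_derivative (\<lambda>h. 2 *\<^sub>R (lmult (\<iota> h) o\<^sub>L (lmult (\<iota> w) - A)))) (at w)"
proof -
  have lin: "bounded_linear (\<lambda>z. lmult (\<iota> z) :: 'a hop)"
    by (rule bounded_linear_compose[OF bounded_linear_lmult bounded_linear_slice_embed])
  have eq: "Q_c (\<iota> z) T = lmult (\<iota> (z\<^sup>2)) - 2 *\<^sub>R (lmult (\<iota> z) o\<^sub>L A) + N" for z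
    by (rule blinfun_eqI)
      (simp add: Q_c_apply blinfun_ops power2_eq_square slice_embed_mult[OF J])
  have sq: "((\<lambda>z::complex. z\<^sup>2) has_derivative (\<lambda>h. 2 * w * h)) (at w)"
    by (auto intro!: derivative_eq_intros simp: power2_eq_square)
  have l1: "((\<lambda>z. lmult (\<iota> z)) has_derivative (\<lambda>h. lmult (\<iota> h) :: 'a hop)) (at w)"
    by (rule bounded_linear.has_derivative[OF lin has_derivative_ident])
  have l2: "((\<lambda>z. lmult (\<iota> z) o\<^sub>L A) has_derivative (\<lambda>h. lmult (\<iota> h) o\<^sub>L A)) (at w)"
    by (rule bounded_linear.has_derivative[OF blinfun_compose.bounded_linear_left l1])
  have "((\<lambda>z. Q_c (\<iota> z) T) has_derivative (\<lambda>h. lmult (\<iota> (2 * w * h)) - 2 *\<^sub>R (lmult (\<iota> h) o\<^sub>L A) + 0)) (at w)"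
    unfolding eq
    by (intro has_derivative_add has_derivative_diff has_derivative_scaleR_right has_derivative_const l2
        bounded_linear.has_derivative[OF lin sq])
  moreover have "lmult (\<iota> (2 * w * h)) - 2 *\<^sub>R (lmult (\<iota> h) o\<^sub>L A) + 0 = 2 *\<^sub>R (lmult (\<iota> h) o\<^sub>L (lmult (\<iota> w) - A))" for h
  proof (rule blinfun_eqI)
    fix x
    have "\<iota> (2 * w * h) = 2 *\<^sub>R (\<iota> h * \<iota> w)"
      using slice_embed_mult[OF J, of h w] linear_cmul[OF bounded_linear.linear[OF bounded_linear_slice_embed], of J 2 "h * w"]
      by (simp add: scaleR_conv_of_real mult_ac)
    then show "blinfun_apply (lmult (\<iota> (2 * w * h)) - 2 *\<^sub>R (lmult (\<iota> h) o\<^sub>L A) + 0) x = (2 *\<^sub>R (lmult (\<iota> h) o\<^sub>L (lmult (\<iota> w) - A))) x"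
      by (simp add: lmult_scaleR lmult_mult blinfun_ops scaleR_diff_right)
  qed
  ultimately show ?thesis by simp
qed

lemma R_has_derivative:
  assumes w: "w \<notin> K"
  shows "(R has_derivative (\<lambda>h. lmult (\<iota> h) o\<^sub>L R' w)) (at w)"
proof -
  have "(R has_derivative (\<lambda>h. - (R w o\<^sub>L (2 *\<^sub>R (lmult (\<iota> h) o\<^sub>L (lmult (\<iota> w) - A))) o\<^sub>L R w))) (at w)"
    using has_derivative_operator_inverse[OF open_K _ _ _ Q_c_has_derivative[of w], of R] w Q_R R_Q by simp
  moreover have "- (R w o\<^sub>L (2 *\<^sub>R (lmult (\<iota> h) o\<^sub>L (lmult (\<iota> w) - A))) o\<^sub>L R w) = lmult (\<iota> h) o\<^sub>L R' w" for h
    by (rule blinfun_eqI)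
      (simp add: R'_def R_\<iota>[OF w] R_A[OF w] blinfun_ops)
  ultimately show ?thesis by simp
qed

lemma R'_\<iota>:
  assumes z: "z \<notin> K"
  shows "R' z (lmult (\<iota> w) x) = lmult (\<iota> w) (R' z x)"
  by (simp add: R'_def R_\<iota>[OF z] R_A[OF z] blinfun_ops A_lmult lmult_\<iota>_commute[of w z])

text \<open>Since \<open>D\<close> commutes with the plane of \<open>J\<close>, the derivative is
  complex linear for composition on either side.\<close>

lemma R'_has_derivative:
  assumes w: "w \<notin> K"
  shows "\<exists>D. (R' has_derivative (\<lambda>h. lmult (\<iota> h) o\<^sub>L D)) (at w) \<and> (\<forall>h. lmult (\<iota> h) o\<^sub>L D = D o\<^sub>L lmult (\<iota> h))"
proof -
  let ?D = "-2 *\<^sub>R (((lmult (\<iota> w) - A) o\<^sub>L ((R w o\<^sub>L R' w) + (R' w o\<^sub>L R w))) + (R w o\<^sub>L R w))"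
  have lin: "bounded_linear (\<lambda>z. lmult (\<iota> z) :: 'a hop)"
    by (rule bounded_linear_compose[OF bounded_linear_lmult bounded_linear_slice_embed])
  have G: "((\<lambda>z. lmult (\<iota> z) - A) has_derivative (\<lambda>h. lmult (\<iota> h) - 0)) (at w)"
    by (intro has_derivative_diff has_derivative_const bounded_linear.has_derivative[OF lin has_derivative_ident])
  note RR = blinfun_compose.FDERIV[OF R_has_derivative[OF w] R_has_derivative[OF w]]
  have "((\<lambda>z. -2 *\<^sub>R ((lmult (\<iota> z) - A) o\<^sub>L (R z o\<^sub>L R z))) has_derivative (\<lambda>h. -2 *\<^sub>R (((lmult (\<iota> w) - A) o\<^sub>L ((R w o\<^sub>L (lmult (\<iota> h) o\<^sub>L R' w)) + ((lmult (\<iota> h) o\<^sub>L R' w) o\<^sub>L R w)))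
      + ((lmult (\<iota> h) - 0) o\<^sub>L (R w o\<^sub>L R w))))) (at w)"
    by (rule has_derivative_scaleR_right[OF blinfun_compose.FDERIV[OF G RR]])
  moreover have "(\<lambda>z. -2 *\<^sub>R ((lmult (\<iota> z) - A) o\<^sub>L (R z o\<^sub>L R z))) = R'" by (simp add: R'_def fun_eq_iff)
  moreover have "-2 *\<^sub>R (((lmult (\<iota> w) - A) o\<^sub>L ((R w o\<^sub>L (lmult (\<iota> h) o\<^sub>L R' w)) + ((lmult (\<iota> h) o\<^sub>L R' w) o\<^sub>L R w)))
      + ((lmult (\<iota> h) - 0) o\<^sub>L (R w o\<^sub>L R w))) = lmult (\<iota> h) o\<^sub>L ?D" for h
    by (rule blinfun_eqI)
      (simp add: R_\<iota>[OF w] blinfun_ops A_lmult lmult_\<iota>_commute[of h w])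
  moreover have "lmult (\<iota> h) o\<^sub>L ?D = ?D o\<^sub>L lmult (\<iota> h)" for h
    by (rule blinfun_eqI)
      (simp add: R_\<iota>[OF w] R'_\<iota>[OF w] blinfun_ops A_lmult lmult_\<iota>_commute[of h w])
  ultimately show ?thesis by (intro exI[of _ ?D]) simp
qed

end

section \<open>The kernels of the calculus as instances of the quadratic resolvent\<close>

context paravector_slice
begin

text \<open>The conjugate stands to the left of the inverse in \<open>F_left\<close> and to its
  right in \<open>F_right\<close>.\<close>

definition Lb :: "'a hop \<Rightarrow> 'a hop" where
  "Lb X = (if left then Tb o\<^sub>L X else X o\<^sub>L Tb)"

definition P2 :: "quat \<Rightarrow> 'a hop" where
  "P2 s = (if left then P2_left s T else P2_right s T)"

sublocale cst: complex_structure "sided_act left J :: 'a hop \<Rightarrow> 'a hop"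
proof (rule complex_structure.intro)
  show "bounded_linear (sided_act left J :: 'a hop \<Rightarrow> _)"
    by (rule bounded_bilinear.bounded_linear_right[OF bounded_bilinear_sided_act])
  have "J * J = -1" using J by (simp add: imag_units_def)
  then show "sided_act left J (sided_act left J X) = - X" for X :: "'a hop"
    by (intro blinfun_eqI)
      (simp add: sided_act_def lmult_minus uminus_blinfun.rep_eq blinfun.minus_right flip: lmult_mult)
qed

lemma cs_eq: "cst.cs z X = sided_act left (\<iota> z) X"
  unfolding cst.cs_def slice_embed_scaleR
  by (simp add: bounded_bilinear.add_left[OF bounded_bilinear_sided_act] bounded_bilinear.scaleR_left[OF bounded_bilinear_sided_act])
    (simp add: sided_act_def)

lemma sided_act_commuting:
  fixes X :: "'a hop"
  assumes "\<And>x. X (lmult a x) = lmult a (X x)"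
  shows "sided_act left a X = lmult a o\<^sub>L X"
  by (rule blinfun_eqI) (simp add: sided_act_def assms)

text \<open>Complex linearity is required in the sense of \<open>sided_act\<close>.
  \<open>R\<close>, \<open>R'\<close> and their derivatives commute with the plane of
  \<open>J\<close>, so for them the actions from the two sides coincide.\<close>

sublocale calc: quadratic_resolvent "sided_act left J :: 'a hop \<Rightarrow> 'a hop" R R' K "\<lambda>X. A o\<^sub>L X" "\<lambda>X. N o\<^sub>L X" Lb id_blinfun
proof (intro quadratic_resolvent.intro quadratic_resolvent_axioms.intro cst.complex_structure_axioms)
  show "bounded_linear (\<lambda>X. A o\<^sub>L X :: 'a hop)" "bounded_linear (\<lambda>X. N o\<^sub>L X :: 'a hop)"
    by (rule blinfun_compose.bounded_linear_right)+
  show "bounded_linear Lb"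
    unfolding Lb_def
    by (cases left) (simp_all add: blinfun_compose.bounded_linear_right
        blinfun_compose.bounded_linear_left)
  show "A o\<^sub>L sided_act left J X = sided_act left J (A o\<^sub>L X)" "N o\<^sub>L sided_act left J X = sided_act left J (N o\<^sub>L X)"
    "Lb (sided_act left J X) = sided_act left J (Lb X)" for X :: "'a hop"
    by (rule blinfun_eqI, simp add: sided_act_def Lb_def A_lmult N_lmult)+
  show "compact K" by (rule compact_K)
  fix z assume z: "z \<notin> K"
  show "(R has_derivative (\<lambda>h. cst.cs h (R' z))) (at z)"
    using R_has_derivative[OF z] by (simp add: cs_eq sided_act_commuting R'_\<iota>[OF z])
  have "cst.cs w (R z) = lmult (\<iota> w) o\<^sub>L R z" "cst.cs w (A o\<^sub>L R z) = lmult (\<iota> w) o\<^sub>L (A o\<^sub>L R z)" for w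
    by (simp_all add: cs_eq sided_act_commuting R_\<iota>[OF z] A_lmult)
  moreover have "lmult (\<iota> (z\<^sup>2)) (R z x) - 2 *\<^sub>R lmult (\<iota> z) (A (R z x)) + N (R z x) = x" for x
    using blinfun_inverse_apply[OF Q_R[OF z], of x] by (simp add: Q_c_apply power2_eq_square slice_embed_mult[OF J])
  ultimately show "cst.cs (z\<^sup>2) (R z) - 2 *\<^sub>R cst.cs z (A o\<^sub>L R z) + (N o\<^sub>L R z) = id_blinfun"
    by (intro blinfun_eqI) (simp add: blinfun_ops)
next
  show "cst.holo R' (- K)"
    unfolding cst.holo_def
  proof
    fix z assume "z \<in> - K"
    then obtain D where D: "(R' has_derivative (\<lambda>h. lmult (\<iota> h) o\<^sub>L D)) (at z)" "\<And>h. lmult (\<iota> h) o\<^sub>L D = D o\<^sub>L lmult (\<iota> h)"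
      using R'_has_derivative[of z] by auto
    have "cst.cs h D = lmult (\<iota> h) o\<^sub>L D" for h using D(2)[of h] by (simp add: cs_eq sided_act_def)
    then show "\<exists>D. (R' has_derivative (\<lambda>h. cst.cs h D)) (at z)" using D(1) by (intro exI[of _ D]) simp
  qed
qed

text \<open>Both sides are 4 times the product of \<open>s - Tb\<close>, \<open>s - A\<close> and
  the square of \<open>R z\<close>. The factor \<open>s - Tb\<close> stands first in the left case
  and last in the right case, as \<open>Tb\<close> need not commute with \<open>s\<close> or
  \<open>R z\<close>.\<close>

lemma kernel_eq_P2:
  assumes z: "z \<notin> K"
  shows "calc.kernel z = P2 (\<iota> z)"
proof (rule blinfun_eqI, rule eqI_functional)
  fix x and \<phi> :: "'a hmod \<Rightarrow> real" assume "bounded_linear \<phi>"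
  then interpret \<phi>: bounded_linear \<phi> .
  have scalar: "op_scalar_part T = A"
    by (simp add: op_scalar_part_def A_def T_def)
  show "\<phi> (calc.kernel z x) = \<phi> (P2 (\<iota> z) x)"
  proof (cases left)
    case True
    show ?thesis
      unfolding calc.kernel_def P2_def P2_left_def F_left_def cs_eq sided_act_def Lb_def R'_def R_def[symmetric] Tb_def[symmetric]
      using True
      by (simp add: scalar numeral_2_eq_2 R_\<iota>[OF z] R_A[OF z] blinfun_ops A_lmult Tb_A
        \<phi>.add \<phi>.diff \<phi>.scaleR \<phi>.neg)
  next
    case False
    show ?thesis
      unfolding calc.kernel_def P2_def P2_right_def F_right_def cs_eq sided_act_def Lb_def R'_def R_def[symmetric] Tb_def[symmetric]
      using False
      by (simp add: scalar numeral_2_eq_2 R_\<iota>[OF z] R_A[OF z] blinfun_ops A_lmult Tb_A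
        \<phi>.add \<phi>.diff \<phi>.scaleR \<phi>.neg)
  qed
qed

lemma moment_eq: "calc.moment n = power_sum n"
proof (induction n rule: calc.moment.induct)
  case 1 show ?case by (simp add: power_sum_def)
next
  case 2 show ?case by (simp add: power_sum_def)
next
  case (3 n)
  show ?case
    by (rule blinfun_eqI)
      (simp add: 3 power_sum_recursion minus_blinfun.rep_eq scaleR_blinfun.rep_eq)
qed

text \<open>Inserting \<open>power_sum m = Tb power_sum (m - 1) + T^(m-1)\<close> into
  \<open>(m + 1) power_sum m - m Tb power_sum (m - 1)\<close> leaves
  \<open>power_sum m + m T^(m-1)\<close>. The side on which \<open>Lb\<close> multiplies is
  immaterial here, since power sums commute with \<open>Tb\<close>.\<close>

lemma kernel_moment_eq: "calc.kernel_moment m = 2 *\<^sub>R P2_power T m"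
proof (cases m)
  case 0
  then show ?thesis by (simp add: calc.kernel_moment_def P2_power_def moment_eq power_sum_def)
next
  case (Suc n)
  have "Lb (power_sum n) x = power_sum n (Tb x)" for x by (simp add: Lb_def Tb_power_sum)
  then have "calc.kernel_moment m x = (2 *\<^sub>R (real m *\<^sub>R op_pow T n + power_sum m)) x" for x
    by (simp add: calc.kernel_moment_def moment_eq Suc power_sum_Suc2 blinfun_ops scaleR_2 algebra_simps)
  then show ?thesis
    by (intro blinfun_eqI) (simp add: P2_power_def power_sum_def Tb_def Suc)
qed

text \<open>The complex calculus treats the components \<open>h1\<close> and \<open>h2\<close>;
  \<open>k\<close> acts afterwards, as a bounded real-linear map that commutes with integrals and
  series.\<close>

theorem calculus_sided:
  assumes \<Omega>: "open \<Omega>" and r: "0 < r" and r_\<Omega>: "ball 0 r \<subseteq> \<Omega>"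
    and h1: "h1 holomorphic_on \<Omega>" and h1_sums: "\<And>z. z \<in> ball 0 r \<Longrightarrow> (\<lambda>m. c1 m * z ^ m) sums h1 z"
    and h2: "h2 holomorphic_on \<Omega>" and h2_sums: "\<And>z. z \<in> ball 0 r \<Longrightarrow> (\<lambda>m. c2 m * z ^ m) sums h2 z"
    and f: "\<And>z. z \<in> \<Omega> \<Longrightarrow> f (\<iota> z) = \<iota> (h1 z) + sided_mult left (\<iota> (h2 z)) k"
    and a: "\<And>m. a m = \<iota> (c1 m) + sided_mult left (\<iota> (c2 m)) k"
    and G: "encircles G K \<Omega>"
  defines "F \<equiv> \<lambda>\<gamma> t. sided_act left (f (\<iota> (\<gamma> t))) (sided_act left (ds_slice J \<gamma> t) (P2 (\<iota> (\<gamma> t))))"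
  shows "\<And>\<gamma>. \<gamma> \<in> G \<Longrightarrow> F \<gamma> integrable_on {0..1}"
    and "(\<lambda>m. 2 *\<^sub>R sided_act left (a m) (P2_power T m)) sums ((1 / (2 * pi)) *\<^sub>R (\<Sum>\<gamma>\<in>G. integral {0..1} (F \<gamma>)))"
proof -
  interpret act: bounded_bilinear "sided_act left :: quat \<Rightarrow> 'a hop \<Rightarrow> _" by (rule bounded_bilinear_sided_act)
  define I where "I h \<gamma> t = cst.cs (h (\<gamma> t) * (velocity \<gamma> t * - \<i>)) (calc.kernel (\<gamma> t))" for h \<gamma> t
  have act_split: "sided_act left (\<iota> u + sided_mult left (\<iota> v) k) X = cst.cs u X + sided_act left k (cst.cs v X)" for u v X
    by (simp add: act.add_left sided_act_mult cs_eq)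
  have F: "F \<gamma> t = I h1 \<gamma> t + sided_act left k (I h2 \<gamma> t)" if \<gamma>G: "\<gamma> \<in> G" and t: "t \<in> {0..1}" for \<gamma> t
  proof -
    have "path_image \<gamma> \<subseteq> \<Omega> - K" using G \<gamma>G by (simp add: encircles_def)
    moreover have "\<gamma> t \<in> path_image \<gamma>" using t by (simp add: path_image_def)
    ultimately have z: "\<gamma> t \<in> \<Omega>" "\<gamma> t \<notin> K" by blast+
    have "ds_slice J \<gamma> t = \<iota> (velocity \<gamma> t * - \<i>)"
      using linear_neg[OF bounded_linear.linear[OF bounded_linear_slice_embed], of J "\<i>"]
      by (simp only: ds_slice_def slice_embed_mult[OF J] slice_embed_simps)
    then show ?thesis
      unfolding F_def f[OF z(1)] act_split I_def cst.cs_mult[of "h1 (\<gamma> t)"] cst.cs_mult[of "h2 (\<gamma> t)"] kernel_eq_P2[OF z(2)]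
      by (simp only: cs_eq)
  qed
  have I1_int: "I h1 \<gamma> integrable_on {0..1}" if \<gamma>G: "\<gamma> \<in> G" for \<gamma>
    unfolding I_def
    by (rule calc.calculus_power_series(1)[OF \<Omega> r K_ball r_\<Omega> h1 h1_sums G])
      (assumption | rule \<gamma>G)+
  have I1_sums: "(\<lambda>m. cst.cs (c1 m) (calc.kernel_moment m)) sums ((1 / (2 * pi)) *\<^sub>R (\<Sum>\<gamma>\<in>G. integral {0..1} (I h1 \<gamma>)))"
    unfolding I_def[abs_def]
    by (rule calc.calculus_power_series(2)[OF \<Omega> r K_ball r_\<Omega> h1 h1_sums G])
  have I2_int: "I h2 \<gamma> integrable_on {0..1}" if \<gamma>G: "\<gamma> \<in> G" for \<gamma>
    unfolding I_def
    by (rule calc.calculus_power_series(1)[OF \<Omega> r K_ball r_\<Omega> h2 h2_sums G])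
      (assumption | rule \<gamma>G)+
  have I2_sums: "(\<lambda>m. cst.cs (c2 m) (calc.kernel_moment m)) sums ((1 / (2 * pi)) *\<^sub>R (\<Sum>\<gamma>\<in>G. integral {0..1} (I h2 \<gamma>)))"
    unfolding I_def[abs_def]
    by (rule calc.calculus_power_series(2)[OF \<Omega> r K_ball r_\<Omega> h2 h2_sums G])
  note k_lin = act.bounded_linear_right[of k]
  have kI: "((\<lambda>t. sided_act left k (I h2 \<gamma> t)) has_integral sided_act left k (integral {0..1} (I h2 \<gamma>))) {0..1}" if "\<gamma> \<in> G" for \<gamma>
    using has_integral_linear[OF integrable_integral[OF I2_int[OF that]] k_lin] by (simp add: o_def)
  have F_int: "(F \<gamma> has_integral (integral {0..1} (I h1 \<gamma>) + sided_act left k (integral {0..1} (I h2 \<gamma>)))) {0..1}" if "\<gamma> \<in> G" for \<gamma>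
    by (rule has_integral_eq[OF _ has_integral_add[OF integrable_integral[OF I1_int[OF that]] kI[OF that]]])
      (simp add: F[OF that])
  then show "F \<gamma> integrable_on {0..1}" if "\<gamma> \<in> G" for \<gamma> using that by blast
  have "integral {0..1} (F \<gamma>) = integral {0..1} (I h1 \<gamma>) + sided_act left k (integral {0..1} (I h2 \<gamma>))" if "\<gamma> \<in> G" for \<gamma>
    by (rule integral_unique[OF F_int[OF that]])
  then have "(1 / (2 * pi)) *\<^sub>R (\<Sum>\<gamma>\<in>G. integral {0..1} (F \<gamma>))
      = (1 / (2 * pi)) *\<^sub>R (\<Sum>\<gamma>\<in>G. integral {0..1} (I h1 \<gamma>)) + sided_act left k ((1 / (2 * pi)) *\<^sub>R (\<Sum>\<gamma>\<in>G. integral {0..1} (I h2 \<gamma>)))"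
    by (simp add: sum.distrib scaleR_add_right act.scaleR_right act.sum_right)
  moreover have "(\<lambda>m. cst.cs (c1 m) (calc.kernel_moment m) + sided_act left k (cst.cs (c2 m) (calc.kernel_moment m))) sums
      ((1 / (2 * pi)) *\<^sub>R (\<Sum>\<gamma>\<in>G. integral {0..1} (I h1 \<gamma>)) + sided_act left k ((1 / (2 * pi)) *\<^sub>R (\<Sum>\<gamma>\<in>G. integral {0..1} (I h2 \<gamma>))))"
    by (intro sums_add bounded_linear.sums[OF k_lin] I1_sums I2_sums)
  moreover have "cst.cs (c1 m) (calc.kernel_moment m) + sided_act left k (cst.cs (c2 m) (calc.kernel_moment m))
      = 2 *\<^sub>R sided_act left (a m) (P2_power T m)" for m
    unfolding act_split[symmetric] a[symmetric] kernel_moment_eq by (rule act.scaleR_right)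
  ultimately show "(\<lambda>m. 2 *\<^sub>R sided_act left (a m) (P2_power T m)) sums ((1 / (2 * pi)) *\<^sub>R (\<Sum>\<gamma>\<in>G. integral {0..1} (F \<gamma>)))"
    by simp
qed

end

section \<open>Slice hyperholomorphic functions on a slice\<close>

lemma bounded_bilinear_sided_mult: "bounded_bilinear (sided_mult left)"
  unfolding sided_mult_def
  by (cases left) (simp_all add: bounded_bilinear_mult bounded_bilinear.flip[OF bounded_bilinear_mult])

interpretation pr: bounded_bilinear "sided_mult left" for left
  by (rule bounded_bilinear_sided_mult)

lemma sided_mult_assoc: "sided_mult left (sided_mult left a b) c = sided_mult left a (sided_mult left b c)"
  by (simp add: sided_mult_def mult.assoc)

lemma sided_mult_unit:
  assumes "J \<in> imag_units"
  shows "sided_mult left J (sided_mult left J x) = - x"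
  unfolding sided_mult_assoc[symmetric] using assms by (simp add: sided_mult_def imag_units_def)

text \<open>The orthogonal projection onto the plane of \<open>J\<close>, read as a complex
  number.\<close>

definition slice_proj :: "quat \<Rightarrow> quat \<Rightarrow> complex" where
  "slice_proj J q = Complex (qc0 q) (inner q J)"

text \<open>The right-hand side is the part of \<open>q\<close> that commutes with
  \<open>J\<close>.\<close>

lemma slice_embed_slice_proj:
  assumes "J \<in> imag_units"
  shows "slice_embed J (slice_proj J q) = (1 / 2) *\<^sub>R (q - J * q * J)"
proof -
  have J0: "qc0 J = 0" and J1: "qc1 J * qc1 J + qc2 J * qc2 J + qc3 J * qc3 J = 1"
    using assms dot_square_norm[of J] by (auto simp: imag_units_iff inner_quat_def)
  show ?thesis
    unfolding slice_embed_scaleR slice_proj_def complex.sel quat_eq_iff quat_arith_defs inner_quat_def quat.sel J0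
    using J1 by (intro conjI; simp; algebra)
qed

lemma inj_slice_embed:
  assumes "J \<in> imag_units" "slice_embed J z = slice_embed J w"
  shows "z = w"
proof -
  have "norm (slice_embed J (z - w)) = 0"
    using assms(2) linear_diff[OF bounded_linear.linear[OF bounded_linear_slice_embed], of J z w] by simp
  then show ?thesis using norm_slice_embed[OF assms(1)] by simp
qed

lemma bounded_linear_slice_proj: "bounded_linear (slice_proj J)"
proof -
  have "linear (slice_proj J)"
    by (rule linearI)
      (simp_all add: slice_proj_def complex_eq_iff inner_quat_def plus_quat_def scaleR_quat_def algebra_simps)
  then show ?thesis by (simp add: linear_conv_bounded_linear)
qed

lemma slice_proj_unit:
  assumes J: "J \<in> imag_units"
  shows "slice_proj J (sided_mult left J q) = \<i> * slice_proj J q"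
proof (rule inj_slice_embed[OF J])
  have JJ: "J * J = -1" using J by (simp add: imag_units_def)
  have JJ': "J * (J * x) = - x" for x by (simp add: JJ flip: mult.assoc)
  show "slice_embed J (slice_proj J (sided_mult left J q)) = slice_embed J (\<i> * slice_proj J q)"
    unfolding slice_embed_slice_proj[OF J] slice_embed_mult[OF J] slice_embed_simps
    by (simp add: sided_mult_def mult.assoc JJ JJ' right_diff_distrib scaleR_diff_right)
qed

lemma slice_proj_sided_mult:
  assumes J: "J \<in> imag_units"
  shows "slice_proj J (sided_mult left (slice_embed J w) q) = w * slice_proj J q"
proof -
  interpret bounded_linear "slice_proj J" by (rule bounded_linear_slice_proj)
  have "sided_mult left (slice_embed J w) q = Re w *\<^sub>R q + Im w *\<^sub>R sided_mult left J q"
    by (simp add: slice_embed_scaleR sided_mult_def algebra_simps)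
  then have "slice_proj J (sided_mult left (slice_embed J w) q) = Re w *\<^sub>R slice_proj J q + Im w *\<^sub>R (\<i> * slice_proj J q)"
    by (simp only: add scaleR slice_proj_unit[OF J])
  also have "\<dots> = of_real (Re w) * slice_proj J q + of_real (Im w) * (\<i> * slice_proj J q)"
    by (simp add: scaleR_conv_of_real)
  also have "\<dots> = (of_real (Re w) + \<i> * of_real (Im w)) * slice_proj J q" by (simp add: algebra_simps)
  finally show ?thesis by (metis complex_eq)
qed

lemma exists_orthogonal_imag_unit:
  assumes J: "J \<in> imag_units"
  shows "\<exists>k\<in>imag_units. k * J = - (J * k)"
proof -
  \<comment> \<open>A quarter turn of the first two imaginary components is orthogonal to
    \<open>J\<close>. It vanishes only if \<open>J\<close> is \<open>qe3\<close> or
    \<open>- qe3\<close>, and then \<open>qe1\<close> serves.\<close>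
  define k0 where "k0 = (if qc1 J = 0 \<and> qc2 J = 0 then qe1 else Quat 0 (- qc2 J) (qc1 J) 0)"
  have J0: "qc0 J = 0" using J by (simp add: imag_units_iff)
  have k0: "qc0 k0 = 0" "k0 \<noteq> 0" "inner k0 J = 0"
    by (auto simp: k0_def quat_eq_iff zero_quat_def inner_quat_def)
  define k where "k = sgn k0"
  have "qc0 k = 0" using k0 by (simp add: k_def sgn_div_norm scaleR_quat_def)
  have "inner k J = 0" using k0(3) by (simp only: k_def sgn_div_norm inner_scaleR_left mult_zero_right)
  have "norm k = 1" using k0 by (simp add: k_def norm_sgn)
  have "k * J = - (J * k)"
    using \<open>qc0 k = 0\<close> \<open>inner k J = 0\<close> J0 by (simp add: quat_eq_iff quat_arith_defs inner_quat_def algebra_simps)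
  with \<open>qc0 k = 0\<close> \<open>norm k = 1\<close> show ?thesis by (intro bexI[of _ k]) (simp_all add: imag_units_iff)
qed

text \<open>The quaternions are the plane of \<open>J\<close> plus that plane times
  \<open>k\<close>; the second coefficient is the projection of \<open>q\<close> times
  \<open>- k\<close>, the inverse of \<open>k\<close>.\<close>

lemma slice_decomposition:
  assumes J: "J \<in> imag_units" and k: "k \<in> imag_units" "k * J = - (J * k)"
  shows "q = slice_embed J (slice_proj J q) + sided_mult left (slice_embed J (slice_proj J (sided_mult left q (- k)))) k"
proof -
  have kk: "k * k = -1" using k by (simp add: imag_units_def)
  have kk': "k * (k * x) = - x" for x by (simp add: kk flip: mult.assoc)
  have kJk: "k * (J * k) = J" using k(2) by (simp add: kk mult.assoc flip: mult.assoc[of k J k])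
  have kJk': "k * (J * (k * x)) = J * x" for x using arg_cong[OF kJk, of "\<lambda>y. y * x"] by (simp add: mult.assoc)
  have "sided_mult left (slice_embed J (slice_proj J (sided_mult left q (- k)))) k = (1 / 2) *\<^sub>R (q + J * q * J)"
    unfolding slice_embed_slice_proj[OF J]
    by (simp add: sided_mult_def mult.assoc left_diff_distrib right_diff_distrib kk kk' kJk kJk')
  then show ?thesis
    unfolding slice_embed_slice_proj[OF J] by (simp flip: scaleR_add_right)
qed

definition sided_slice_hyperholomorphic :: "bool \<Rightarrow> quat set \<Rightarrow> (quat \<Rightarrow> quat) \<Rightarrow> bool" where
  "sided_slice_hyperholomorphic left U f =
    (if left then slice_hyperholomorphic_left U f else slice_hyperholomorphic_right U f)"

lemma sided_slice_hyperholomorphicE: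
  assumes "sided_slice_hyperholomorphic left U f"
  obtains \<alpha> \<beta> where "open U" "axially_symmetric U" "slice_pair U \<alpha> \<beta>"
    "\<And>u v J. J \<in> imag_units \<Longrightarrow> of_real u + J * of_real v \<in> U \<Longrightarrow>
       f (of_real u + J * of_real v) = \<alpha> (u, v) + sided_mult left J (\<beta> (u, v))"
  using assms unfolding sided_slice_hyperholomorphic_def slice_hyperholomorphic_left_def slice_hyperholomorphic_right_def
    sided_mult_def by (cases left) (simp; blast)+

text \<open>The Cauchy--Riemann equations leave two free partial derivatives, \<open>a = \<partial>\<^sub>u \<alpha> = \<partial>\<^sub>v \<beta>\<close> and
  \<open>b = \<partial>\<^sub>u \<beta> = - \<partial>\<^sub>v \<alpha>\<close>.\<close>

abbreviation CR_re :: "(real \<times> real \<Rightarrow> quat) \<Rightarrow> quat \<Rightarrow> quat \<Rightarrow> real \<times> real \<Rightarrow> bool" where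
  "CR_re \<alpha> a b p \<equiv> (\<alpha> has_derivative (\<lambda>h. fst h *\<^sub>R a - snd h *\<^sub>R b)) (at p)"

abbreviation CR_im :: "(real \<times> real \<Rightarrow> quat) \<Rightarrow> quat \<Rightarrow> quat \<Rightarrow> real \<times> real \<Rightarrow> bool" where
  "CR_im \<beta> a b p \<equiv> (\<beta> has_derivative (\<lambda>h. fst h *\<^sub>R b + snd h *\<^sub>R a)) (at p)"

lemma slice_pair_derivatives:
  assumes p: "slice_pair U \<alpha> \<beta>" and J: "J \<in> imag_units" and uv: "of_real u + J * of_real v \<in> U"
  shows "\<exists>a b. CR_re \<alpha> a b (u, v)
    \<and> CR_im \<beta> a b (u, v) \<and> \<beta> (u, - v) = - \<beta> (u, v)"
proof -
  have *: "\<alpha> differentiable (at (u, v))" "\<beta> differentiable (at (u, v))" "\<beta> (u, - v) = - \<beta> (u, v)"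
    "frechet_derivative \<alpha> (at (u, v)) (1, 0) = frechet_derivative \<beta> (at (u, v)) (0, 1)"
    "frechet_derivative \<alpha> (at (u, v)) (0, 1) = - frechet_derivative \<beta> (at (u, v)) (1, 0)"
    using p J uv unfolding slice_pair_def by blast+
  have lin: "L h = fst h *\<^sub>R L (1, 0) + snd h *\<^sub>R L (0, 1)" if L: "bounded_linear L" for L :: "real \<times> real \<Rightarrow> quat" and h
  proof -
    interpret L: bounded_linear L by fact
    have "h = fst h *\<^sub>R (1, 0) + snd h *\<^sub>R (0, 1)" by (simp add: prod_eq_iff)
    then have "L h = L (fst h *\<^sub>R (1, 0) + snd h *\<^sub>R (0, 1))" by (rule arg_cong)
    then show ?thesis by (simp only: L.add L.scaleR)
  qed
  let ?A = "frechet_derivative \<alpha> (at (u, v))" and ?B = "frechet_derivative \<beta> (at (u, v))"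
  have A: "(\<alpha> has_derivative ?A) (at (u, v))" and B: "(\<beta> has_derivative ?B) (at (u, v))"
    using * by (simp_all add: frechet_derivative_works)
  define a b where "a = ?A (1, 0)" and "b = ?B (1, 0)"
  have "?A h = fst h *\<^sub>R a - snd h *\<^sub>R b" for h
    unfolding a_def b_def
    by (subst lin[OF has_derivative_bounded_linear[OF A]]) (simp only: *(5) scaleR_minus_right diff_conv_add_uminus)
  then have "?A = (\<lambda>h. fst h *\<^sub>R a - snd h *\<^sub>R b)" by (rule ext)
  note A' = A[unfolded this]
  have "?B h = fst h *\<^sub>R b + snd h *\<^sub>R a" for h
    unfolding a_def b_def
    by (subst lin[OF has_derivative_bounded_linear[OF B]]) (simp only: *(4))
  then have "?B = (\<lambda>h. fst h *\<^sub>R b + snd h *\<^sub>R a)" by (rule ext)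
  note B' = B[unfolded this]
  show ?thesis using A' B' *(3) by blast
qed

lemma open_slice: "open U \<Longrightarrow> open (slice J U)"
  unfolding slice_def using open_vimage linear_continuous_on[OF bounded_linear_slice_embed] by blast

text \<open>Under \<open>?L\<close>, multiplication by \<open>J\<close> becomes multiplication by
  \<open>\<i>\<close>, so the Cauchy-Riemann system of the pair turns into complex
  differentiability. The choices \<open>c = 1\<close> and \<open>c = - k\<close> give the two
  components.\<close>

lemma slice_part_holomorphic:
  assumes f: "sided_slice_hyperholomorphic left W f" and J: "J \<in> imag_units"
  shows "(\<lambda>z. slice_proj J (sided_mult left (f (slice_embed J z)) c)) holomorphic_on slice J W"
proof -
  obtain \<alpha> \<beta> where W: "open W" and pair: "slice_pair W \<alpha> \<beta>"
    and f_eq: "\<And>u v J. J \<in> imag_units \<Longrightarrow> of_real u + J * of_real v \<in> W \<Longrightarrow>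
       f (of_real u + J * of_real v) = \<alpha> (u, v) + sided_mult left J (\<beta> (u, v))"
    using sided_slice_hyperholomorphicE[OF f] by metis
  let ?L = "\<lambda>q. slice_proj J (sided_mult left q c)"
  have L: "bounded_linear ?L"
    by (rule bounded_linear_compose[OF bounded_linear_slice_proj pr.bounded_linear_left])
  interpret L: bounded_linear ?L by (rule L)
  have LJ: "?L (sided_mult left J q) = \<i> * ?L q" for q
    by (simp add: sided_mult_assoc slice_proj_unit[OF J])
  let ?\<phi> = "\<lambda>z. \<alpha> (Re z, Im z) + sided_mult left J (\<beta> (Re z, Im z))"
  have "\<exists>D. ((\<lambda>z. ?L (f (slice_embed J z))) has_field_derivative D) (at z)" if z: "z \<in> slice J W" for z
  proof -
    have in_W: "of_real (Re z) + J * of_real (Im z) \<in> W" using z by (simp add: slice_def slice_embed_def)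
    obtain a b where A: "CR_re \<alpha> a b (Re z, Im z)"
      and B: "CR_im \<beta> a b (Re z, Im z)"
      using slice_pair_derivatives[OF pair J in_W] by (elim exE conjE)
    have C: "((\<lambda>z. (Re z, Im z)) has_derivative (\<lambda>h. (Re h, Im h))) (at z)"
      by (intro has_derivative_Pair bounded_linear.has_derivative[OF bounded_linear_Re]
          bounded_linear.has_derivative[OF bounded_linear_Im] has_derivative_ident)
    have A': "((\<lambda>z. \<alpha> (Re z, Im z)) has_derivative (\<lambda>h. Re h *\<^sub>R a - Im h *\<^sub>R b)) (at z)"
      using diff_chain_at[OF C A] by (simp add: o_def)
    have B': "((\<lambda>z. \<beta> (Re z, Im z)) has_derivative (\<lambda>h. Re h *\<^sub>R b + Im h *\<^sub>R a)) (at z)"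
      using diff_chain_at[OF C B] by (simp add: o_def)
    have "((\<lambda>z. ?L (?\<phi> z)) has_derivative (\<lambda>h. ?L ((Re h *\<^sub>R a - Im h *\<^sub>R b) + sided_mult left J (Re h *\<^sub>R b + Im h *\<^sub>R a)))) (at z)"
      by (intro bounded_linear.has_derivative[OF L] has_derivative_add A' bounded_linear.has_derivative[OF pr.bounded_linear_right] B')
    moreover have "?L ((Re h *\<^sub>R a - Im h *\<^sub>R b) + sided_mult left J (Re h *\<^sub>R b + Im h *\<^sub>R a)) = (?L a + \<i> * ?L b) * h" for h
    proof -
      have "?L ((Re h *\<^sub>R a - Im h *\<^sub>R b) + sided_mult left J (Re h *\<^sub>R b + Im h *\<^sub>R a))
          = (Re h *\<^sub>R ?L a - Im h *\<^sub>R ?L b) + \<i> * (Re h *\<^sub>R ?L b + Im h *\<^sub>R ?L a)"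
        by (simp only: L.add L.diff L.scaleR LJ)
      also have "\<dots> = (of_real (Re h) * ?L a - of_real (Im h) * ?L b) + \<i> * (of_real (Re h) * ?L b + of_real (Im h) * ?L a)"
        by (simp only: scaleR_conv_of_real)
      also have "\<dots> = (?L a + \<i> * ?L b) * (of_real (Re h) + \<i> * of_real (Im h))" by (simp add: algebra_simps)
      finally show ?thesis by (metis complex_eq)
    qed
    ultimately have \<phi>: "((\<lambda>z. ?L (?\<phi> z)) has_field_derivative (?L a + \<i> * ?L b)) (at z)"
      by (simp add: has_field_derivative_def)
    have eq: "?L (?\<phi> w) = ?L (f (slice_embed J w))" if "w \<in> slice J W" for w
      using f_eq[OF J, of "Re w" "Im w"] that by (simp add: slice_def slice_embed_def)
    show ?thesis
      using has_field_derivative_transform_within_open[OF \<phi> open_slice[OF W] z eq] by blast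
  qed
  then show ?thesis
    unfolding holomorphic_on_def field_differentiable_def using has_field_derivative_at_within by blast
qed

lemma slice_embed_power: "J \<in> imag_units \<Longrightarrow> slice_embed J (z ^ m) = slice_embed J z ^ m"
  by (induction m) (simp_all add: slice_embed_mult)

lemma slice_part_power_series:
  assumes J: "J \<in> imag_units" and f: "\<And>q. q \<in> ball 0 r \<Longrightarrow> (\<lambda>m. sided_mult left (q ^ m) (a m)) sums f q" and z: "z \<in> ball 0 r"
  shows "(\<lambda>m. slice_proj J (sided_mult left (a m) c) * z ^ m) sums slice_proj J (sided_mult left (f (slice_embed J z)) c)"
proof -
  have L: "bounded_linear (\<lambda>q. slice_proj J (sided_mult left q c))"
    by (rule bounded_linear_compose[OF bounded_linear_slice_proj pr.bounded_linear_left])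
  have "slice_embed J z \<in> ball 0 r" using z norm_slice_embed[OF J] by simp
  from bounded_linear.sums[OF L f[OF this]] show ?thesis
    by (simp add: sided_mult_assoc slice_proj_sided_mult[OF J] mult.commute flip: slice_embed_power[OF J])
qed

section \<open>The kernel of the conjugate Fueter operator\<close>

definition sided_Dbar :: "bool \<Rightarrow> (quat \<Rightarrow> quat) \<Rightarrow> quat \<Rightarrow> quat" where
  "sided_Dbar left f = (if left then Dbar_left f else Dbar_right f)"

lemma sided_Dbar_eq:
  "sided_Dbar left f q = qpartial 1 f q - (sided_mult left qe1 (qpartial qe1 f q)
     + sided_mult left qe2 (qpartial qe2 f q) + sided_mult left qe3 (qpartial qe3 f q))"
  by (simp add: sided_Dbar_def Dbar_left_def Dbar_right_def sided_mult_def)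

text \<open>The chain rule along a line whose plane coordinates move as \<open>c\<close> while its
  imaginary unit turns as \<open>I\<close>; the turning contributes the term with
  \<open>I'\<close>.\<close>

lemma qpartial_slice_function:
  assumes W: "open W"
    and f_eq: "\<And>u v J. J \<in> imag_units \<Longrightarrow> of_real u + J * of_real v \<in> W \<Longrightarrow>
       f (of_real u + J * of_real v) = \<alpha> (u, v) + sided_mult left J (\<beta> (u, v))"
    and q: "q \<in> W" and c0: "c 0 = (u, v)" and I0: "I 0 = J"
    and A: "CR_re \<alpha> a b (u, v)"
    and B: "CR_im \<beta> a b (u, v)"
    and c: "(c has_vector_derivative c') (at 0)" and I: "(I has_vector_derivative I') (at 0)"
    and I_unit: "\<And>t. I t \<in> imag_units"
    and line: "\<And>t. q + t *\<^sub>R e = of_real (fst (c t)) + I t * of_real (snd (c t))"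
  shows "qpartial e f q = (fst c' *\<^sub>R a - snd c' *\<^sub>R b) + (sided_mult left J (fst c' *\<^sub>R b + snd c' *\<^sub>R a) + sided_mult left I' (\<beta> (u, v)))"
    (is "_ = ?D")
proof -
  have A': "((\<lambda>t. \<alpha> (c t)) has_vector_derivative (fst c' *\<^sub>R a - snd c' *\<^sub>R b)) (at 0)"
    using diff_chain_at[OF c[unfolded has_vector_derivative_def], of \<alpha>, unfolded c0, OF A]
    by (simp add: o_def has_vector_derivative_def scaleR_diff_right)
  have B': "((\<lambda>t. \<beta> (c t)) has_vector_derivative (fst c' *\<^sub>R b + snd c' *\<^sub>R a)) (at 0)"
    using diff_chain_at[OF c[unfolded has_vector_derivative_def], of \<beta>, unfolded c0, OF B]
    by (simp add: o_def has_vector_derivative_def scaleR_add_right)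
  have 1: "((\<lambda>t. \<alpha> (c t) + sided_mult left (I t) (\<beta> (c t))) has_vector_derivative ?D) (at 0)"
    using has_vector_derivative_add[OF A' pr.has_vector_derivative[OF I B']]
    by (simp add: c0 I0)
  have 2: "open ((\<lambda>t. q + t *\<^sub>R e) -` W)"
    by (intro open_vimage W continuous_intros)
  have 3: "\<alpha> (c t) + sided_mult left (I t) (\<beta> (c t)) = f (q + t *\<^sub>R e)" if "t \<in> (\<lambda>t. q + t *\<^sub>R e) -` W" for t
    using f_eq[OF I_unit, of "fst (c t)" t "snd (c t)"] that by (simp add: line)
  have "((\<lambda>t. f (q + t *\<^sub>R e)) has_vector_derivative ?D) (at 0)"
    by (rule has_vector_derivative_transform_within_open[OF 1 2 _ 3]) (use q in auto)
  then show ?thesis unfolding qpartial_def by (rule vector_derivative_at)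
qed

text \<open>Points with unit \<open>qe1\<close> or \<open>- qe1\<close> will suffice, since the pair
  depends on \<open>(u, v)\<close> alone. The directions \<open>1\<close> and \<open>qe1\<close>
  stay in the plane of \<open>J\<close>; the other two turn the unit at rate \<open>1 / v\<close>,
  and each contributes \<open>(1 / v) *\<^sub>R \<beta> (u, v)\<close>.\<close>

lemma sided_Dbar_on_axis:
  assumes W: "open W"
    and f_eq: "\<And>u v J. J \<in> imag_units \<Longrightarrow> of_real u + J * of_real v \<in> W \<Longrightarrow>
       f (of_real u + J * of_real v) = \<alpha> (u, v) + sided_mult left J (\<beta> (u, v))"
    and q: "of_real u + J * of_real v \<in> W" and J: "J = s *\<^sub>R qe1" and s: "s * s = 1" and v: "v \<noteq> 0"
    and A: "CR_re \<alpha> a b (u, v)"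
    and B: "CR_im \<beta> a b (u, v)"
  shows "sided_Dbar left f (of_real u + J * of_real v) = 2 *\<^sub>R a + 2 *\<^sub>R sided_mult left J b + (2 / v) *\<^sub>R \<beta> (u, v)"
proof -
  let ?q = "of_real u + J * of_real v"
  note P = qpartial_slice_function[OF W f_eq q _ _ A B]
  have unit: "J \<in> imag_units"
    using s by (simp add: J imag_units_iff norm_eq_sqrt_inner inner_quat_def scaleR_quat_def)
  have e1: "qe1 = s *\<^sub>R J" using s by (simp add: J)
  have p0: "qpartial 1 f ?q = (fst (1::real, 0::real) *\<^sub>R a - snd (1::real, 0::real) *\<^sub>R b)
      + (sided_mult left J (fst (1::real, 0::real) *\<^sub>R b + snd (1::real, 0::real) *\<^sub>R a) + sided_mult left 0 (\<beta> (u, v)))"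
  proof (rule P[where c = "\<lambda>t. (u + t, v)" and I = "\<lambda>t. J"])
    show "((\<lambda>t. (u + t, v)) has_vector_derivative (1, 0)) (at 0)"
      by (intro has_vector_derivative_Pair) (auto intro!: derivative_eq_intros)
  qed (use unit in \<open>simp_all add: of_real_def\<close>, simp add: algebra_simps)
  have p1: "qpartial qe1 f ?q = (fst (0::real, s) *\<^sub>R a - snd (0::real, s) *\<^sub>R b)
      + (sided_mult left J (fst (0::real, s) *\<^sub>R b + snd (0::real, s) *\<^sub>R a) + sided_mult left 0 (\<beta> (u, v)))"
  proof (rule P[where c = "\<lambda>t. (u, v + s * t)" and I = "\<lambda>t. J"])
    show "((\<lambda>t. (u, v + s * t)) has_vector_derivative (0, s)) (at 0)"
      by (intro has_vector_derivative_Pair) (auto intro!: derivative_eq_intros)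
    show "?q + t *\<^sub>R qe1 = of_real (fst (u, v + s * t)) + J * of_real (snd (u, v + s * t))" for t
      using e1 by (simp add: of_real_def algebra_simps)
  qed (use unit in simp_all)
  have p2: "qpartial e f ?q = (fst (0::real, 0::real) *\<^sub>R a - snd (0::real, 0::real) *\<^sub>R b)
      + (sided_mult left J (fst (0::real, 0::real) *\<^sub>R b + snd (0::real, 0::real) *\<^sub>R a) + sided_mult left ((1 / v) *\<^sub>R e) (\<beta> (u, v)))"
    if e: "e = qe2 \<or> e = qe3" for e
  proof -
    \<comment> \<open>The distance to the real axis along the line, with the sign of
      \<open>v\<close> so that \<open>w 0 = v\<close>. Its derivative at 0 vanishes: to first order
      only the unit changes.\<close>
    define w where "w t = sgn v * sqrt (v\<^sup>2 + t\<^sup>2)" for t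
    have w0: "w 0 = v" by (simp add: w_def sgn_mult_abs)
    have pos: "0 < v\<^sup>2 + t\<^sup>2" for t using v by (simp add: add_pos_nonneg)
    have w_nz: "w t \<noteq> 0" for t using v pos[of t] by (simp add: w_def sgn_zero_iff)
    have w_sq: "(w t)\<^sup>2 = v\<^sup>2 + t\<^sup>2" for t using v pos[of t] by (simp add: w_def power_mult_distrib sgn_if)
    have w': "(w has_real_derivative 0) (at 0)"
      unfolding w_def[abs_def] using v by (auto intro!: derivative_eq_intros)
    have iw': "((\<lambda>t. inverse (w t)) has_vector_derivative 0) (at 0)"
      using DERIV_inverse_fun[OF w' w_nz] by (simp add: has_real_derivative_iff_has_vector_derivative)
    show ?thesis
    proof (rule P[where c = "\<lambda>t. (u, w t)" and I = "\<lambda>t. inverse (w t) *\<^sub>R (v *\<^sub>R J + t *\<^sub>R e)"])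
      show "((\<lambda>t. (u, w t)) has_vector_derivative (0, 0)) (at 0)"
        using w' by (intro has_vector_derivative_Pair) (auto simp: has_real_derivative_iff_has_vector_derivative)
      have "((\<lambda>t. v *\<^sub>R J + t *\<^sub>R e) has_vector_derivative e) (at 0)"
        by (auto intro!: derivative_eq_intros)
      from bounded_bilinear.has_vector_derivative[OF bounded_bilinear_scaleR iw' this]
      show "((\<lambda>t. inverse (w t) *\<^sub>R (v *\<^sub>R J + t *\<^sub>R e)) has_vector_derivative (1 / v) *\<^sub>R e) (at 0)"
        by (simp add: w0 divide_inverse)
      fix t
      have "inner (v *\<^sub>R J + t *\<^sub>R e) (v *\<^sub>R J + t *\<^sub>R e) = (s * s) * (v * v) + t * t" "qc0 (v *\<^sub>R J + t *\<^sub>R e) = 0"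
        using e by (auto simp: J inner_quat_def plus_quat_def scaleR_quat_def algebra_simps)
      then have "inner (v *\<^sub>R J + t *\<^sub>R e) (v *\<^sub>R J + t *\<^sub>R e) = (w t)\<^sup>2" "qc0 (v *\<^sub>R J + t *\<^sub>R e) = 0"
        unfolding w_sq s by (simp_all add: power2_eq_square)
      then have nq: "norm (v *\<^sub>R J + t *\<^sub>R e) = \<bar>w t\<bar>" "qc0 (v *\<^sub>R J + t *\<^sub>R e) = 0"
        by (simp_all add: norm_eq_sqrt_inner)
      show "inverse (w t) *\<^sub>R (v *\<^sub>R J + t *\<^sub>R e) \<in> imag_units"
      proof -
        have "qc0 (inverse (w t) *\<^sub>R x) = inverse (w t) * qc0 x" for x by (simp add: scaleR_quat_def)
        with w_nz[of t] nq show ?thesis by (simp add: imag_units_iff)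
      qed
      show "?q + t *\<^sub>R e = of_real (fst (u, w t)) + inverse (w t) *\<^sub>R (v *\<^sub>R J + t *\<^sub>R e) * of_real (snd (u, w t))"
        using w_nz[of t] by (simp add: of_real_def)
    qed (use v w0 in simp_all)
  qed
  have ee: "sided_mult left e (sided_mult left ((1 / v) *\<^sub>R e) x) = - (1 / v) *\<^sub>R x" if "e = qe2 \<or> e = qe3" for e x
  proof -
    have "e \<in> imag_units" using that by (auto simp: imag_units_iff norm_eq_sqrt_inner inner_quat_def)
    then show ?thesis by (simp add: pr.scaleR_left pr.scaleR_right sided_mult_unit)
  qed
  have m1: "sided_mult left qe1 x = s *\<^sub>R sided_mult left J x" for x
    by (subst e1) (simp add: pr.scaleR_left)
  have "sided_mult left qe1 (qpartial qe1 f ?q) = - sided_mult left J b - a"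
    unfolding m1 p1 using s
    by (simp add: pr.scaleR_left pr.scaleR_right pr.add_right pr.diff_right pr.minus_right pr.zero_left sided_mult_unit[OF unit] scaleR_diff_right scaleR_add_right)
  moreover have "sided_mult left qe2 (qpartial qe2 f ?q) = - (1 / v) *\<^sub>R \<beta> (u, v)"
    "sided_mult left qe3 (qpartial qe3 f ?q) = - (1 / v) *\<^sub>R \<beta> (u, v)"
    using p2[of qe2] p2[of qe3] ee[of qe2 "\<beta> (u, v)"] ee[of qe3 "\<beta> (u, v)"] by (simp_all add: pr.zero_right)
  moreover have "qpartial 1 f ?q = a + sided_mult left J b"
    using p0 by (simp add: pr.zero_left)
  ultimately have "sided_Dbar left f ?q = (a + sided_mult left J b) - ((- sided_mult left J b - a) + - (1 / v) *\<^sub>R \<beta> (u, v) + - (1 / v) *\<^sub>R \<beta> (u, v))"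
    by (simp only: sided_Dbar_eq)
  also have "\<dots> = 2 *\<^sub>R a + 2 *\<^sub>R sided_mult left J b + (2 * (1 / v)) *\<^sub>R \<beta> (u, v)"
    unfolding scaleR_scaleR[symmetric] scaleR_2 by simp
  finally show ?thesis by simp
qed

lemma quat_in_slice: "\<exists>u v. \<exists>J\<in>imag_units. q = of_real u + J * of_real v"
proof -
  define p where "p = Quat 0 (qc1 q) (qc2 q) (qc3 q)"
  have q: "q = of_real (qc0 q) + p" by (simp add: p_def of_real_def quat_eq_iff quat_arith_defs)
  show ?thesis
  proof (cases "p = 0")
    case True
    have "qe1 \<in> imag_units" by (simp add: imag_units_iff norm_eq_sqrt_inner inner_quat_def)
    then show ?thesis using q True by (intro exI[of _ "qc0 q"] exI[of _ 0] bexI[of _ qe1]) simp_all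
  next
    case False
    then have "norm (sgn p) = 1" by (simp add: norm_sgn)
    moreover have "qc0 (sgn p) = 0" by (simp add: sgn_div_norm scaleR_quat_def p_def)
    ultimately have "sgn p \<in> imag_units" by (simp add: imag_units_iff)
    moreover have "p = sgn p * of_real (norm p)" using False by (simp add: sgn_div_norm of_real_def)
    ultimately show ?thesis using q by (intro exI[of _ "qc0 q"] exI[of _ "norm p"] bexI[of _ "sgn p"]) simp_all
  qed
qed

lemma norm_slice_point: "J \<in> imag_units \<Longrightarrow> norm (of_real u + J * of_real v) = norm (u, v)"
  using norm_slice_embed[of J "Complex u v"] by (simp add: slice_embed_def cmod_def norm_Pair)

text \<open>For the differences \<open>\<alpha>\<close> and \<open>\<beta>\<close> of the two pairs,
  the formula for the operator forces \<open>b = 0\<close> and \<open>v a + \<beta> = 0\<close> off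
  the real axis. Hence \<open>v \<beta>\<close> has zero derivative and equals its value 0 at the
  origin; so \<open>\<beta>\<close> vanishes, and then \<open>\<alpha>\<close> is constant.\<close>

lemma sided_Dbar_eq_imp_diff_const:
  assumes f: "sided_slice_hyperholomorphic left W f" and g: "sided_slice_hyperholomorphic left W g"
    and ball: "ball 0 r \<subseteq> W" and D: "\<And>q. q \<in> ball 0 r \<Longrightarrow> sided_Dbar left f q = sided_Dbar left g q"
  shows "\<exists>c. \<forall>q\<in>ball 0 r. g q = f q + c"
proof -
  obtain \<alpha>1 \<beta>1 where W: "open W" and pair1: "slice_pair W \<alpha>1 \<beta>1"
    and f_eq: "\<And>u v J. J \<in> imag_units \<Longrightarrow> of_real u + J * of_real v \<in> W \<Longrightarrow>
       f (of_real u + J * of_real v) = \<alpha>1 (u, v) + sided_mult left J (\<beta>1 (u, v))"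
    by (rule sided_slice_hyperholomorphicE[OF f]) blast
  obtain \<alpha>2 \<beta>2 where pair2: "slice_pair W \<alpha>2 \<beta>2"
    and g_eq: "\<And>u v J. J \<in> imag_units \<Longrightarrow> of_real u + J * of_real v \<in> W \<Longrightarrow>
       g (of_real u + J * of_real v) = \<alpha>2 (u, v) + sided_mult left J (\<beta>2 (u, v))"
    by (rule sided_slice_hyperholomorphicE[OF g]) blast
  define \<alpha> where "\<alpha> p = \<alpha>2 p - \<alpha>1 p" for p
  define \<beta> where "\<beta> p = \<beta>2 p - \<beta>1 p" for p
  let ?B = "ball 0 r :: (real \<times> real) set"
  have in_W: "of_real u + J * of_real v \<in> ball 0 r" if "(u, v) \<in> ?B" "J \<in> imag_units" for u v J
    using that norm_slice_point[of J u v] by simp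
  have unit1: "qe1 \<in> imag_units" "- qe1 \<in> imag_units"
    by (simp_all add: imag_units_iff norm_eq_sqrt_inner inner_quat_def uminus_quat_def)
  have deriv: "\<exists>a b. CR_re \<alpha> a b (u, v)
      \<and> CR_im \<beta> a b (u, v) \<and> \<beta> (u, - v) = - \<beta> (u, v)
      \<and> (v \<noteq> 0 \<longrightarrow> b = 0 \<and> v *\<^sub>R a + \<beta> (u, v) = 0)" if uv: "(u, v) \<in> ?B" for u v
  proof -
    have w1: "of_real u + qe1 * of_real v \<in> W" using in_W[OF uv unit1(1)] ball by blast
    have w2: "of_real u + (- qe1) * of_real v \<in> W" using in_W[OF uv unit1(2)] ball by blast
    obtain a1 b1 where A1: "CR_re \<alpha>1 a1 b1 (u, v)"
      and B1: "CR_im \<beta>1 a1 b1 (u, v)" and odd1: "\<beta>1 (u, - v) = - \<beta>1 (u, v)"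
      using slice_pair_derivatives[OF pair1 unit1(1) w1] by (elim exE conjE)
    obtain a2 b2 where A2: "CR_re \<alpha>2 a2 b2 (u, v)"
      and B2: "CR_im \<beta>2 a2 b2 (u, v)" and odd2: "\<beta>2 (u, - v) = - \<beta>2 (u, v)"
      using slice_pair_derivatives[OF pair2 unit1(1) w1] by (elim exE conjE)
    define a b where "a = a2 - a1" and "b = b2 - b1"
    have "CR_re \<alpha> a b (u, v)"
      unfolding \<alpha>_def[abs_def] a_def b_def using has_derivative_diff[OF A2 A1] by (simp add: algebra_simps)
    moreover have "CR_im \<beta> a b (u, v)"
      unfolding \<beta>_def[abs_def] a_def b_def using has_derivative_diff[OF B2 B1] by (simp add: algebra_simps)
    moreover have "\<beta> (u, - v) = - \<beta> (u, v)" by (simp add: \<beta>_def odd1 odd2)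
    moreover have "b = 0 \<and> v *\<^sub>R a + \<beta> (u, v) = 0" if v: "v \<noteq> 0"
    proof -
      have zero: "2 *\<^sub>R a + 2 *\<^sub>R sided_mult left (s *\<^sub>R qe1) b + (2 / v) *\<^sub>R \<beta> (u, v) = 0" if s: "s = 1 \<or> s = -1" for s :: real
      proof -
        have su: "s *\<^sub>R qe1 \<in> imag_units" using s unit1 by auto
        have ss: "s * s = 1" using s by auto
        have inb: "of_real u + (s *\<^sub>R qe1) * of_real v \<in> ball 0 r" by (rule in_W[OF uv su])
        have inw: "of_real u + (s *\<^sub>R qe1) * of_real v \<in> W" using inb ball by blast
        have "2 *\<^sub>R a1 + 2 *\<^sub>R sided_mult left (s *\<^sub>R qe1) b1 + (2 / v) *\<^sub>R \<beta>1 (u, v)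
            = 2 *\<^sub>R a2 + 2 *\<^sub>R sided_mult left (s *\<^sub>R qe1) b2 + (2 / v) *\<^sub>R \<beta>2 (u, v)"
          using D[OF inb] sided_Dbar_on_axis[where f = f, OF W f_eq inw refl ss v A1 B1] sided_Dbar_on_axis[where f = g, OF W g_eq inw refl ss v A2 B2]
          by simp
        then show ?thesis unfolding a_def b_def \<beta>_def pr.diff_right scaleR_diff_right by (simp add: algebra_simps)
      qed
      \<comment> \<open>The equations for \<open>qe1\<close> and \<open>- qe1\<close> differ only in
        the sign of this term, so their difference isolates it.\<close>
      let ?m = "sided_mult left qe1 b"
      have plus: "2 *\<^sub>R a + 2 *\<^sub>R ?m + (2 / v) *\<^sub>R \<beta> (u, v) = 0" using zero[of 1] by simp
      have minus: "2 *\<^sub>R a - 2 *\<^sub>R ?m + (2 / v) *\<^sub>R \<beta> (u, v) = 0" using zero[of "-1"] by (simp add: pr.minus_left)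
      have "4 *\<^sub>R ?m = (2 *\<^sub>R a + 2 *\<^sub>R ?m + (2 / v) *\<^sub>R \<beta> (u, v)) - (2 *\<^sub>R a - 2 *\<^sub>R ?m + (2 / v) *\<^sub>R \<beta> (u, v))"
        by (simp flip: scaleR_add_left)
      then have m: "?m = 0" unfolding plus minus by simp
      then have "b = 0" using sided_mult_unit[OF unit1(1), of left b] by (simp add: pr.zero_right)
      moreover have "v *\<^sub>R a + \<beta> (u, v) = (v / 2) *\<^sub>R (2 *\<^sub>R a + 2 *\<^sub>R ?m + (2 / v) *\<^sub>R \<beta> (u, v))"
        unfolding m using v by (simp add: scaleR_add_right)
      then have "v *\<^sub>R a + \<beta> (u, v) = 0" unfolding plus by simp
      ultimately show ?thesis by blast
    qed
    ultimately show ?thesis by blast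
  qed
  have "\<exists>c. \<forall>p\<in>?B. snd p *\<^sub>R \<beta> p = c"
  proof (rule has_derivative_zero_constant)
    fix p assume p: "p \<in> ?B"
    obtain u v where p_eq: "p = (u, v)" by (cases p)
    obtain a b where B: "CR_im \<beta> a b (u, v)"
      and odd: "\<beta> (u, - v) = - \<beta> (u, v)" and z: "v \<noteq> 0 \<longrightarrow> b = 0 \<and> v *\<^sub>R a + \<beta> (u, v) = 0"
      using deriv[OF p[unfolded p_eq]] by (elim exE conjE)
    have "((\<lambda>p. snd p *\<^sub>R \<beta> p) has_derivative (\<lambda>h. v *\<^sub>R (fst h *\<^sub>R b + snd h *\<^sub>R a) + snd h *\<^sub>R \<beta> (u, v))) (at (u, v))"
      using has_derivative_scaleR[OF bounded_linear_imp_has_derivative[OF bounded_linear_snd] B] by simp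
    moreover have "v *\<^sub>R (fst h *\<^sub>R b + snd h *\<^sub>R a) + snd h *\<^sub>R \<beta> (u, v) = 0" for h :: "real \<times> real"
    proof (cases "v = 0")
      case True
      \<comment> \<open>On the real axis \<open>\<beta>\<close> vanishes by oddness.\<close>
      then have "2 *\<^sub>R \<beta> (u, v) = 0" using odd by (simp add: scaleR_2 eq_neg_iff_add_eq_0)
      then show ?thesis using True by simp
    next
      case False
      then have zz: "b = 0" "v *\<^sub>R a + \<beta> (u, v) = 0" using z by simp_all
      have "v *\<^sub>R (fst h *\<^sub>R b + snd h *\<^sub>R a) + snd h *\<^sub>R \<beta> (u, v) = snd h *\<^sub>R (v *\<^sub>R a + \<beta> (u, v))"
        by (simp add: zz(1) scaleR_add_right mult.commute)
      then show ?thesis by (simp only: zz(2) scaleR_zero_right)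
    qed
    ultimately have "((\<lambda>p. snd p *\<^sub>R \<beta> p) has_derivative (\<lambda>h. 0)) (at p)" by (simp add: p_eq)
    then show "((\<lambda>p. snd p *\<^sub>R \<beta> p) has_derivative (\<lambda>h. 0)) (at p within ?B)" by (rule has_derivative_at_withinI)
  qed (rule convex_ball)
  then obtain c0 where c0: "\<And>p. p \<in> ?B \<Longrightarrow> snd p *\<^sub>R \<beta> p = c0" by blast
  have \<beta>0: "\<beta> p = 0" if p: "p \<in> ?B" for p
  proof -
    obtain u v where p_eq: "p = (u, v)" by (cases p)
    have "norm p < r" using p by simp
    then have "0 < r" by (rule le_less_trans[OF norm_ge_zero])
    then have "(0, 0) \<in> ?B" by (simp flip: zero_prod_def)
    then have "c0 = 0" using c0[of "(0, 0)"] by simp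
    moreover have "\<beta> (u, v) = 0" if "v = 0"
    proof -
      have "\<beta> (u, - v) = - \<beta> (u, v)" using deriv[OF p[unfolded p_eq]] by (elim exE conjE)
      then have "2 *\<^sub>R \<beta> (u, v) = 0" using that by (simp add: scaleR_2 eq_neg_iff_add_eq_0)
      then show ?thesis by simp
    qed
    ultimately show ?thesis using c0[OF p] by (cases "v = 0") (simp_all add: p_eq)
  qed
  have "\<exists>c. \<forall>p\<in>?B. \<alpha> p = c"
  proof (rule has_derivative_zero_constant)
    fix p assume p: "p \<in> ?B"
    obtain u v where p_eq: "p = (u, v)" by (cases p)
    obtain a b where A: "CR_re \<alpha> a b (u, v)"
      and B: "CR_im \<beta> a b (u, v)"
      using deriv[OF p[unfolded p_eq]] by (elim exE conjE)
    have "(\<beta> has_derivative (\<lambda>h. 0)) (at (u, v))"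
      by (rule has_derivative_transform_within_open[OF has_derivative_const[of 0] open_ball p[unfolded p_eq]]) (simp add: \<beta>0)
    \<comment> \<open>The derivatives of \<open>\<alpha>\<close> and \<open>\<beta>\<close> share
      the coefficients \<open>a\<close> and \<open>b\<close>, so a vanishing \<open>\<beta>\<close>
      makes \<open>\<alpha>\<close> stationary.\<close>
    then have eq: "(\<lambda>h. fst h *\<^sub>R b + snd h *\<^sub>R a) = (\<lambda>h. 0)" by (rule has_derivative_unique[OF B])
    have "b = 0" "a = 0" using fun_cong[OF eq, of "(1, 0)"] fun_cong[OF eq, of "(0, 1)"] by simp_all
    then have "(\<alpha> has_derivative (\<lambda>h. 0)) (at p)" using A by (simp add: p_eq)
    then show "(\<alpha> has_derivative (\<lambda>h. 0)) (at p within ?B)" by (rule has_derivative_at_withinI)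
  qed (rule convex_ball)
  then obtain c where c: "\<And>p. p \<in> ?B \<Longrightarrow> \<alpha> p = c" by blast
  have "g q = f q + c" if q: "q \<in> ball 0 r" for q
  proof -
    obtain u v J where J: "J \<in> imag_units" and q_eq: "q = of_real u + J * of_real v" using quat_in_slice[of q] by blast
    have "(u, v) \<in> ?B" using q norm_slice_point[OF J, of u v] by (simp add: q_eq)
    then have "\<alpha>2 (u, v) - \<alpha>1 (u, v) = c" "\<beta>2 (u, v) = \<beta>1 (u, v)" using c \<beta>0 by (auto simp: \<alpha>_def \<beta>_def)
    moreover have "q \<in> W" using q ball by blast
    ultimately show ?thesis using f_eq[OF J, of u v] g_eq[OF J, of u v] by (simp add: q_eq algebra_simps)
  qed
  then show ?thesis by blast
qed

section \<open>The value of the calculus\<close>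

lemma axially_symmetric_ball: "axially_symmetric (ball 0 \<rho>)"
  unfolding axially_symmetric_def by (simp add: norm_slice_point)

lemma slice_ball: "J \<in> imag_units \<Longrightarrow> slice J (ball 0 \<rho>) = ball 0 \<rho>"
  unfolding slice_def by (auto simp: norm_slice_embed)

lemma positively_oriented_circle:
  assumes "0 < \<rho>"
  shows "positively_oriented_boundary (ball 0 \<rho>) {circlepath 0 \<rho>}"
proof -
  have "winding_number (circlepath 0 \<rho>) z = (if z \<in> ball 0 \<rho> then 1 else 0)" if z: "norm z \<noteq> \<rho>" for z
  proof (cases "norm z < \<rho>")
    case True
    then show ?thesis using winding_number_circlepath[of z 0 \<rho>] by simp
  next
    case False
    have "winding_number (circlepath 0 \<rho>) z = 0"
      by (rule winding_number_zero_outside[of _ "cball 0 \<rho>"]) (use z False assms in \<open>auto simp: valid_path_imp_path\<close>)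
    then show ?thesis using False by simp
  qed
  then show ?thesis
    using assms by (simp add: positively_oriented_boundary_def Jordan_boundary_def simple_path_circlepath)
qed

context paravector_operator
begin

text \<open>The value predicates demand that admissible data exist; a ball of radius strictly
  between the extent of the spectrum and \<open>r\<close> supplies them.\<close>

lemma exists_admissible_contour:
  assumes r: "0 < r" and spec: "S_spectrum T \<subseteq> ball 0 r" and W: "ball 0 r \<subseteq> W"
  shows "\<exists>J U G. admissible_contour T W J U G"
proof -
  have "closed (S_spectrum T)"
    unfolding S_spectrum_def using open_S_resolvent_set[OF BX_T] by (simp add: closed_def)
  moreover have "bounded (S_spectrum T)" by (rule bounded_subset[OF bounded_ball spec])
  ultimately have "compact (S_spectrum T)" by (simp add: compact_eq_bounded_closed)
  from compact_subset_smaller_cball[OF this spec r]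
  obtain s where s: "0 \<le> s" "s < r" "S_spectrum T \<subseteq> cball 0 s" by blast
  define \<rho> where "\<rho> = (s + r) / 2"
  have \<rho>: "0 < \<rho>" "s < \<rho>" "\<rho> < r" using s by (auto simp: \<rho>_def)
  have e1: "qe1 \<in> imag_units" by (simp add: imag_units_iff norm_eq_sqrt_inner inner_quat_def)
  have pos: "positively_oriented_boundary (slice J (ball 0 \<rho>)) {circlepath 0 \<rho>}" if "J \<in> imag_units" for J
    unfolding slice_ball[OF that] by (rule positively_oriented_circle[OF \<rho>(1)])
  then have "Jordan_boundary (slice J (ball 0 \<rho>)) {circlepath 0 \<rho>}" if "J \<in> imag_units" for J
    using that by (simp add: positively_oriented_boundary_def)
  then have "slice_Cauchy_domain (ball 0 \<rho>)"
    unfolding slice_Cauchy_domain_def using axially_symmetric_ball by auto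
  moreover have "S_spectrum T \<subseteq> ball 0 \<rho>" using s(3) \<rho>(2) by (auto simp: subset_eq)
  moreover have "closure (ball 0 \<rho>) \<subseteq> W" using W \<rho> by (simp add: subset_eq)
  ultimately have "admissible_contour T W qe1 (ball 0 \<rho>) {circlepath 0 \<rho>}"
    unfolding admissible_contour_def using e1 pos[OF e1] by simp
  then show ?thesis by blast
qed

definition sided_integrand :: "bool \<Rightarrow> (quat \<Rightarrow> quat) \<Rightarrow> quat \<Rightarrow> (real \<Rightarrow> complex) \<Rightarrow> real \<Rightarrow> 'a hop" where
  "sided_integrand left f J = (if left then P2_integrand_left T f J else P2_integrand_right T f J)"

text \<open>Here \<open>f\<close> carries the power series and \<open>g\<close> is any function with
  the same image under the operator. On \<open>W\<close>, which may be disconnected,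
  \<open>g - f\<close> is controlled only on the ball; that is enough, because the contour is moved
  there.\<close>

lemma P2_calculus:
  assumes f: "sided_slice_hyperholomorphic left W f" and g: "sided_slice_hyperholomorphic left W g"
    and r: "0 < r" and spec: "S_spectrum T \<subseteq> ball 0 r" and ball: "ball 0 r \<subseteq> W"
    and f_sums: "\<And>q. q \<in> ball 0 r \<Longrightarrow> (\<lambda>m. sided_mult left (q ^ m) (a m)) sums f q"
    and D: "\<And>q. q \<in> W \<Longrightarrow> sided_Dbar left f q = sided_Dbar left g q"
    and adm: "admissible_contour T W J U G"
  shows "\<And>\<gamma>. \<gamma> \<in> G \<Longrightarrow> sided_integrand left g J \<gamma> integrable_on {0..1}"
    and "(\<lambda>m. 2 *\<^sub>R sided_act left (a (Suc m)) (P2_power T (Suc m))) sums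
      ((1 / (2 * pi)) *\<^sub>R (\<Sum>\<gamma>\<in>G. integral {0..1} (sided_integrand left g J \<gamma>)))"
proof -
  have J: "J \<in> imag_units" and U: "open U" "S_spectrum T \<subseteq> U" "closure U \<subseteq> W"
    and G: "Jordan_boundary (slice J U) G"
    and wn: "\<And>z. z \<notin> frontier (slice J U) \<Longrightarrow> (\<Sum>\<gamma>\<in>G. winding_number \<gamma> z) = (if z \<in> slice J U then 1 else 0)"
    using adm unfolding admissible_contour_def slice_Cauchy_domain_def positively_oriented_boundary_def by auto
  interpret slc: paravector_slice T0 T1 T2 J left r
    by unfold_locales (use J spec in auto)
  have W: "open W" using f by (rule sided_slice_hyperholomorphicE)
  obtain c where c: "\<And>q. q \<in> ball 0 r \<Longrightarrow> g q = f q + c"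
    using sided_Dbar_eq_imp_diff_const[OF f g ball] D ball by blast
  \<comment> \<open>The constant is absorbed into the coefficient of order 0, whose term in the
    calculus vanishes.\<close>
  define b where "b = a(0 := a 0 + c)"
  have g_sums: "(\<lambda>m. sided_mult left (q ^ m) (b m)) sums g q" if q: "q \<in> ball 0 r" for q
  proof -
    have "(\<lambda>m. if m = 0 then c else 0) sums c" by (rule sums_single)
    from sums_add[OF f_sums[OF q] this] have "(\<lambda>m. sided_mult left (q ^ m) (a m) + (if m = 0 then c else 0)) sums g q"
      by (simp add: c[OF q])
    moreover have "sided_mult left (q ^ m) (a m) + (if m = 0 then c else 0) = sided_mult left (q ^ m) (b m)" for m
      by (simp add: b_def sided_mult_def algebra_simps)
    ultimately show ?thesis by simp
  qed
  obtain k where k: "k \<in> imag_units" "k * J = - (J * k)" using exists_orthogonal_imag_unit[OF J] by blast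
  have open_sU: "open (slice J U)" by (rule open_slice[OF U(1)])
  have K_U: "slc.K \<subseteq> slice J U" using U(2) by (auto simp: slc.K_def slice_def)
  have cl: "closure (slice J U) \<subseteq> slice J W"
  proof -
    have "closed (slice J (closure U))"
      unfolding slice_def by (intro closed_vimage closed_closure linear_continuous_on bounded_linear_slice_embed)
    moreover have "slice J U \<subseteq> slice J (closure U)" using closure_subset by (auto simp: slice_def)
    ultimately have "closure (slice J U) \<subseteq> slice J (closure U)" by (rule closure_minimal[rotated])
    also have "\<dots> \<subseteq> slice J W" using U(3) by (auto simp: slice_def)
    finally show ?thesis .
  qed
  \<comment> \<open>The contour lies on this frontier, so it avoids the open slice of
    \<open>U\<close>, and with it \<open>K\<close>, but stays in the slice of
    \<open>W\<close>.\<close>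
  have fr: "frontier (slice J U) \<subseteq> slice J W - slice J U"
    using cl open_sU by (auto simp: frontier_def interior_open)
  let ?h = "\<lambda>d z. slice_proj J (sided_mult left (g (slice_embed J z)) d)"
  let ?c = "\<lambda>d m. slice_proj J (sided_mult left (b m) d)"
  have one: "sided_mult left x 1 = x" for x by (simp add: sided_mult_def)
  have "ball 0 r \<subseteq> slice J W" using ball slice_ball[OF J, of r] by (auto simp: slice_def)
  note calc = slc.calculus_sided[where f = g and a = b and k = k, OF open_slice[OF W] r this
      slice_part_holomorphic[OF g J, of 1] slice_part_power_series[OF J g_sums, of r _ 1]
      slice_part_holomorphic[OF g J, of "- k"] slice_part_power_series[OF J g_sums, of r _ "- k"]]
  have decomp: "q = slice_embed J (slice_proj J (sided_mult left q 1)) + sided_mult left (slice_embed J (slice_proj J (sided_mult left q (- k)))) k" for q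
    unfolding one by (rule slice_decomposition[OF J k])
  have encl: "encircles G slc.K (slice J W)"
    unfolding encircles_def
  proof (intro conjI ballI allI impI)
    fix z assume "z \<in> slc.K"
    then have "z \<notin> frontier (slice J U)" "z \<in> slice J U" using K_U fr by blast+
    then show "(\<Sum>\<gamma>\<in>G. winding_number \<gamma> z) = 1" using wn[of z] by simp
  next
    fix z assume "z \<notin> slice J W"
    then have "z \<notin> frontier (slice J U)" "z \<notin> slice J U"
      using fr cl closure_subset[of "slice J U"] by blast+
    then show "(\<Sum>\<gamma>\<in>G. winding_number \<gamma> z) = 0" using wn[of z] by simp
  qed (use G fr K_U in \<open>auto 0 3 simp: Jordan_boundary_def\<close>)
  have integrand: "sided_integrand left g J \<gamma> =
      (\<lambda>t. sided_act left (g (slice_embed J (\<gamma> t))) (sided_act left (ds_slice J \<gamma> t) (slc.P2 (slice_embed J (\<gamma> t)))))" for \<gamma>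
    by (simp add: fun_eq_iff sided_integrand_def sided_act_def slc.P2_def P2_integrand_left_def P2_integrand_right_def blinfun_compose_assoc)
  show "sided_integrand left g J \<gamma> integrable_on {0..1}" if \<gamma>G: "\<gamma> \<in> G" for \<gamma>
    unfolding integrand
    by (rule calc(1)) (assumption | rule \<gamma>G encl decomp)+
  have "(\<lambda>m. 2 *\<^sub>R sided_act left (b m) (P2_power T m)) sums
      ((1 / (2 * pi)) *\<^sub>R (\<Sum>\<gamma>\<in>G. integral {0..1} (sided_integrand left g J \<gamma>)))"
    unfolding integrand
    by (rule calc(2)) (assumption | rule encl decomp)+
  \<comment> \<open>\<open>P2_power T 0\<close> has a zero factor in front of its power and an empty
    sum; this justifies starting the series at order 1.\<close>
  moreover have "2 *\<^sub>R sided_act left (b 0) (P2_power T 0) = 0"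
    by (simp add: P2_power_def sided_act_def)
  ultimately have "(\<lambda>m. 2 *\<^sub>R sided_act left (b (Suc m)) (P2_power T (Suc m))) sums
      ((1 / (2 * pi)) *\<^sub>R (\<Sum>\<gamma>\<in>G. integral {0..1} (sided_integrand left g J \<gamma>)))"
    using sums_Suc_iff[of "\<lambda>m. 2 *\<^sub>R sided_act left (b m) (P2_power T m)"] by (simp only: add_0_right)
  then show "(\<lambda>m. 2 *\<^sub>R sided_act left (a (Suc m)) (P2_power T (Suc m))) sums
      ((1 / (2 * pi)) *\<^sub>R (\<Sum>\<gamma>\<in>G. integral {0..1} (sided_integrand left g J \<gamma>)))"
    by (simp add: b_def)
qed

text \<open>Summability is read off from one existing contour. Independence of all admissible data
  holds because \<open>P2_calculus\<close> gives the same series for each choice.\<close>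

lemma P2_value_sided:
  assumes f: "sided_slice_hyperholomorphic left W f"
    and r: "0 < r" and spec: "S_spectrum T \<subseteq> ball 0 r" and ball: "ball 0 r \<subseteq> W"
    and f_sums: "\<And>q. q \<in> ball 0 r \<Longrightarrow> (\<lambda>m. sided_mult left (q ^ m) (a m)) sums f q"
    and g: "\<And>q. q \<in> W \<Longrightarrow> g q = sided_Dbar left f q"
  shows "summable (\<lambda>m. sided_act left (a (Suc m)) (P2_power T (Suc m)))"
    and "(if left then P2_value_left T W g else P2_value_right T W g)
      (2 *\<^sub>R (\<Sum>m. sided_act left (a (Suc m)) (P2_power T (Suc m))))"
proof -
  obtain J0 U0 G0 where adm0: "admissible_contour T W J0 U0 G0"
    using exists_admissible_contour[OF r spec ball] by blast
  have "summable (\<lambda>m. 2 *\<^sub>R sided_act left (a (Suc m)) (P2_power T (Suc m)))"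
    by (rule sums_summable[OF P2_calculus(2)[OF f f r spec ball f_sums refl adm0]])
  then have "summable (\<lambda>m. (1 / 2) *\<^sub>R (2 *\<^sub>R sided_act left (a (Suc m)) (P2_power T (Suc m))))"
    by (rule summable_scaleR_right)
  then show sm: "summable (\<lambda>m. sided_act left (a (Suc m)) (P2_power T (Suc m)))" by simp
  have val: "(\<forall>\<gamma>\<in>G. sided_integrand left f' J \<gamma> integrable_on {0..1}) \<and>
      2 *\<^sub>R (\<Sum>m. sided_act left (a (Suc m)) (P2_power T (Suc m)))
        = (1 / (2 * pi)) *\<^sub>R (\<Sum>\<gamma>\<in>G. integral {0..1} (sided_integrand left f' J \<gamma>))"
    if f': "sided_slice_hyperholomorphic left W f'" and gf': "\<forall>q\<in>W. g q = sided_Dbar left f' q"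
      and adm: "admissible_contour T W J U G" for f' J U G
  proof -
    have D: "sided_Dbar left f q = sided_Dbar left f' q" if "q \<in> W" for q
      using g[OF that] gf' that by simp
    note P = P2_calculus[OF f f' r spec ball f_sums D adm]
    have "(\<lambda>m. 2 *\<^sub>R sided_act left (a (Suc m)) (P2_power T (Suc m))) sums
        (2 *\<^sub>R (\<Sum>m. sided_act left (a (Suc m)) (P2_power T (Suc m))))"
      by (rule sums_scaleR_right[OF summable_sums[OF sm]])
    from sums_unique2[OF this P(2)] show ?thesis using P(1) by simp
  qed
  show "(if left then P2_value_left T W g else P2_value_right T W g)
      (2 *\<^sub>R (\<Sum>m. sided_act left (a (Suc m)) (P2_power T (Suc m))))"
  proof (cases left)
    case True
    note defs = sided_slice_hyperholomorphic_def sided_Dbar_def sided_integrand_def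
    have "P2_value_left T W g (2 *\<^sub>R (\<Sum>m. sided_act left (a (Suc m)) (P2_power T (Suc m))))"
      unfolding P2_value_left_def
    proof (intro conjI)
      show "S_spectrum T \<subseteq> W" using spec ball by (rule subset_trans)
      show "\<exists>f. slice_hyperholomorphic_left W f \<and> (\<forall>q\<in>W. g q = Dbar_left f q)"
        using f g True by (intro exI[of _ f]) (simp add: defs)
      show "\<exists>J U G. admissible_contour T W J U G" using adm0 by (intro exI)
    qed (intro allI impI, elim conjE, use val True in \<open>simp add: defs\<close>)
    then show ?thesis using True by simp
  next
    case False
    note defs = sided_slice_hyperholomorphic_def sided_Dbar_def sided_integrand_def
    have "P2_value_right T W g (2 *\<^sub>R (\<Sum>m. sided_act left (a (Suc m)) (P2_power T (Suc m))))"
      unfolding P2_value_right_def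
    proof (intro conjI)
      show "S_spectrum T \<subseteq> W" using spec ball by (rule subset_trans)
      show "\<exists>f. slice_hyperholomorphic_right W f \<and> (\<forall>q\<in>W. g q = Dbar_right f q)"
        using f g False by (intro exI[of _ f]) (simp add: defs)
      show "\<exists>J U G. admissible_contour T W J U G" using adm0 by (intro exI)
    qed (intro allI impI, elim conjE, use val False in \<open>simp add: defs\<close>)
    then show ?thesis using False by simp
  qed
qed

end

theorem proposition3p18:
  fixes T :: "'a::banach hop" and T0 T1 T2 :: "'a \<Rightarrow>\<^sub>L 'a"
  assumes "T \<in> BCX"
    and "T = op_of_components T0 T1 T2 0"
    and "complex_spectrum T0 \<subseteq> \<real>" "complex_spectrum T1 \<subseteq> \<real>" "complex_spectrum T2 \<subseteq> \<real>"
  shows "(\<forall>(W :: quat set) (f :: quat \<Rightarrow> quat) (g :: quat \<Rightarrow> quat) (a :: nat \<Rightarrow> quat) (r :: real).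
            slice_hyperholomorphic_left W f \<and> S_spectrum T \<subseteq> W \<and>
            (\<forall>q\<in>W. g q = Dbar_left f q) \<and>
            0 < r \<and> S_spectrum T \<subseteq> ball 0 r \<and> ball 0 r \<subseteq> W \<and>
            (\<forall>q\<in>ball 0 r. (\<lambda>m. q ^ m * a m) sums f q) \<longrightarrow>
            summable (\<lambda>m. P2_power T (Suc m) o\<^sub>L lmult (a (Suc m))) \<and>
            P2_value_left T W g (2 *\<^sub>R (\<Sum>m. P2_power T (Suc m) o\<^sub>L lmult (a (Suc m)))))
       \<and> (\<forall>(W :: quat set) (f :: quat \<Rightarrow> quat) (g :: quat \<Rightarrow> quat) (a :: nat \<Rightarrow> quat) (r :: real).
            slice_hyperholomorphic_right W f \<and> S_spectrum T \<subseteq> W \<and>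
            (\<forall>q\<in>W. g q = Dbar_right f q) \<and>
            0 < r \<and> S_spectrum T \<subseteq> ball 0 r \<and> ball 0 r \<subseteq> W \<and>
            (\<forall>q\<in>ball 0 r. (\<lambda>m. a m * q ^ m) sums f q) \<longrightarrow>
            summable (\<lambda>m. lmult (a (Suc m)) o\<^sub>L P2_power T (Suc m)) \<and>
            P2_value_right T W g (2 *\<^sub>R (\<Sum>m. lmult (a (Suc m)) o\<^sub>L P2_power T (Suc m))))"
proof -
  obtain A0 A1 A2 A3 where T_A: "T = op_of_components A0 A1 A2 A3"
    and comm: "\<forall>A\<in>{A0, A1, A2, A3}. \<forall>B\<in>{A0, A1, A2, A3}. A o\<^sub>L B = B o\<^sub>L A"
    using assms(1) unfolding BCX_def by blast
  \<comment> \<open>Membership in \<open>BCX\<close> provides some commuting components; components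
    are unique, so these are \<open>T0\<close>, \<open>T1\<close> and \<open>T2\<close>.\<close>
  have A: "A0 = T0" "A1 = T1" "A2 = T2"
    using op_component_op_of_components[of A0 A1 A2 A3] unfolding T_A[symmetric] assms(2) by simp_all
  have "A0 o\<^sub>L A1 = A1 o\<^sub>L A0" "A0 o\<^sub>L A2 = A2 o\<^sub>L A0" "A1 o\<^sub>L A2 = A2 o\<^sub>L A1"
    using comm by blast+
  then interpret pv: paravector_operator T0 T1 T2
    unfolding A by (rule paravector_operator.intro)
  have T: "pv.T = T" by (simp add: pv.T_def assms(2))
  note left = pv.P2_value_sided[where left = True, unfolded T sided_slice_hyperholomorphic_def sided_mult_def
      sided_act_def sided_Dbar_def if_True]
  note right = pv.P2_value_sided[where left = False, unfolded T sided_slice_hyperholomorphic_def sided_mult_def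
      sided_act_def sided_Dbar_def if_False]
  show ?thesis
  proof (intro conjI allI impI; elim conjE)
    fix W :: "quat set" and f g a r
    assume hyp: "slice_hyperholomorphic_left W f" "\<forall>q\<in>W. g q = Dbar_left f q" "0 < r" "S_spectrum T \<subseteq> ball 0 r"
      "ball 0 r \<subseteq> W" "\<forall>q\<in>ball 0 r. (\<lambda>m. q ^ m * a m) sums f q"
    show "summable (\<lambda>m. P2_power T (Suc m) o\<^sub>L lmult (a (Suc m)))"
      "P2_value_left T W g (2 *\<^sub>R (\<Sum>m. P2_power T (Suc m) o\<^sub>L lmult (a (Suc m))))"
      by (rule left(1)[of W f r a g] left(2)[of W f r a g]; use hyp in blast)+
  next
    fix W :: "quat set" and f g a r
    assume hyp: "slice_hyperholomorphic_right W f" "\<forall>q\<in>W. g q = Dbar_right f q" "0 < r" "S_spectrum T \<subseteq> ball 0 r"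
      "ball 0 r \<subseteq> W" "\<forall>q\<in>ball 0 r. (\<lambda>m. a m * q ^ m) sums f q"
    show "summable (\<lambda>m. lmult (a (Suc m)) o\<^sub>L P2_power T (Suc m))"
      "P2_value_right T W g (2 *\<^sub>R (\<Sum>m. lmult (a (Suc m)) o\<^sub>L P2_power T (Suc m)))"
      by (rule right(1)[of W f r a g] right(2)[of W f r a g]; use hyp in blast)+
  qed
qed

end
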